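(* Let $\Lambda$ be a finitely aligned $k$-graph and let $K$ be a field. (1) Let $v\in\Lambda^0$. Then $\mathrm{KP}_K(\Lambda)p_v$ is a minimal left ideal of $\mathrm{KP}_K(\Lambda)$ if and only if $v\in P_l(\Lambda)$. (2) Let $a\in\mathrm{KP}_K(\Lambda)$. Then $\mathrm{KP}_K(\Lambda)a$ is a minimal left ideal of $\mathrm{KP}_K(\Lambda)$ if and only if there exists $v\in P_l(\Lambda)$ such that $\mathrm{KP}_K(\Lambda)p_v$ is isomorphic to $\mathrm{KP}_K(\Lambda)a$ as left $\mathrm{KP}_K(\Lambda)$-modules.
   Context: $k$-graphs. For a positive integer $k$, a $k$-graph is a countable small category $\Lambda$ with a functor $d:\Lambda\to\mathbb{N}^k$ (degree) satisfying unique factorisation: if $d(\lambda)=m+n$ there are unique $\mu,\nu\in\Lambda$ with $d(\mu)=m$, $d(\nu)=n$, $\lambda=\mu\nu$. $\Lambda^0=d^{-1}(0)$ is identified with the objects (vertices); $r,s$ are codomain and domain; $\mu\nu$ is defined when $s(\mu)=r(\nu)$; $v\Lambda=\{\lambda: r(\lambda)=v\}$. For $\lambda,\mu\in\Lambda$, $\Lambda^{\min}(\lambda,\mu)=\{(\rho,\tau): \lambda\rho=\mu\tau,\ d(\lambda\rho)=d(\lambda)\vee d(\mu)\}$, where $\vee$ is the coordinatewise maximum. $\Lambda$ is finitely aligned if $\Lambda^{\min}(\lambda,\mu)$ is finite (possibly empty) for all $\lambda,\mu$. A set $E\subseteq v\Lambda$ is exhaustive if for every $\lambda\in v\Lambda$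 there is $\mu\in E$ with $\Lambda^{\min}(\lambda,\mu)\neq\emptyset$; $\mathrm{FE}(\Lambda)$ is the collection of finite exhaustive sets $E\subseteq v\Lambda\setminus\{v\}$, $v\in\Lambda^0$, and $r(E)=v$ for such $E$. Boundary paths. For $m\in(\mathbb{N}\cup\{\infty\})^k$ let $\Omega_{k,m}$ be the $k$-graph $\{(p,q)\in\mathbb{N}^k\times\mathbb{N}^k: p\le q\le m\}$ with $r(p,q)=(p,p)$, $s(p,q)=(q,q)$, $d(p,q)=q-p$. A boundary path is a degree-preserving functor $x:\Omega_{k,m}\to\Lambda$ for some $m=:d(x)$ such that for every $n\in\mathbb{N}^k$ with $n\le d(x)$ and every $E\in\mathrm{FE}(\Lambda)$ with $r(E)=x(n,n)$ there is $\lambda\in E$ with $n+d(\lambda)\le d(x)$ and $x(n,n+d(\lambda))=\lambda$. The set of boundary paths is denoted $\delta\Lambda$, and $v\delta\Lambda=\{x\in\delta\Lambda: x(0,0)=v\}$. For $n\in\mathbb{N}^k$, $n\le d(x)$, the shift $\sigma^n(x)$ is the boundary path of degree $d(x)-n$ with $\sigma^n(x)(p,q)=x(n+p,n+q)$. $x\in\delta\Lambda$ is aperiodic if $\sigma^m(x)\ne\sigma^n(x)$ for all distinct $m,n\in\mathbb{N}^k$ with $m,n\le d(x)$ (equivalently, $x$ has trivial isotropy in the boundary path groupoid). Line points. $P_l(\Lambda)=\{v\in\Lambda^0: v\delta\Lambda=\{x\}\text{ for some } x, \text{ and } x\text{ is aperiodic}\}$. Kumjian–Pask algebra. $\mathrm{KP}_K(\Lambda)$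 is the universal $K$-algebra generated by elements $s_\lambda, s_{\lambda^*}$ ($\lambda\in\Lambda$), with $s_v=s_{v^*}=:p_v$ for $v\in\Lambda^0$, subject to: (KP1) the $p_v$ are mutually orthogonal idempotents; (KP2) $s_\lambda s_\mu=s_{\lambda\mu}$ and $s_{\mu^*}s_{\lambda^*}=s_{(\lambda\mu)^*}$ whenever $s(\lambda)=r(\mu)$; (KP3) $s_{\lambda^*}s_\mu=\sum_{(\rho,\tau)\in\Lambda^{\min}(\lambda,\mu)}s_\rho s_{\tau^*}$ for all $\lambda,\mu\in\Lambda$; (KP4) $\prod_{\lambda\in E}(p_{r(E)}-s_\lambda s_{\lambda^*})=0$ for all $E\in\mathrm{FE}(\Lambda)$. Equivalently, $\mathrm{KP}_K(\Lambda)$ is the Steinberg algebra over $K$ of the boundary path groupoid $\mathcal{G}_\Lambda$, whose unit space is identified with $\delta\Lambda$, with $p_v$ corresponding to the characteristic function of $Z(v)=v\delta\Lambda$. A minimal left ideal is a nonzero left ideal containing no left ideals other than $0$ and itself. *)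

theory Defs
  imports
    "HOL-Algebra.QuotRing"
    "HOL-Library.Poly_Mapping"
    "HOL-Library.Function_Algebras"
    "HOL-Library.Extended_Nat"
    "HOL-Library.Countable_Set"
    "HOL-Library.FuncSet"
begin

section \<open>k-graphs\<close>

text \<open>
  The rank is \<open>k = CARD('k)\<close> for a finite type \<open>'k\<close> (so \<open>k \<ge> 1\<close>) and \<open>\<nat>\<^sup>k\<close> is the type
  \<open>'k \<Rightarrow> nat\<close> with its pointwise \<open>0\<close>, \<open>+\<close>, \<open>-\<close>, \<open>\<le>\<close> and \<open>sup\<close>. A small category is given by its
  morphisms; an object is identified with its identity morphism, so range and source are
  themselves morphisms. \<open>cmp \<Lambda> \<mu> \<nu>\<close> is the composite \<open>\<mu>\<nu>\<close>, meaningful when \<open>src \<Lambda> \<mu> = rng \<Lambda> \<nu>\<close>.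
\<close>

record ('a, 'k) kgraph =
  Mor :: "'a set"
  rng :: "'a \<Rightarrow> 'a"
  src :: "'a \<Rightarrow> 'a"
  cmp :: "'a \<Rightarrow> 'a \<Rightarrow> 'a"
  deg :: "'a \<Rightarrow> 'k \<Rightarrow> nat"

locale k_graph =
  fixes \<Lambda> :: "('a, 'k::finite) kgraph"
  assumes countable_Mor: "countable (Mor \<Lambda>)"
    and rng_closed: "\<alpha> \<in> Mor \<Lambda> \<Longrightarrow> rng \<Lambda> \<alpha> \<in> Mor \<Lambda>"
    and src_closed: "\<alpha> \<in> Mor \<Lambda> \<Longrightarrow> src \<Lambda> \<alpha> \<in> Mor \<Lambda>"
    and rng_rng: "\<alpha> \<in> Mor \<Lambda> \<Longrightarrow> rng \<Lambda> (rng \<Lambda> \<alpha>) = rng \<Lambda> \<alpha>"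
    and src_rng: "\<alpha> \<in> Mor \<Lambda> \<Longrightarrow> src \<Lambda> (rng \<Lambda> \<alpha>) = rng \<Lambda> \<alpha>"
    and rng_src: "\<alpha> \<in> Mor \<Lambda> \<Longrightarrow> rng \<Lambda> (src \<Lambda> \<alpha>) = src \<Lambda> \<alpha>"
    and src_src: "\<alpha> \<in> Mor \<Lambda> \<Longrightarrow> src \<Lambda> (src \<Lambda> \<alpha>) = src \<Lambda> \<alpha>"
    and cmp_closed: "\<lbrakk>\<alpha> \<in> Mor \<Lambda>; \<mu> \<in> Mor \<Lambda>; src \<Lambda> \<alpha> = rng \<Lambda> \<mu>\<rbrakk> \<Longrightarrow> cmp \<Lambda> \<alpha> \<mu> \<in> Mor \<Lambda>"
    and rng_cmp: "\<lbrakk>\<alpha> \<in> Mor \<Lambda>; \<mu> \<in> Mor \<Lambda>; src \<Lambda> \<alpha> = rng \<Lambda> \<mu>\<rbrakk> \<Longrightarrow> rng \<Lambda> (cmp \<Lambda> \<alpha> \<mu>) = rng \<Lambda> \<alpha>"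
    and src_cmp: "\<lbrakk>\<alpha> \<in> Mor \<Lambda>; \<mu> \<in> Mor \<Lambda>; src \<Lambda> \<alpha> = rng \<Lambda> \<mu>\<rbrakk> \<Longrightarrow> src \<Lambda> (cmp \<Lambda> \<alpha> \<mu>) = src \<Lambda> \<mu>"
    and cmp_assoc: "\<lbrakk>\<alpha> \<in> Mor \<Lambda>; \<mu> \<in> Mor \<Lambda>; \<nu> \<in> Mor \<Lambda>; src \<Lambda> \<alpha> = rng \<Lambda> \<mu>; src \<Lambda> \<mu> = rng \<Lambda> \<nu>\<rbrakk>
      \<Longrightarrow> cmp \<Lambda> (cmp \<Lambda> \<alpha> \<mu>) \<nu> = cmp \<Lambda> \<alpha> (cmp \<Lambda> \<mu> \<nu>)"
    and cmp_rng: "\<alpha> \<in> Mor \<Lambda> \<Longrightarrow> cmp \<Lambda> (rng \<Lambda> \<alpha>) \<alpha> = \<alpha>"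
    and cmp_src: "\<alpha> \<in> Mor \<Lambda> \<Longrightarrow> cmp \<Lambda> \<alpha> (src \<Lambda> \<alpha>) = \<alpha>"
    and deg_rng: "\<alpha> \<in> Mor \<Lambda> \<Longrightarrow> deg \<Lambda> (rng \<Lambda> \<alpha>) = 0"
    and deg_src: "\<alpha> \<in> Mor \<Lambda> \<Longrightarrow> deg \<Lambda> (src \<Lambda> \<alpha>) = 0"
    and deg_cmp: "\<lbrakk>\<alpha> \<in> Mor \<Lambda>; \<mu> \<in> Mor \<Lambda>; src \<Lambda> \<alpha> = rng \<Lambda> \<mu>\<rbrakk>
      \<Longrightarrow> deg \<Lambda> (cmp \<Lambda> \<alpha> \<mu>) = deg \<Lambda> \<alpha> + deg \<Lambda> \<mu>"
    and unique_factorisation: "\<lbrakk>\<alpha> \<in> Mor \<Lambda>; deg \<Lambda> \<alpha> = m + n\<rbrakk> \<Longrightarrow>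
      \<exists>!p. case p of (\<mu>, \<nu>) \<Rightarrow> \<mu> \<in> Mor \<Lambda> \<and> \<nu> \<in> Mor \<Lambda> \<and> src \<Lambda> \<mu> = rng \<Lambda> \<nu> \<and>
        deg \<Lambda> \<mu> = m \<and> deg \<Lambda> \<nu> = n \<and> \<alpha> = cmp \<Lambda> \<mu> \<nu>"

definition vertices :: "('a, 'k) kgraph \<Rightarrow> 'a set" where
  "vertices \<Lambda> = {v \<in> Mor \<Lambda>. deg \<Lambda> v = 0}"

definition paths_from :: "('a, 'k) kgraph \<Rightarrow> 'a \<Rightarrow> 'a set" where
  "paths_from \<Lambda> v = {\<alpha> \<in> Mor \<Lambda>. rng \<Lambda> \<alpha> = v}"

definition min_ext :: "('a, 'k) kgraph \<Rightarrow> 'a \<Rightarrow> 'a \<Rightarrow> ('a \<times> 'a) set" where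
  "min_ext \<Lambda> \<alpha> \<mu> = {(\<rho>, \<tau>). \<rho> \<in> Mor \<Lambda> \<and> \<tau> \<in> Mor \<Lambda> \<and>
     src \<Lambda> \<alpha> = rng \<Lambda> \<rho> \<and> src \<Lambda> \<mu> = rng \<Lambda> \<tau> \<and>
     cmp \<Lambda> \<alpha> \<rho> = cmp \<Lambda> \<mu> \<tau> \<and> deg \<Lambda> (cmp \<Lambda> \<alpha> \<rho>) = sup (deg \<Lambda> \<alpha>) (deg \<Lambda> \<mu>)}"

definition finitely_aligned :: "('a, 'k) kgraph \<Rightarrow> bool" where
  "finitely_aligned \<Lambda> \<longleftrightarrow> (\<forall>\<alpha>\<in>Mor \<Lambda>. \<forall>\<mu>\<in>Mor \<Lambda>. finite (min_ext \<Lambda> \<alpha> \<mu>))"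

definition exhaustive :: "('a, 'k) kgraph \<Rightarrow> 'a \<Rightarrow> 'a set \<Rightarrow> bool" where
  "exhaustive \<Lambda> v E \<longleftrightarrow> E \<subseteq> paths_from \<Lambda> v \<and>
     (\<forall>\<alpha>\<in>paths_from \<Lambda> v. \<exists>\<mu>\<in>E. min_ext \<Lambda> \<alpha> \<mu> \<noteq> {})"

text \<open>\<open>FE_at \<Lambda> v\<close> is the set of \<open>E \<in> FE(\<Lambda>)\<close> with \<open>r(E) = v\<close>. Such \<open>E\<close> are nonempty because
  \<open>v\<close> itself belongs to \<open>v\<Lambda>\<close>.\<close>

definition FE_at :: "('a, 'k) kgraph \<Rightarrow> 'a \<Rightarrow> 'a set set" where
  "FE_at \<Lambda> v = {E. finite E \<and> E \<subseteq> paths_from \<Lambda> v - {v} \<and> exhaustive \<Lambda> v E}"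


section \<open>Boundary paths and line points\<close>

definition below :: "('k \<Rightarrow> nat) \<Rightarrow> ('k \<Rightarrow> enat) \<Rightarrow> bool" where
  "below n m \<longleftrightarrow> (\<forall>i. enat (n i) \<le> m i)"

definition Omega :: "('k \<Rightarrow> enat) \<Rightarrow> (('k \<Rightarrow> nat) \<times> ('k \<Rightarrow> nat), 'k) kgraph" where
  "Omega m = \<lparr>Mor = {(p, q). p \<le> q \<and> below q m},
     rng = (\<lambda>(p, q). (p, p)), src = (\<lambda>(p, q). (q, q)),
     cmp = (\<lambda>(p, q) (p', q'). (p, q')), deg = (\<lambda>(p, q). q - p)\<rparr>"

definition degree_preserving_functor ::
    "('a, 'k) kgraph \<Rightarrow> ('b, 'k) kgraph \<Rightarrow> ('a \<Rightarrow> 'b) \<Rightarrow> bool" where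
  "degree_preserving_functor \<Gamma> \<Lambda> x \<longleftrightarrow>
     (\<forall>\<alpha>\<in>Mor \<Gamma>. x \<alpha> \<in> Mor \<Lambda> \<and> x (rng \<Gamma> \<alpha>) = rng \<Lambda> (x \<alpha>) \<and>
        x (src \<Gamma> \<alpha>) = src \<Lambda> (x \<alpha>) \<and> deg \<Lambda> (x \<alpha>) = deg \<Gamma> \<alpha>) \<and>
     (\<forall>\<alpha>\<in>Mor \<Gamma>. \<forall>\<mu>\<in>Mor \<Gamma>. src \<Gamma> \<alpha> = rng \<Gamma> \<mu> \<longrightarrow>
        x (cmp \<Gamma> \<alpha> \<mu>) = cmp \<Lambda> (x \<alpha>) (x \<mu>))"

text \<open>A path is stored together with its degree. Its values outside \<open>\<Omega>\<^bsub>k,m\<^esub>\<close> are fixed to be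
  \<open>undefined\<close>, so that equality of paths is equality of functors.\<close>

type_synonym ('a, 'k) path = "('k \<Rightarrow> enat) \<times> (('k \<Rightarrow> nat) \<times> ('k \<Rightarrow> nat) \<Rightarrow> 'a)"

definition boundary_paths :: "('a, 'k) kgraph \<Rightarrow> ('a, 'k) path set" where
  "boundary_paths \<Lambda> = {(m, x). x \<in> extensional (Mor (Omega m)) \<and>
     degree_preserving_functor (Omega m) \<Lambda> x \<and>
     (\<forall>n. below n m \<longrightarrow> (\<forall>E\<in>FE_at \<Lambda> (x (n, n)).
        \<exists>\<alpha>\<in>E. below (n + deg \<Lambda> \<alpha>) m \<and> x (n, n + deg \<Lambda> \<alpha>) = \<alpha>))}"

definition boundary_paths_from :: "('a, 'k) kgraph \<Rightarrow> 'a \<Rightarrow> ('a, 'k) path set" where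
  "boundary_paths_from \<Lambda> v = {(m, x) \<in> boundary_paths \<Lambda>. x (0, 0) = v}"

definition shift :: "('k \<Rightarrow> nat) \<Rightarrow> ('a, 'k) path \<Rightarrow> ('a, 'k) path" where
  "shift n y = (case y of (m, x) \<Rightarrow>
     let m' = (\<lambda>i. m i - enat (n i))
     in (m', restrict (\<lambda>(p, q). x (n + p, n + q)) (Mor (Omega m'))))"

definition aperiodic :: "('a, 'k) path \<Rightarrow> bool" where
  "aperiodic y \<longleftrightarrow>
     (\<forall>m n. below m (fst y) \<longrightarrow> below n (fst y) \<longrightarrow> m \<noteq> n \<longrightarrow> shift m y \<noteq> shift n y)"

definition line_points :: "('a, 'k) kgraph \<Rightarrow> 'a set" where
  "line_points \<Lambda> = {v \<in> vertices \<Lambda>. \<exists>y. boundary_paths_from \<Lambda> v = {y} \<and> aperiodic y}"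


section \<open>The Kumjian--Pask algebra\<close>

instantiation list :: (type) monoid_add
begin

definition zero_list :: "'a list" where "zero_list = []"

definition plus_list :: "'a list \<Rightarrow> 'a list \<Rightarrow> 'a list" where "plus_list = append"

instance by standard (simp_all add: zero_list_def plus_list_def)

end

text \<open>\<open>Path \<alpha>\<close> and \<open>Ghost \<alpha>\<close> are the formal symbols for \<open>s\<^bsub>\<alpha>\<^esub>\<close> and \<open>s\<^bsub>\<alpha>*\<^esub>\<close>. With concatenation of
  words as addition of exponents, \<open>'a letter list \<Rightarrow>\<^sub>0 'f\<close> carries the convolution product of the
  free unital \<open>'f\<close>-algebra on these symbols.\<close>

datatype 'a letter = Path 'a | Ghost 'a

type_synonym ('a, 'f) free = "'a letter list \<Rightarrow>\<^sub>0 'f"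

definition letters :: "('a, 'k) kgraph \<Rightarrow> 'a letter set" where
  "letters \<Lambda> = Path ` Mor \<Lambda> \<union> Ghost ` Mor \<Lambda>"

definition free_algebra :: "'f::field itself \<Rightarrow> ('a, 'k) kgraph \<Rightarrow> ('a, 'f) free ring" where
  "free_algebra K \<Lambda> = \<lparr>carrier = {f. Poly_Mapping.keys f \<subseteq> lists (letters \<Lambda>)},
     mult = (*), one = 1, zero = 0, add = (+)\<rparr>"

abbreviation gen :: "'a letter \<Rightarrow> ('a, 'f::field) free" where
  "gen l \<equiv> Poly_Mapping.single [l] 1"

text \<open>Every element of this set is set to zero in the quotient. The first part identifies \<open>s\<^bsub>v\<^esub>\<close> with \<open>s\<^bsub>v*\<^esub>\<close>.
  The factors of the product in the last relation do not commute in the free algebra, so the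
  relation is imposed for every ordering \<open>xs\<close> of \<open>E\<close>; modulo the other relations the factors
  commute and all orderings give the same relation.\<close>

definition kp_relations :: "'f::field itself \<Rightarrow> ('a, 'k) kgraph \<Rightarrow> ('a, 'f) free set" where
  "kp_relations K \<Lambda> =
     {gen (Path v) - gen (Ghost v) | v. v \<in> vertices \<Lambda>} \<union>
     {gen (Path v) * gen (Path v) - gen (Path v) | v. v \<in> vertices \<Lambda>} \<union>
     {gen (Path v) * gen (Path w) | v w. v \<in> vertices \<Lambda> \<and> w \<in> vertices \<Lambda> \<and> v \<noteq> w} \<union>
     {gen (Path \<alpha>) * gen (Path \<mu>) - gen (Path (cmp \<Lambda> \<alpha> \<mu>)) | \<alpha> \<mu>.
        \<alpha> \<in> Mor \<Lambda> \<and> \<mu> \<in> Mor \<Lambda> \<and> src \<Lambda> \<alpha> = rng \<Lambda> \<mu>} \<union>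
     {gen (Ghost \<mu>) * gen (Ghost \<alpha>) - gen (Ghost (cmp \<Lambda> \<alpha> \<mu>)) | \<alpha> \<mu>.
        \<alpha> \<in> Mor \<Lambda> \<and> \<mu> \<in> Mor \<Lambda> \<and> src \<Lambda> \<alpha> = rng \<Lambda> \<mu>} \<union>
     {gen (Ghost \<alpha>) * gen (Path \<mu>)
        - (\<Sum>(\<rho>, \<tau>)\<in>min_ext \<Lambda> \<alpha> \<mu>. gen (Path \<rho>) * gen (Ghost \<tau>)) | \<alpha> \<mu>.
        \<alpha> \<in> Mor \<Lambda> \<and> \<mu> \<in> Mor \<Lambda>} \<union>
     {prod_list (map (\<lambda>\<alpha>. gen (Path v) - gen (Path \<alpha>) * gen (Ghost \<alpha>)) xs) | v xs.
        v \<in> vertices \<Lambda> \<and> distinct xs \<and> set xs \<in> FE_at \<Lambda> v}"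

definition kp_ideal :: "'f::field itself \<Rightarrow> ('a, 'k) kgraph \<Rightarrow> ('a, 'f) free set" where
  "kp_ideal K \<Lambda> = Idl\<^bsub>free_algebra K \<Lambda>\<^esub> (kp_relations K \<Lambda>)"

definition kp_class :: "'f::field itself \<Rightarrow> ('a, 'k) kgraph \<Rightarrow> ('a, 'f) free \<Rightarrow> ('a, 'f) free set" where
  "kp_class K \<Lambda> f = kp_ideal K \<Lambda> +>\<^bsub>free_algebra K \<Lambda>\<^esub> f"

text \<open>\<open>KP\<^bsub>K\<^esub>(\<Lambda>)\<close> is not unital in general: the universal algebra on the generators consists of the
  classes of free-algebra elements with zero constant term (the empty word does not occur).
  All relations have zero constant term, so this is the free non-unital algebra modulo the
  ideal they generate. Consequently the field \<open>one\<close> of this record, inherited from the quotient of the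
  free unital algebra, need not lie in its carrier and must not be used.\<close>

definition kp_algebra :: "'f::field itself \<Rightarrow> ('a, 'k) kgraph \<Rightarrow> ('a, 'f) free set ring" where
  "kp_algebra K \<Lambda> = (free_algebra K \<Lambda> Quot kp_ideal K \<Lambda>)
     \<lparr>carrier := kp_class K \<Lambda> ` {f \<in> carrier (free_algebra K \<Lambda>). [] \<notin> Poly_Mapping.keys f}\<rparr>"

definition kp_vertex :: "'f::field itself \<Rightarrow> ('a, 'k) kgraph \<Rightarrow> 'a \<Rightarrow> ('a, 'f) free set" where
  "kp_vertex K \<Lambda> v = kp_class K \<Lambda> (gen (Path v))"


section \<open>Left ideals of possibly non-unital rings\<close>

text \<open>None of the following definitions refers to the field \<open>one\<close> of \<open>R\<close>. The left ideal \<open>R a\<close> is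
  the library's \<open>PIdl\<^bsub>R\<^esub> a = {x \<otimes>\<^bsub>R\<^esub> a | x. x \<in> carrier R}\<close>.\<close>

definition left_ideal :: "'a set \<Rightarrow> ('a, 'b) ring_scheme \<Rightarrow> bool" where
  "left_ideal J R \<longleftrightarrow> additive_subgroup J R \<and>
     (\<forall>a\<in>carrier R. \<forall>x\<in>J. a \<otimes>\<^bsub>R\<^esub> x \<in> J)"

definition minimal_left_ideal :: "'a set \<Rightarrow> ('a, 'b) ring_scheme \<Rightarrow> bool" where
  "minimal_left_ideal J R \<longleftrightarrow> left_ideal J R \<and> J \<noteq> {\<zero>\<^bsub>R\<^esub>} \<and>
     (\<forall>J'. left_ideal J' R \<and> J' \<subseteq> J \<longrightarrow> J' = {\<zero>\<^bsub>R\<^esub>} \<or> J' = J)"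

definition left_module_isomorphic :: "('a, 'b) ring_scheme \<Rightarrow> 'a set \<Rightarrow> 'a set \<Rightarrow> bool" where
  "left_module_isomorphic R M N \<longleftrightarrow> (\<exists>\<phi>. bij_betw \<phi> M N \<and>
     (\<forall>x\<in>M. \<forall>y\<in>M. \<phi> (x \<oplus>\<^bsub>R\<^esub> y) = \<phi> x \<oplus>\<^bsub>R\<^esub> \<phi> y) \<and>
     (\<forall>a\<in>carrier R. \<forall>x\<in>M. \<phi> (a \<otimes>\<^bsub>R\<^esub> x) = a \<otimes>\<^bsub>R\<^esub> \<phi> x))"

end

theory Submission
  imports Defs
begin

text \<open>
  Write \<open>A\<close> for the Kumjian--Pask algebra, \<open>s\<^sub>\<alpha>\<close> for the generator of a path and \<open>s\<^sub>\<alpha>*\<close> for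
  its ghost. A left ideal \<open>Aa\<close> is minimal iff \<open>a \<noteq> 0\<close> and every nonzero \<open>ga\<close> can be
  multiplied back to \<open>a\<close>; such an \<open>a\<close> is called \<open>simple\<close> below, and
  \<open>minimal_left_ideal_iff_simple\<close> holds because \<open>A\<close> has local units.

  Line points have a description by finite paths (\<open>line_points_iff\<close>): \<open>v\<close> is one iff any two paths
  with range \<open>v\<close> have a common extension, and coincide if they have the same source. Both halves of
  the first part of the theorem go through this description.

  Two tools do the work. The first is an action of \<open>A\<close> on functions from boundary paths to a ring
  of Laurent polynomials, in which \<open>s\<^sub>\<alpha>\<close> moves a path \<open>x\<close> to \<open>\<alpha>x\<close> and multiplies by a
  monomial recording \<open>d(\<alpha>)\<close>. It shows that elements are nonzero, and it detects periodicity: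
  if some \<open>t\<close> acts on the point mass at \<open>x\<close> as a monomial \<open>z \<noteq> 1\<close>, then \<open>t - s\<^sub>v\<close>, where
  \<open>v = r(x)\<close>, acts as \<open>z - 1\<close>, which is not a unit; therefore no element acting on that point mass as a nonzero
  Laurent polynomial can be simple (\<open>not_simple_of_monomial\<close>). The second is a \<open>reduction\<close>: every nonzero \<open>f\<close> can be multiplied
  on the left by a ghost so as to become a combination of distinct ghosts with a common source, all
  coefficients being nonzero.

  If \<open>v\<close> is a line point, the reduction turns any nonzero \<open>g s\<^sub>v\<close> into a multiple of a single
  ghost \<open>s\<^sub>\<nu>*\<close>, and \<open>s\<^sub>\<nu> s\<^sub>\<nu>* = s\<^sub>v\<close>, so \<open>s\<^sub>v\<close> is simple. Conversely, let \<open>s\<^sub>v\<close> be simple. Two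
  paths without common extension would give \<open>s\<^sub>v = h s\<^sub>\<mu>*\<close> and \<open>s\<^sub>\<mu>* s\<^sub>\<beta> = 0\<close>, hence \<open>s\<^sub>\<beta> = 0\<close>;
  and two different paths with the same source would give the forbidden periodicity.

  For the second part let \<open>a\<close> be simple. Reduce it to a combination of ghosts \<open>s\<^sub>\<nu>*\<close> and
  multiply by \<open>s\<^sub>\<tau>*\<close> on the left and by one \<open>s\<^sub>\<nu>\<^sub>\<tau>\<close> on the right, with \<open>\<tau>\<close> chosen to leave
  as few terms as possible. If more than one term survives, the surviving terms fix a boundary path up
  to different monomials, which is the forbidden periodicity again. So a multiple of \<open>s\<^sub>w\<close>, with
  \<open>w = s(\<tau>)\<close>, is left. Then \<open>s\<^sub>w\<close> is simple and \<open>w\<close> is a line point, and there is a nonzero homomorphism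
  \<open>A s\<^sub>w \<rightarrow> Aa\<close> between simple modules.
\<close>

section \<open>Initial segments and common extensions of paths\<close>

context k_graph
begin

abbreviation M :: "'a set" where "M \<equiv> Mor \<Lambda>"
abbreviation rg :: "'a \<Rightarrow> 'a" where "rg \<equiv> rng \<Lambda>"
abbreviation sr :: "'a \<Rightarrow> 'a" where "sr \<equiv> src \<Lambda>"
abbreviation dg :: "'a \<Rightarrow> 'k \<Rightarrow> nat" where "dg \<equiv> deg \<Lambda>"
abbreviation comp :: "'a \<Rightarrow> 'a \<Rightarrow> 'a" (infixl "\<cdot>" 70) where "\<alpha> \<cdot> \<mu> \<equiv> cmp \<Lambda> \<alpha> \<mu>"

lemmas mor_simps [simp] = rng_closed src_closed rng_rng src_rng rng_src src_src cmp_closed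
  rng_cmp src_cmp cmp_rng cmp_src deg_rng deg_src deg_cmp

lemma comp_inject:
  assumes "\<alpha> \<in> M" "\<beta> \<in> M" "sr \<alpha> = rg \<beta>" "\<alpha>' \<in> M" "\<beta>' \<in> M" "sr \<alpha>' = rg \<beta>'"
    and "\<alpha> \<cdot> \<beta> = \<alpha>' \<cdot> \<beta>'" "dg \<alpha> = dg \<alpha>'"
  shows "\<alpha> = \<alpha>'" "\<beta> = \<beta>'"
proof -
  have "dg (\<alpha> \<cdot> \<beta>) = dg (\<alpha>' \<cdot> \<beta>')" using assms(7) by simp
  then have "dg \<alpha> + dg \<beta> = dg \<alpha> + dg \<beta>'"
    unfolding deg_cmp[OF assms(1-3)] deg_cmp[OF assms(4-6)] assms(8) .
  then have d: "dg \<beta> = dg \<beta>'" by (simp only: add_left_cancel)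
  let ?Q = "\<lambda>p. case p of (\<mu>, \<nu>) \<Rightarrow> \<mu> \<in> M \<and> \<nu> \<in> M \<and> sr \<mu> = rg \<nu> \<and>
    dg \<mu> = dg \<alpha> \<and> dg \<nu> = dg \<beta> \<and> \<alpha> \<cdot> \<beta> = \<mu> \<cdot> \<nu>"
  have "\<exists>!p. ?Q p" using assms(1-3) by (intro unique_factorisation) simp_all
  note uniq = the1_equality[OF this]
  have "?Q (\<alpha>, \<beta>)" using assms by simp
  moreover have "?Q (\<alpha>', \<beta>')" unfolding case_prod_conv using assms(4-8) d by metis
  ultimately have "(\<alpha>, \<beta>) = (\<alpha>', \<beta>')" using uniq[of "(\<alpha>, \<beta>)"] uniq[of "(\<alpha>', \<beta>')"] by metis
  then show "\<alpha> = \<alpha>'" "\<beta> = \<beta>'" by auto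
qed

lemma comp_cancel_left:
  assumes "\<alpha> \<in> M" "\<beta> \<in> M" "sr \<alpha> = rg \<beta>" "\<beta>' \<in> M" "sr \<alpha> = rg \<beta>'" "\<alpha> \<cdot> \<beta> = \<alpha> \<cdot> \<beta>'"
  shows "\<beta> = \<beta>'"
  using comp_inject(2)[OF assms(1-3) assms(1) assms(4-6)] by simp

lemma comp_cancel_right:
  assumes "\<alpha> \<in> M" "\<beta> \<in> M" "sr \<alpha> = rg \<beta>" "\<alpha>' \<in> M" "sr \<alpha>' = rg \<beta>" "\<alpha> \<cdot> \<beta> = \<alpha>' \<cdot> \<beta>"
  shows "\<alpha> = \<alpha>'"
proof -
  have "dg \<alpha> + dg \<beta> = dg \<alpha>' + dg \<beta>" using assms deg_cmp by metis
  then have "dg \<alpha> = dg \<alpha>'" by (metis add_right_cancel)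
  then show ?thesis using comp_inject(1)[OF assms(1-3) assms(4) assms(2) assms(5,6)] by simp
qed

lemma factor:
  assumes "\<gamma> \<in> M" "m \<le> dg \<gamma>"
  obtains \<alpha> \<beta> where "\<alpha> \<in> M" "\<beta> \<in> M" "sr \<alpha> = rg \<beta>" "dg \<alpha> = m" "\<gamma> = \<alpha> \<cdot> \<beta>"
proof -
  have "dg \<gamma> = m + (dg \<gamma> - m)" using assms(2) by (auto simp: le_fun_def)
  from unique_factorisation[OF assms(1) this] that show thesis by (auto dest!: ex1_implies_ex)
qed

lemma vertex_rng_src:
  assumes "v \<in> vertices \<Lambda>"
  shows "v \<in> M" "rg v = v" "sr v = v"
proof -
  have v: "v \<in> M" "dg v = 0" using assms by (auto simp: vertices_def)
  have "rg v = v" "v = sr v"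
    using comp_inject[of "rg v" v v "sr v"] v
    by (simp_all only: cmp_rng cmp_src deg_rng rng_closed src_closed src_rng rng_src)
  then show "v \<in> M" "rg v = v" "sr v = v" using v by auto
qed

lemma rng_vertex [simp]: "\<alpha> \<in> M \<Longrightarrow> rg \<alpha> \<in> vertices \<Lambda>"
  and src_vertex [simp]: "\<alpha> \<in> M \<Longrightarrow> sr \<alpha> \<in> vertices \<Lambda>"
  by (auto simp: vertices_def)

definition prefix :: "'a \<Rightarrow> 'a \<Rightarrow> bool" where
  "prefix \<alpha> \<gamma> \<longleftrightarrow> \<alpha> \<in> M \<and> (\<exists>\<beta>\<in>M. sr \<alpha> = rg \<beta> \<and> \<gamma> = \<alpha> \<cdot> \<beta>)"

lemma prefixI: "\<alpha> \<in> M \<Longrightarrow> \<beta> \<in> M \<Longrightarrow> sr \<alpha> = rg \<beta> \<Longrightarrow> prefix \<alpha> (\<alpha> \<cdot> \<beta>)"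
  by (auto simp: prefix_def)

lemma prefixE:
  assumes "prefix \<alpha> \<gamma>"
  obtains \<beta> where "\<alpha> \<in> M" "\<beta> \<in> M" "sr \<alpha> = rg \<beta>" "\<gamma> = \<alpha> \<cdot> \<beta>"
  using assms by (auto simp: prefix_def)

lemma prefix_mor: "prefix \<alpha> \<gamma> \<Longrightarrow> \<alpha> \<in> M" "prefix \<alpha> \<gamma> \<Longrightarrow> \<gamma> \<in> M"
  by (auto simp: prefix_def)

lemma prefix_rng: "prefix \<alpha> \<gamma> \<Longrightarrow> rg \<alpha> = rg \<gamma>"
  by (auto simp: prefix_def)

lemma prefix_deg: "prefix \<alpha> \<gamma> \<Longrightarrow> dg \<alpha> \<le> dg \<gamma>"
  by (auto simp: prefix_def le_fun_def)

lemma prefix_refl: "\<alpha> \<in> M \<Longrightarrow> prefix \<alpha> \<alpha>"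
  unfolding prefix_def by (intro conjI bexI[of _ "sr \<alpha>"]) auto

lemma prefix_trans:
  assumes "prefix \<alpha> \<beta>" "prefix \<beta> \<gamma>" shows "prefix \<alpha> \<gamma>"
proof -
  from assms obtain \<beta>' \<gamma>' where "\<alpha> \<in> M" "\<beta>' \<in> M" "sr \<alpha> = rg \<beta>'" "\<beta> = \<alpha> \<cdot> \<beta>'"
    "\<gamma>' \<in> M" "sr \<beta> = rg \<gamma>'" "\<gamma> = \<beta> \<cdot> \<gamma>'" by (metis prefixE)
  then show ?thesis using prefixI[of \<alpha> "\<beta>' \<cdot> \<gamma>'"] cmp_assoc by simp
qed

lemma prefix_comp_mono:
  assumes "\<kappa> \<in> M" "sr \<kappa> = rg \<alpha>" "prefix \<alpha> \<gamma>" shows "prefix (\<kappa> \<cdot> \<alpha>) (\<kappa> \<cdot> \<gamma>)"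
  using assms(3)
proof (rule prefixE)
  fix \<beta> assume "\<alpha> \<in> M" "\<beta> \<in> M" "sr \<alpha> = rg \<beta>" "\<gamma> = \<alpha> \<cdot> \<beta>"
  then show ?thesis using assms prefixI[of "\<kappa> \<cdot> \<alpha>" \<beta>] cmp_assoc by simp
qed

lemma prefix_comp_cancel:
  assumes "\<kappa> \<in> M" "\<alpha> \<in> M" "\<gamma> \<in> M" "sr \<kappa> = rg \<alpha>" "sr \<kappa> = rg \<gamma>" "prefix (\<kappa> \<cdot> \<alpha>) (\<kappa> \<cdot> \<gamma>)"
  shows "prefix \<alpha> \<gamma>"
  using assms(6)
proof (rule prefixE)
  fix \<beta> assume b: "\<beta> \<in> M" "sr (\<kappa> \<cdot> \<alpha>) = rg \<beta>" "\<kappa> \<cdot> \<gamma> = \<kappa> \<cdot> \<alpha> \<cdot> \<beta>"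
  then have "\<kappa> \<cdot> \<gamma> = \<kappa> \<cdot> (\<alpha> \<cdot> \<beta>)" using assms cmp_assoc by simp
  then have "\<gamma> = \<alpha> \<cdot> \<beta>" using assms b comp_cancel_left[of \<kappa> \<gamma> "\<alpha> \<cdot> \<beta>"] by simp
  then show ?thesis using assms b prefixI by simp
qed

lemma prefix_eq_deg:
  assumes "prefix \<alpha> \<gamma>" "prefix \<beta> \<gamma>" "dg \<alpha> = dg \<beta>" shows "\<alpha> = \<beta>"
proof -
  obtain \<alpha>' where "\<alpha> \<in> M" "\<alpha>' \<in> M" "sr \<alpha> = rg \<alpha>'" "\<gamma> = \<alpha> \<cdot> \<alpha>'" using assms(1) by (rule prefixE)
  moreover obtain \<beta>' where "\<beta> \<in> M" "\<beta>' \<in> M" "sr \<beta> = rg \<beta>'" "\<gamma> = \<beta> \<cdot> \<beta>'"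
    using assms(2) by (rule prefixE)
  ultimately show ?thesis using comp_inject(1)[of \<alpha> \<alpha>' \<beta> \<beta>'] assms(3) by simp
qed

lemma prefix_of_deg_le:
  assumes "prefix \<alpha> \<gamma>" "prefix \<beta> \<gamma>" "dg \<alpha> \<le> dg \<beta>" shows "prefix \<alpha> \<beta>"
proof -
  obtain \<alpha>' \<beta>' where "\<alpha>' \<in> M" "\<beta>' \<in> M" "sr \<alpha>' = rg \<beta>'" "dg \<alpha>' = dg \<alpha>" "\<beta> = \<alpha>' \<cdot> \<beta>'"
    using factor[OF prefix_mor(1)[OF assms(2)] assms(3)] by metis
  then have "prefix \<alpha>' \<beta>" using prefixI by simp
  then show ?thesis using prefix_eq_deg[OF assms(1) prefix_trans[OF _ assms(2)]] \<open>dg \<alpha>' = dg \<alpha>\<close> by metis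
qed

text \<open>A second form of \<open>\<Lambda>\<^sup>m\<^sup>i\<^sup>n(\<alpha>, \<beta>) \<noteq> \<emptyset>\<close>, see \<open>min_ext_nonempty_iff\<close>; being
  inherited by initial segments, it is easier to manipulate.\<close>

definition compat :: "'a \<Rightarrow> 'a \<Rightarrow> bool" where
  "compat \<alpha> \<beta> \<longleftrightarrow> (\<exists>\<gamma>. prefix \<alpha> \<gamma> \<and> prefix \<beta> \<gamma>)"

lemma compatI: "prefix \<alpha> \<gamma> \<Longrightarrow> prefix \<beta> \<gamma> \<Longrightarrow> compat \<alpha> \<beta>"
  by (auto simp: compat_def)

lemma compat_sym: "compat \<alpha> \<beta> \<Longrightarrow> compat \<beta> \<alpha>"
  by (auto simp: compat_def)

lemma compat_eq_deg: "compat \<alpha> \<beta> \<Longrightarrow> dg \<alpha> = dg \<beta> \<Longrightarrow> \<alpha> = \<beta>"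
  by (auto simp: compat_def intro: prefix_eq_deg)

lemma compat_prefix: "compat \<alpha>' \<beta>' \<Longrightarrow> prefix \<alpha> \<alpha>' \<Longrightarrow> prefix \<beta> \<beta>' \<Longrightarrow> compat \<alpha> \<beta>"
  by (auto simp: compat_def intro: prefix_trans)

text \<open>Any common extension of two paths factors through a minimal one, because by unique
  factorisation it has an initial segment of degree equal to the join of the two degrees.\<close>

lemma min_ext_below:
  assumes "prefix \<alpha> \<gamma>" "prefix \<beta> \<gamma>"
  obtains \<rho> \<tau> where "(\<rho>, \<tau>) \<in> min_ext \<Lambda> \<alpha> \<beta>" "prefix (\<alpha> \<cdot> \<rho>) \<gamma>"
proof -
  let ?m = "sup (dg \<alpha>) (dg \<beta>)"
  have "?m \<le> dg \<gamma>" using prefix_deg assms by auto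
  then obtain \<delta> \<epsilon> where d: "\<delta> \<in> M" "\<epsilon> \<in> M" "sr \<delta> = rg \<epsilon>" "dg \<delta> = ?m" "\<gamma> = \<delta> \<cdot> \<epsilon>"
    using factor prefix_mor assms by metis
  then have "prefix \<delta> \<gamma>" using prefixI by simp
  have "dg \<alpha> \<le> dg \<delta>" "dg \<beta> \<le> dg \<delta>" unfolding d(4) by simp_all
  then have "prefix \<alpha> \<delta>" "prefix \<beta> \<delta>" using prefix_of_deg_le \<open>prefix \<delta> \<gamma>\<close> assms by blast+
  then obtain \<rho> \<tau> where "\<alpha> \<in> M" "\<rho> \<in> M" "sr \<alpha> = rg \<rho>" and \<rho>: "\<alpha> \<cdot> \<rho> = \<delta>"
    and "\<beta> \<in> M" "\<tau> \<in> M" "sr \<beta> = rg \<tau>" and \<tau>: "\<beta> \<cdot> \<tau> = \<delta>" by (metis prefixE)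
  then have "(\<rho>, \<tau>) \<in> min_ext \<Lambda> \<alpha> \<beta>" using d(4) by (auto simp only: min_ext_def)
  then show thesis using that[of \<rho> \<tau>] \<open>prefix \<delta> \<gamma>\<close> \<rho> by simp
qed

lemma min_extD:
  assumes "(\<rho>, \<tau>) \<in> min_ext \<Lambda> \<alpha> \<beta>"
  shows "\<rho> \<in> M" "\<tau> \<in> M" "sr \<alpha> = rg \<rho>" "sr \<beta> = rg \<tau>" "\<alpha> \<cdot> \<rho> = \<beta> \<cdot> \<tau>"
    "dg (\<alpha> \<cdot> \<rho>) = sup (dg \<alpha>) (dg \<beta>)"
  using assms by (auto simp: min_ext_def)

lemma min_ext_src:
  assumes "(\<rho>, \<tau>) \<in> min_ext \<Lambda> \<alpha> \<beta>" "\<alpha> \<in> M" "\<beta> \<in> M" shows "sr \<rho> = sr \<tau>"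
  using min_extD[OF assms(1)] assms by (metis src_cmp)

lemma min_ext_nonempty_iff:
  assumes "\<alpha> \<in> M" "\<beta> \<in> M" shows "min_ext \<Lambda> \<alpha> \<beta> \<noteq> {} \<longleftrightarrow> compat \<alpha> \<beta>"
proof
  assume "min_ext \<Lambda> \<alpha> \<beta> \<noteq> {}"
  then obtain \<rho> \<tau> where "(\<rho>, \<tau>) \<in> min_ext \<Lambda> \<alpha> \<beta>" by auto
  then show "compat \<alpha> \<beta>" using min_extD prefixI assms compatI by metis
next
  assume "compat \<alpha> \<beta>"
  then show "min_ext \<Lambda> \<alpha> \<beta> \<noteq> {}" unfolding compat_def by (metis empty_iff min_ext_below)
qed

lemma min_ext_swap: "min_ext \<Lambda> \<beta> \<alpha> = prod.swap ` min_ext \<Lambda> \<alpha> \<beta>"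
proof -
  have "(\<rho>, \<tau>) \<in> min_ext \<Lambda> \<beta> \<alpha> \<longleftrightarrow> (\<tau>, \<rho>) \<in> min_ext \<Lambda> \<alpha> \<beta>" for \<rho> \<tau>
    unfolding min_ext_def by (auto simp: sup_commute)
  then have "p \<in> min_ext \<Lambda> \<beta> \<alpha> \<longleftrightarrow> prod.swap p \<in> min_ext \<Lambda> \<alpha> \<beta>" for p by (cases p) simp
  then show ?thesis by (force intro: rev_image_eqI[of "prod.swap p" for p])
qed

lemma min_ext_comp:
  assumes "\<alpha> \<in> M" "\<beta> \<in> M" "sr \<alpha> = rg \<beta>"
  shows "min_ext \<Lambda> (\<alpha> \<cdot> \<beta>) \<alpha> = {(sr \<beta>, \<beta>)}"
proof -
  have s: "sup (dg \<alpha> + dg \<beta>) (dg \<alpha>) = dg \<alpha> + dg \<beta>" by (rule sup_absorb1) (simp add: le_fun_def)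
  have "(\<rho>, \<tau>) \<in> min_ext \<Lambda> (\<alpha> \<cdot> \<beta>) \<alpha> \<longleftrightarrow> \<rho> = sr \<beta> \<and> \<tau> = \<beta>" for \<rho> \<tau>
  proof
    assume p: "(\<rho>, \<tau>) \<in> min_ext \<Lambda> (\<alpha> \<cdot> \<beta>) \<alpha>"
    note q = min_extD[OF p]
    have "dg \<rho> = 0" using q(6) q(1,3) assms s by simp
    then have v: "\<rho> \<in> vertices \<Lambda>" using q(1) by (simp add: vertices_def)
    then have r: "\<rho> = sr \<beta>" using vertex_rng_src(2)[OF v] q(3) assms by simp
    moreover have "\<alpha> \<cdot> \<beta> = \<alpha> \<cdot> \<tau>" using q(5) assms r by (metis cmp_closed cmp_src src_cmp)
    ultimately show "\<rho> = sr \<beta> \<and> \<tau> = \<beta>" using comp_cancel_left[of \<alpha> \<beta> \<tau>] assms q by auto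
  next
    assume "\<rho> = sr \<beta> \<and> \<tau> = \<beta>"
    moreover have "\<alpha> \<cdot> \<beta> \<cdot> sr \<beta> = \<alpha> \<cdot> \<beta>" using assms by (metis cmp_closed cmp_src src_cmp)
    ultimately show "(\<rho>, \<tau>) \<in> min_ext \<Lambda> (\<alpha> \<cdot> \<beta>) \<alpha>"
      using assms s by (simp add: min_ext_def)
  qed
  then show ?thesis by auto
qed

lemma compat_rng: "compat \<alpha> \<beta> \<Longrightarrow> rg \<alpha> = rg \<beta>"
  by (metis compat_def prefix_rng)

lemma compat_comp_right:
  assumes "\<alpha> \<in> M" "\<beta> \<in> M" "sr \<alpha> = rg \<beta>" "compat \<alpha> \<gamma>"
  shows "compat (\<alpha> \<cdot> \<beta>) \<gamma> \<longleftrightarrow> (\<exists>(\<rho>, \<tau>)\<in>min_ext \<Lambda> \<alpha> \<gamma>. compat \<beta> \<rho>)"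
proof
  assume "compat (\<alpha> \<cdot> \<beta>) \<gamma>"
  then obtain \<delta> where d: "prefix (\<alpha> \<cdot> \<beta>) \<delta>" "prefix \<gamma> \<delta>" by (auto simp: compat_def)
  have "prefix \<alpha> \<delta>" using d(1) prefixI assms prefix_trans by blast
  then obtain \<rho> \<tau> where p: "(\<rho>, \<tau>) \<in> min_ext \<Lambda> \<alpha> \<gamma>" "prefix (\<alpha> \<cdot> \<rho>) \<delta>"
    using min_ext_below d(2) by metis
  obtain \<beta>' where b: "\<beta>' \<in> M" "sr \<beta> = rg \<beta>'" "\<delta> = \<alpha> \<cdot> (\<beta> \<cdot> \<beta>')"
    using d(1) assms by (auto elim!: prefixE simp: cmp_assoc)
  have "prefix \<rho> (\<beta> \<cdot> \<beta>')"
    using prefix_comp_cancel[of \<alpha> \<rho> "\<beta> \<cdot> \<beta>'"] min_extD[OF p(1)] p(2) b assms by simp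
  then show "\<exists>(\<rho>, \<tau>)\<in>min_ext \<Lambda> \<alpha> \<gamma>. compat \<beta> \<rho>"
    using p(1) compatI[OF prefixI[of \<beta> \<beta>']] b(1,2) assms(2) by blast
next
  assume "\<exists>(\<rho>, \<tau>)\<in>min_ext \<Lambda> \<alpha> \<gamma>. compat \<beta> \<rho>"
  then obtain \<rho> \<tau> \<delta> where p: "(\<rho>, \<tau>) \<in> min_ext \<Lambda> \<alpha> \<gamma>" "prefix \<beta> \<delta>" "prefix \<rho> \<delta>"
    by (auto simp: compat_def)
  note q = min_extD[OF p(1)]
  obtain \<gamma>' where "prefix \<gamma> \<gamma>'" using assms(4) by (auto simp: compat_def)
  then have "\<gamma> \<in> M" by (rule prefix_mor)
  then have "prefix \<gamma> (\<gamma> \<cdot> \<tau>)" using prefixI q by simp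
  moreover have "prefix (\<gamma> \<cdot> \<tau>) (\<alpha> \<cdot> \<delta>)"
    using prefix_comp_mono[of \<alpha> \<rho> \<delta>] q(3,5) p(3) assms(1) by simp
  ultimately have "prefix \<gamma> (\<alpha> \<cdot> \<delta>)" by (rule prefix_trans)
  then show "compat (\<alpha> \<cdot> \<beta>) \<gamma>" using prefix_comp_mono[of \<alpha> \<beta> \<delta>] p assms compatI by blast
qed

section \<open>Boundary paths as sets of initial segments\<close>

text \<open>A boundary path is determined by the set of its initial segments, and the sets that arise
  are the directed, hereditary sets of paths that meet \<open>\<mu>E\<close> whenever they contain \<open>\<mu>\<close> and
  \<open>E\<close> is in \<open>FE\<close> at the source of \<open>\<mu>\<close>. Working with these boundary filters avoids degrees in
  \<open>(\<nat> \<union> {\<infinity>})\<^sup>k\<close> and makes removing or adding an initial segment a simple operation on sets.\<close>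

definition BF :: "'a set set" where
  "BF = {U. U \<subseteq> M \<and> U \<noteq> {} \<and> (\<forall>\<gamma>\<in>U. \<forall>\<alpha>. prefix \<alpha> \<gamma> \<longrightarrow> \<alpha> \<in> U) \<and>
    (\<forall>\<alpha>\<in>U. \<forall>\<beta>\<in>U. \<exists>\<gamma>\<in>U. prefix \<alpha> \<gamma> \<and> prefix \<beta> \<gamma>) \<and>
    (\<forall>\<mu>\<in>U. \<forall>E\<in>FE_at \<Lambda> (sr \<mu>). \<exists>\<epsilon>\<in>E. \<mu> \<cdot> \<epsilon> \<in> U)}"

lemma BF_mor: "U \<in> BF \<Longrightarrow> \<alpha> \<in> U \<Longrightarrow> \<alpha> \<in> M"
  and BF_down: "U \<in> BF \<Longrightarrow> \<gamma> \<in> U \<Longrightarrow> prefix \<alpha> \<gamma> \<Longrightarrow> \<alpha> \<in> U"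
  and BF_directed: "U \<in> BF \<Longrightarrow> \<alpha> \<in> U \<Longrightarrow> \<beta> \<in> U \<Longrightarrow> \<exists>\<gamma>\<in>U. prefix \<alpha> \<gamma> \<and> prefix \<beta> \<gamma>"
  and BF_FE: "U \<in> BF \<Longrightarrow> \<mu> \<in> U \<Longrightarrow> E \<in> FE_at \<Lambda> (sr \<mu>) \<Longrightarrow> \<exists>\<epsilon>\<in>E. \<mu> \<cdot> \<epsilon> \<in> U"
  and BF_nonempty: "U \<in> BF \<Longrightarrow> U \<noteq> {}"
  unfolding BF_def by blast+

lemma BF_compat: "U \<in> BF \<Longrightarrow> \<alpha> \<in> U \<Longrightarrow> \<beta> \<in> U \<Longrightarrow> compat \<alpha> \<beta>"
  using BF_directed unfolding compat_def by blast

lemma BF_eq_deg: "U \<in> BF \<Longrightarrow> \<alpha> \<in> U \<Longrightarrow> \<beta> \<in> U \<Longrightarrow> dg \<alpha> = dg \<beta> \<Longrightarrow> \<alpha> = \<beta>"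
  using BF_compat compat_eq_deg by blast

lemma BF_rng_eq: "U \<in> BF \<Longrightarrow> \<alpha> \<in> U \<Longrightarrow> \<beta> \<in> U \<Longrightarrow> rg \<alpha> = rg \<beta>"
  using BF_compat compat_rng by blast

lemma prefix_rng_self: "\<alpha> \<in> M \<Longrightarrow> prefix (rg \<alpha>) \<alpha>"
  using prefixI[of "rg \<alpha>" \<alpha>] by simp

lemma BF_rng: "U \<in> BF \<Longrightarrow> \<alpha> \<in> U \<Longrightarrow> rg \<alpha> \<in> U"
  using BF_down BF_mor prefix_rng_self by blast

lemma BF_comp_down: "U \<in> BF \<Longrightarrow> \<alpha> \<cdot> \<beta> \<in> U \<Longrightarrow> \<alpha> \<in> M \<Longrightarrow> \<beta> \<in> M \<Longrightarrow> sr \<alpha> = rg \<beta> \<Longrightarrow> \<alpha> \<in> U"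
  using BF_down prefixI by blast

text \<open>\<open>FE\<close> leaves out sets that contain the vertex itself; for such sets the conclusion is trivial.\<close>

lemma BF_exhaustive:
  assumes "U \<in> BF" "\<mu> \<in> U" "finite E" "exhaustive \<Lambda> (sr \<mu>) E"
  obtains \<epsilon> where "\<epsilon> \<in> E" "\<mu> \<cdot> \<epsilon> \<in> U"
proof (cases "sr \<mu> \<in> E")
  case True
  then show thesis using that assms(2) BF_mor[OF assms(1,2)] by (metis cmp_src)
next
  case False
  then have "E \<in> FE_at \<Lambda> (sr \<mu>)" using assms by (auto simp: FE_at_def exhaustive_def)
  then show thesis using BF_FE assms that by blast
qed

text \<open>Enumerate all pairs of a path \<open>\<mu>\<close> and a finite set
  \<open>E\<close> so that each occurs infinitely often, and extend the current path whenever it can be made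
  to pass through \<open>\<mu>E\<close>. If \<open>E\<close> is exhaustive and \<open>\<mu>\<close> an initial segment, this is possible.\<close>

lemma BF_exists:
  assumes "\<alpha> \<in> M"
  obtains U where "U \<in> BF" "\<alpha> \<in> U"
proof -
  define Q where "Q = M \<times> {E. finite E \<and> E \<subseteq> M}"
  have "countable Q" "(\<alpha>, {}) \<in> Q"
    unfolding Q_def using countable_Mor assms
    by (auto intro!: countable_SIGMA countable_Collect_finite_subset)
  define e where "e = from_nat_into Q"
  have e: "\<exists>i. e i = q" if "q \<in> Q" for q
    using from_nat_into_surj[OF \<open>countable Q\<close> that] by (simp add: e_def)
  define through where "through = (\<lambda>q \<rho>. \<exists>\<epsilon>\<in>snd q. sr (fst q) = rg \<epsilon> \<and> prefix (fst q \<cdot> \<epsilon>) \<rho>)"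
  define step where "step = (\<lambda>q \<rho>. if \<exists>\<rho>'. prefix \<rho> \<rho>' \<and> through q \<rho>'
    then SOME \<rho>'. prefix \<rho> \<rho>' \<and> through q \<rho>' else \<rho>)"
  define p where "p = rec_nat \<alpha> (\<lambda>j \<rho>. step (e (fst (prod_decode j))) \<rho>)"
  have p0: "p 0 = \<alpha>" and pS: "p (Suc j) = step (e (fst (prod_decode j))) (p j)" for j
    by (simp_all add: p_def)
  have st: "prefix \<rho> (step q \<rho>) \<and> through q (step q \<rho>)" if "\<exists>\<rho>'. prefix \<rho> \<rho>' \<and> through q \<rho>'" for q \<rho>
    using someI_ex[OF that] that by (simp add: step_def)
  have st2: "prefix \<rho> (step q \<rho>)" if "\<rho> \<in> M" for q \<rho>
    using st[of \<rho> q] prefix_refl[OF that] by (auto simp: step_def)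
  have pM: "p j \<in> M" for j
    by (induction j) (use p0 pS assms st2 prefix_mor in metis)+
  have mono: "prefix (p i) (p j)" if "i \<le> j" for i j
    using that
  proof (induction j)
    case 0
    then show ?case using prefix_refl pM by simp
  next
    case (Suc j)
    show ?case
    proof (cases "i = Suc j")
      case True
      then show ?thesis using prefix_refl pM by simp
    next
      case False
      then have "prefix (p i) (p j)" using Suc by simp
      then show ?thesis using pS[of j] st2[OF pM[of j]] prefix_trans by metis
    qed
  qed
  define U where "U = {\<beta>. \<exists>j. prefix \<beta> (p j)}"
  have "U \<in> BF" unfolding BF_def
  proof (intro CollectI conjI ballI allI impI)
    show "U \<subseteq> M" unfolding U_def using prefix_mor by blast
    show "U \<noteq> {}" unfolding U_def using prefix_refl pM by blast
    show "\<beta> \<in> U" if "\<gamma> \<in> U" "prefix \<beta> \<gamma>" for \<beta> \<gamma> using that prefix_trans unfolding U_def by blast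
    show "\<exists>\<gamma>\<in>U. prefix \<beta> \<gamma> \<and> prefix \<beta>' \<gamma>" if "\<beta> \<in> U" "\<beta>' \<in> U" for \<beta> \<beta>'
    proof -
      obtain i j where "prefix \<beta> (p i)" "prefix \<beta>' (p j)" using \<open>\<beta> \<in> U\<close> \<open>\<beta>' \<in> U\<close> unfolding U_def by blast
      then have "prefix \<beta> (p (max i j))" "prefix \<beta>' (p (max i j))"
        using mono prefix_trans max.cobounded1 max.cobounded2 by metis+
      moreover have "p (max i j) \<in> U" unfolding U_def using prefix_refl pM by blast
      ultimately show ?thesis by blast
    qed
    show "\<exists>\<epsilon>\<in>E. \<mu> \<cdot> \<epsilon> \<in> U" if "\<mu> \<in> U" "E \<in> FE_at \<Lambda> (sr \<mu>)" for \<mu> E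
    proof -
      have E: "finite E" "E \<subseteq> M" "exhaustive \<Lambda> (sr \<mu>) E"
        using that(2) by (auto simp: FE_at_def paths_from_def)
      obtain i where i: "prefix \<mu> (p i)" using \<open>\<mu> \<in> U\<close> unfolding U_def by blast
      then have "(\<mu>, E) \<in> Q" using E prefix_mor by (simp add: Q_def)
      then obtain l where l: "e l = (\<mu>, E)" using e by blast
      define j where "j = prod_encode (l, i)"
      have "i \<le> j" unfolding j_def by (rule le_prod_encode_2)
      then have "prefix \<mu> (p j)" using i mono prefix_trans by blast
      then obtain \<mu>' where m: "\<mu> \<in> M" "\<mu>' \<in> M" "sr \<mu> = rg \<mu>'" "p j = \<mu> \<cdot> \<mu>'" by (rule prefixE)
      then have "\<mu>' \<in> paths_from \<Lambda> (sr \<mu>)" by (simp add: paths_from_def)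
      then obtain \<epsilon> where \<epsilon>: "\<epsilon> \<in> E" "min_ext \<Lambda> \<mu>' \<epsilon> \<noteq> {}"
        using E(3) unfolding exhaustive_def by blast
      have \<epsilon>': "\<epsilon> \<in> M" "rg \<epsilon> = sr \<mu>"
        using E(3) \<epsilon>(1) unfolding exhaustive_def paths_from_def by blast+
      have "compat \<mu>' \<epsilon>" using \<epsilon>(2) min_ext_nonempty_iff[OF m(2) \<epsilon>'(1)] by simp
      then obtain \<delta> where "prefix \<mu>' \<delta>" "prefix \<epsilon> \<delta>" unfolding compat_def by blast
      then have "prefix (\<mu> \<cdot> \<mu>') (\<mu> \<cdot> \<delta>)" "prefix (\<mu> \<cdot> \<epsilon>) (\<mu> \<cdot> \<delta>)"
        using prefix_comp_mono m \<epsilon>' by metis+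
      then have "\<exists>\<rho>'. prefix (p j) \<rho>' \<and> through (\<mu>, E) \<rho>'"
        unfolding through_def m(4) fst_conv snd_conv
        using \<epsilon>(1) \<epsilon>'(2)[symmetric] by blast
      from st[OF this] have "through (\<mu>, E) (p (Suc j))"
        unfolding pS by (simp add: j_def l)
      then obtain \<epsilon>'' where "\<epsilon>'' \<in> E" "prefix (\<mu> \<cdot> \<epsilon>'') (p (Suc j))" by (auto simp: through_def)
      then show ?thesis unfolding U_def by blast
    qed
  qed
  moreover have "\<alpha> \<in> U" unfolding U_def using prefix_refl[OF assms] p0 by force
  ultimately show thesis using that by blast
qed

text \<open>For a boundary filter \<open>U\<close> with boundary path \<open>x\<close>, the following two are the filters of the
  shift of \<open>x\<close> by the degree of its initial segment \<open>\<kappa>\<close>, and of \<open>\<kappa>x\<close>.\<close>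

definition strip :: "'a \<Rightarrow> 'a set \<Rightarrow> 'a set" where
  "strip \<kappa> U = {\<alpha> \<in> M. sr \<kappa> = rg \<alpha> \<and> \<kappa> \<cdot> \<alpha> \<in> U}"

definition prepend :: "'a \<Rightarrow> 'a set \<Rightarrow> 'a set" where
  "prepend \<kappa> U = {\<alpha>. \<exists>\<mu>\<in>U. prefix \<alpha> (\<kappa> \<cdot> \<mu>)}"

lemma strip_BF:
  assumes "U \<in> BF" "\<kappa> \<in> U" shows "strip \<kappa> U \<in> BF"
proof -
  have k: "\<kappa> \<in> M" using BF_mor assms .
  show ?thesis unfolding BF_def
  proof (intro CollectI conjI ballI allI impI)
    show "strip \<kappa> U \<subseteq> M" by (auto simp: strip_def)
    show "strip \<kappa> U \<noteq> {}" using k assms by (auto simp: strip_def intro!: exI[of _ "sr \<kappa>"])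
    show "\<alpha> \<in> strip \<kappa> U" if "\<gamma> \<in> strip \<kappa> U" "prefix \<alpha> \<gamma>" for \<alpha> \<gamma>
      using that k assms prefix_comp_mono[OF k _ that(2)] prefix_mor[OF that(2)] prefix_rng[OF that(2)]
        BF_down[OF assms(1)] unfolding strip_def by auto
    show "\<exists>\<gamma>\<in>strip \<kappa> U. prefix \<alpha> \<gamma> \<and> prefix \<beta> \<gamma>" if "\<alpha> \<in> strip \<kappa> U" "\<beta> \<in> strip \<kappa> U" for \<alpha> \<beta>
    proof -
      have a: "\<alpha> \<in> M" "sr \<kappa> = rg \<alpha>" "\<beta> \<in> M" "sr \<kappa> = rg \<beta>" "\<kappa> \<cdot> \<alpha> \<in> U" "\<kappa> \<cdot> \<beta> \<in> U"
        using that by (auto simp: strip_def)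
      obtain \<gamma> where g: "\<gamma> \<in> U" "prefix (\<kappa> \<cdot> \<alpha>) \<gamma>" "prefix (\<kappa> \<cdot> \<beta>) \<gamma>"
        using BF_directed[OF assms(1) a(5,6)] by blast
      have "prefix \<kappa> \<gamma>" using prefixI[OF k a(1,2)] g(2) by (rule prefix_trans)
      then obtain \<delta> where d: "\<delta> \<in> M" "sr \<kappa> = rg \<delta>" "\<gamma> = \<kappa> \<cdot> \<delta>" by (rule prefixE)
      have "prefix \<alpha> \<delta>" "prefix \<beta> \<delta>" using prefix_comp_cancel[OF k] a d g by simp_all
      then show ?thesis using d g(1) by (auto simp: strip_def)
    qed
    show "\<exists>\<epsilon>\<in>E. \<mu> \<cdot> \<epsilon> \<in> strip \<kappa> U" if "\<mu> \<in> strip \<kappa> U" "E \<in> FE_at \<Lambda> (sr \<mu>)" for \<mu> E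
    proof -
      have m: "\<mu> \<in> M" "sr \<kappa> = rg \<mu>" "\<kappa> \<cdot> \<mu> \<in> U" using that(1) by (auto simp: strip_def)
      have "E \<in> FE_at \<Lambda> (sr (\<kappa> \<cdot> \<mu>))" using that(2) k m by simp
      then obtain \<epsilon> where \<epsilon>: "\<epsilon> \<in> E" "\<kappa> \<cdot> \<mu> \<cdot> \<epsilon> \<in> U" using BF_FE[OF assms(1) m(3)] by blast
      have "\<epsilon> \<in> M" "rg \<epsilon> = sr \<mu>" using \<epsilon>(1) that(2) by (auto simp: FE_at_def paths_from_def)
      then show ?thesis using \<epsilon> k m by (auto simp: strip_def cmp_assoc intro!: bexI[of _ \<epsilon>])
    qed
  qed
qed

end

locale finitely_aligned_k_graph = k_graph \<Lambda> for \<Lambda> :: "('a, 'k::finite) kgraph" +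
  assumes fin_aligned: "finitely_aligned \<Lambda>"
begin

lemma finite_min_ext: "\<alpha> \<in> M \<Longrightarrow> \<beta> \<in> M \<Longrightarrow> finite (min_ext \<Lambda> \<alpha> \<beta>)"
  using fin_aligned by (simp add: finitely_aligned_def)

text \<open>The set \<open>E'\<close> is what remains of \<open>E\<close> after \<open>\<alpha>\<close>: a common extension of \<open>\<alpha>\<beta>\<close> with a member of
  \<open>E\<close> factors through a minimal one of \<open>\<alpha>\<close>, so that \<open>\<beta>\<close> is compatible with a member of \<open>E'\<close>.\<close>

lemma exhaustive_transport:
  assumes "\<alpha> \<in> M" "finite E" "exhaustive \<Lambda> (rg \<alpha>) E"
  defines "E' \<equiv> \<Union>\<epsilon>\<in>E. fst ` min_ext \<Lambda> \<alpha> \<epsilon>"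
  shows "finite E'" "exhaustive \<Lambda> (sr \<alpha>) E'"
proof -
  have E: "\<epsilon> \<in> M" "rg \<epsilon> = rg \<alpha>" if "\<epsilon> \<in> E" for \<epsilon>
    using that assms(3) by (auto simp: exhaustive_def paths_from_def)
  show "finite E'" unfolding E'_def using assms(1,2) E finite_min_ext by auto
  have "\<exists>\<rho>\<in>E'. min_ext \<Lambda> \<beta> \<rho> \<noteq> {}" if b: "\<beta> \<in> paths_from \<Lambda> (sr \<alpha>)" for \<beta>
  proof -
    have b': "\<beta> \<in> M" "sr \<alpha> = rg \<beta>" using b by (auto simp: paths_from_def)
    then have "\<alpha> \<cdot> \<beta> \<in> paths_from \<Lambda> (rg \<alpha>)" using assms(1) by (simp add: paths_from_def)
    then obtain \<epsilon> where \<epsilon>: "\<epsilon> \<in> E" "min_ext \<Lambda> (\<alpha> \<cdot> \<beta>) \<epsilon> \<noteq> {}"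
      using assms(3) unfolding exhaustive_def by blast
    then have c: "compat (\<alpha> \<cdot> \<beta>) \<epsilon>" using min_ext_nonempty_iff E assms(1) b' by simp
    then have "compat \<alpha> \<epsilon>"
      using compat_prefix prefixI[OF assms(1) b'] prefix_refl E \<epsilon>(1) by blast
    then obtain \<rho> \<tau> where p: "(\<rho>, \<tau>) \<in> min_ext \<Lambda> \<alpha> \<epsilon>" "compat \<beta> \<rho>"
      using c compat_comp_right[OF assms(1) b'] by blast
    have "\<rho> \<in> E'" unfolding E'_def using \<epsilon>(1) imageI[OF p(1), of fst] by auto
    moreover have "min_ext \<Lambda> \<beta> \<rho> \<noteq> {}"
      using p(2) min_ext_nonempty_iff[OF b'(1) min_extD(1)[OF p(1)]] by simp
    ultimately show ?thesis by blast
  qed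
  moreover have "E' \<subseteq> paths_from \<Lambda> (sr \<alpha>)"
    unfolding E'_def paths_from_def by (auto dest: min_extD)
  ultimately show "exhaustive \<Lambda> (sr \<alpha>) E'" by (auto simp: exhaustive_def)
qed

lemma comp_mem_prepend:
  assumes "\<kappa> \<in> M" "\<mu> \<in> M" "sr \<kappa> = rg \<mu>" "\<mu> \<in> U" shows "\<kappa> \<cdot> \<mu> \<in> prepend \<kappa> U"
  unfolding prepend_def using assms prefix_refl[of "\<kappa> \<cdot> \<mu>"] by auto

lemma mem_prepend_self:
  assumes "\<kappa> \<in> M" "sr \<kappa> \<in> U" shows "\<kappa> \<in> prepend \<kappa> U"
  using comp_mem_prepend[OF assms(1) _ _ assms(2)] assms(1) by simp

text \<open>The boundary condition for \<open>\<kappa>x\<close> at a segment \<open>\<alpha>\<close> that does not yet contain \<open>\<kappa>\<close> is the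
  only delicate point: extend \<open>\<alpha>\<close> to some \<open>\<kappa>\<mu>\<close> and transport the exhaustive set along the
  extension, so that the condition for \<open>x\<close> at \<open>\<mu>\<close> applies.\<close>

lemma prepend_BF:
  assumes "U \<in> BF" "\<kappa> \<in> M" "sr \<kappa> \<in> U" shows "prepend \<kappa> U \<in> BF"
proof -
  have r: "\<mu> \<in> M" "sr \<kappa> = rg \<mu>" if "\<mu> \<in> U" for \<mu>
    using BF_mor[OF assms(1) that] BF_rng_eq[OF assms(1,3) that] assms(2) by simp_all
  show ?thesis unfolding BF_def
  proof (intro CollectI conjI ballI allI impI)
    show "prepend \<kappa> U \<subseteq> M" by (auto simp: prepend_def intro: prefix_mor)
    show "prepend \<kappa> U \<noteq> {}"
      using mem_prepend_self[OF assms(2,3)] by blast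
    show "\<alpha> \<in> prepend \<kappa> U" if "\<gamma> \<in> prepend \<kappa> U" "prefix \<alpha> \<gamma>" for \<alpha> \<gamma>
      using that prefix_trans unfolding prepend_def by blast
    show "\<exists>\<gamma>\<in>prepend \<kappa> U. prefix \<alpha> \<gamma> \<and> prefix \<beta> \<gamma>" if ab: "\<alpha> \<in> prepend \<kappa> U" "\<beta> \<in> prepend \<kappa> U" for \<alpha> \<beta>
    proof -
      obtain \<mu> \<nu> where m: "\<mu> \<in> U" "prefix \<alpha> (\<kappa> \<cdot> \<mu>)" "\<nu> \<in> U" "prefix \<beta> (\<kappa> \<cdot> \<nu>)"
        using ab unfolding prepend_def by blast
      obtain \<gamma> where g: "\<gamma> \<in> U" "prefix \<mu> \<gamma>" "prefix \<nu> \<gamma>" using BF_directed[OF assms(1) m(1,3)] by blast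
      then have "prefix \<alpha> (\<kappa> \<cdot> \<gamma>)" "prefix \<beta> (\<kappa> \<cdot> \<gamma>)"
        using m r prefix_comp_mono[OF assms(2)] prefix_trans by blast+
      moreover have "\<kappa> \<cdot> \<gamma> \<in> prepend \<kappa> U"
        using comp_mem_prepend[OF assms(2) r[OF g(1)] g(1)] .
      ultimately show ?thesis by blast
    qed
    show "\<exists>\<epsilon>\<in>E. \<alpha> \<cdot> \<epsilon> \<in> prepend \<kappa> U" if aE: "\<alpha> \<in> prepend \<kappa> U" "E \<in> FE_at \<Lambda> (sr \<alpha>)" for \<alpha> E
    proof -
      obtain \<mu> where m: "\<mu> \<in> U" "prefix \<alpha> (\<kappa> \<cdot> \<mu>)" using aE(1) by (auto simp: prepend_def)
      obtain \<alpha>' where a: "\<alpha> \<in> M" "\<alpha>' \<in> M" "sr \<alpha> = rg \<alpha>'" "\<kappa> \<cdot> \<mu> = \<alpha> \<cdot> \<alpha>'"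
        using m(2) by (rule prefixE)
      define E' where "E' = (\<Union>\<epsilon>\<in>E. fst ` min_ext \<Lambda> \<alpha>' \<epsilon>)"
      have s: "sr \<alpha>' = sr \<mu>" using a r[OF m(1)] assms(2) by (metis src_cmp)
      have "finite E" "exhaustive \<Lambda> (rg \<alpha>') E" using aE(2) a(3) by (auto simp: FE_at_def)
      from exhaustive_transport[OF a(2) this]
      have "finite E'" "exhaustive \<Lambda> (sr \<mu>) E'" unfolding E'_def s by auto
      then obtain \<rho> where \<rho>: "\<rho> \<in> E'" "\<mu> \<cdot> \<rho> \<in> U" using BF_exhaustive[OF assms(1) m(1)] by blast
      then obtain \<epsilon> \<tau> where \<epsilon>: "\<epsilon> \<in> E" "(\<rho>, \<tau>) \<in> min_ext \<Lambda> \<alpha>' \<epsilon>" by (auto simp: E'_def)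
      note q = min_extD[OF \<epsilon>(2)]
      have \<epsilon>': "\<epsilon> \<in> M" "rg \<epsilon> = sr \<alpha>" using \<epsilon>(1) aE(2) by (auto simp: FE_at_def paths_from_def)
      have "\<kappa> \<cdot> (\<mu> \<cdot> \<rho>) = \<kappa> \<cdot> \<mu> \<cdot> \<rho>" using cmp_assoc assms(2) r[OF m(1)] q(1,3) s by simp
      also have "\<dots> = \<alpha> \<cdot> (\<alpha>' \<cdot> \<rho>)" unfolding a(4) using cmp_assoc a(1-3) q(1,3) by simp
      also have "\<dots> = \<alpha> \<cdot> \<epsilon> \<cdot> \<tau>" unfolding q(5) using cmp_assoc a(1) \<epsilon>' q(2,4) by simp
      finally have "prefix (\<alpha> \<cdot> \<epsilon>) (\<kappa> \<cdot> (\<mu> \<cdot> \<rho>))" using prefixI[of "\<alpha> \<cdot> \<epsilon>" \<tau>] a(1) \<epsilon>' q(2,4) by simp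
      then show ?thesis using \<epsilon>(1) \<rho>(2) unfolding prepend_def by blast
    qed
  qed
qed

lemma strip_prepend:
  assumes "U \<in> BF" "\<kappa> \<in> M" "sr \<kappa> \<in> U" shows "strip \<kappa> (prepend \<kappa> U) = U"
proof -
  have r: "\<mu> \<in> M" "sr \<kappa> = rg \<mu>" if "\<mu> \<in> U" for \<mu>
    using BF_mor[OF assms(1) that] BF_rng_eq[OF assms(1,3) that] assms(2) by simp_all
  show ?thesis
  proof (intro equalityI subsetI)
    fix \<alpha> assume "\<alpha> \<in> strip \<kappa> (prepend \<kappa> U)"
    then obtain \<mu> where "\<alpha> \<in> M" "sr \<kappa> = rg \<alpha>" "\<mu> \<in> U" "prefix (\<kappa> \<cdot> \<alpha>) (\<kappa> \<cdot> \<mu>)"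
      by (auto simp: strip_def prepend_def)
    then show "\<alpha> \<in> U" using prefix_comp_cancel[OF assms(2)] r BF_down[OF assms(1)] by blast
  next
    fix \<alpha> assume "\<alpha> \<in> U"
    then show "\<alpha> \<in> strip \<kappa> (prepend \<kappa> U)"
      using r assms(2) comp_mem_prepend by (simp add: strip_def)
  qed
qed

lemma prepend_strip:
  assumes "U \<in> BF" "\<kappa> \<in> U" shows "prepend \<kappa> (strip \<kappa> U) = U"
proof (intro equalityI subsetI)
  fix \<alpha> assume "\<alpha> \<in> prepend \<kappa> (strip \<kappa> U)"
  then show "\<alpha> \<in> U" using BF_down[OF assms(1)] by (auto simp: strip_def prepend_def)
next
  fix \<alpha> assume "\<alpha> \<in> U"
  then obtain \<gamma> where g: "\<gamma> \<in> U" "prefix \<alpha> \<gamma>" "prefix \<kappa> \<gamma>" using BF_directed[OF assms(1) _ assms(2)] by blast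
  from g(3) obtain \<mu> where "\<mu> \<in> M" "sr \<kappa> = rg \<mu>" "\<gamma> = \<kappa> \<cdot> \<mu>" by (rule prefixE)
  then show "\<alpha> \<in> prepend \<kappa> (strip \<kappa> U)" using g by (auto simp: strip_def prepend_def)
qed

lemma strip_comp:
  assumes "\<kappa> \<in> M" "\<mu> \<in> M" "sr \<kappa> = rg \<mu>" shows "strip (\<kappa> \<cdot> \<mu>) U = strip \<mu> (strip \<kappa> U)"
proof -
  have "\<alpha> \<in> strip (\<kappa> \<cdot> \<mu>) U \<longleftrightarrow> \<alpha> \<in> strip \<mu> (strip \<kappa> U)" for \<alpha>
  proof (cases "\<alpha> \<in> M \<and> sr \<mu> = rg \<alpha>")
    case True
    then show ?thesis using assms cmp_assoc[of \<kappa> \<mu> \<alpha>] by (simp add: strip_def)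
  next
    case False
    then show ?thesis unfolding strip_def mem_Collect_eq src_cmp[OF assms] by blast
  qed
  then show ?thesis by blast
qed

lemma prepend_comp:
  assumes "\<kappa> \<in> M" "\<mu> \<in> M" "sr \<kappa> = rg \<mu>" "U \<in> BF" "sr \<mu> \<in> U"
  shows "prepend (\<kappa> \<cdot> \<mu>) U = prepend \<kappa> (prepend \<mu> U)"
proof -
  have r: "\<nu> \<in> M" "sr \<mu> = rg \<nu>" if "\<nu> \<in> U" for \<nu>
    using BF_mor[OF assms(4) that] BF_rng_eq[OF assms(4,5) that] assms(2) by simp_all
  show ?thesis
  proof (intro equalityI subsetI)
    fix \<alpha> assume "\<alpha> \<in> prepend (\<kappa> \<cdot> \<mu>) U"
    then obtain \<nu> where n: "\<nu> \<in> U" "prefix \<alpha> (\<kappa> \<cdot> \<mu> \<cdot> \<nu>)" by (auto simp: prepend_def)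
    then have "prefix \<alpha> (\<kappa> \<cdot> (\<mu> \<cdot> \<nu>))" using r[OF n(1)] assms cmp_assoc by simp
    moreover have "\<mu> \<cdot> \<nu> \<in> prepend \<mu> U"
      using comp_mem_prepend[OF assms(2) r[OF n(1)] n(1)] .
    ultimately show "\<alpha> \<in> prepend \<kappa> (prepend \<mu> U)" by (auto simp: prepend_def)
  next
    fix \<alpha> assume "\<alpha> \<in> prepend \<kappa> (prepend \<mu> U)"
    then obtain \<beta> \<nu> where n: "\<nu> \<in> U" "prefix \<beta> (\<mu> \<cdot> \<nu>)" "prefix \<alpha> (\<kappa> \<cdot> \<beta>)" by (auto simp: prepend_def)
    have "sr \<kappa> = rg \<beta>" using prefix_rng[OF n(2)] r[OF n(1)] assms(2,3) by simp
    then have "prefix (\<kappa> \<cdot> \<beta>) (\<kappa> \<cdot> (\<mu> \<cdot> \<nu>))" using prefix_comp_mono[OF assms(1) _ n(2)] by simp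
    then have "prefix \<alpha> (\<kappa> \<cdot> \<mu> \<cdot> \<nu>)" using prefix_trans[OF n(3)] r[OF n(1)] assms(1-3) cmp_assoc by simp
    then show "\<alpha> \<in> prepend (\<kappa> \<cdot> \<mu>) U" using n(1) by (auto simp: prepend_def)
  qed
qed

text \<open>For \<open>\<kappa> \<in> U\<close> the minimal extensions of \<open>\<alpha>\<kappa>\<close> and \<open>\<beta>\<kappa>\<close> form an exhaustive set, because
  both stay compatible under every further continuation. As \<open>U\<close> cannot avoid this set, \<open>\<alpha>\<kappa>\<close> is an
  initial segment of some \<open>\<beta>\<kappa>\<rho>\<close> with \<open>\<kappa>\<rho> \<in> U\<close>.\<close>

lemma prepend_subset_of_compat:
  assumes "U \<in> BF" "\<alpha> \<in> M" "\<beta> \<in> M" "sr \<alpha> = sr \<beta>" "sr \<alpha> \<in> U"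
    and c: "\<And>\<kappa>. \<kappa> \<in> M \<Longrightarrow> rg \<kappa> = sr \<alpha> \<Longrightarrow> compat (\<alpha> \<cdot> \<kappa>) (\<beta> \<cdot> \<kappa>)"
  shows "prepend \<alpha> U \<subseteq> prepend \<beta> U"
proof
  fix \<delta> assume "\<delta> \<in> prepend \<alpha> U"
  then obtain \<kappa> where k: "\<kappa> \<in> U" "prefix \<delta> (\<alpha> \<cdot> \<kappa>)" by (auto simp: prepend_def)
  have k': "\<kappa> \<in> M" "rg \<kappa> = sr \<alpha>"
    using BF_mor[OF assms(1) k(1)] BF_rng_eq[OF assms(1,5) k(1)] assms(2) by simp_all
  define E where "E = fst ` min_ext \<Lambda> (\<beta> \<cdot> \<kappa>) (\<alpha> \<cdot> \<kappa>)"
  have m: "\<alpha> \<cdot> \<kappa> \<in> M" "\<beta> \<cdot> \<kappa> \<in> M" using assms(2-4) k' by simp_all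
  have "finite E" unfolding E_def using finite_min_ext m by simp
  moreover have "exhaustive \<Lambda> (sr \<kappa>) E"
    unfolding exhaustive_def
  proof (intro conjI ballI)
    show "E \<subseteq> paths_from \<Lambda> (sr \<kappa>)"
      unfolding E_def paths_from_def using assms(2-4) k' by (auto dest: min_extD)
    fix \<gamma> assume "\<gamma> \<in> paths_from \<Lambda> (sr \<kappa>)"
    then have g: "\<gamma> \<in> M" "rg \<gamma> = sr \<kappa>" by (auto simp: paths_from_def)
    have cc: "compat (\<beta> \<cdot> \<kappa> \<cdot> \<gamma>) (\<alpha> \<cdot> \<kappa> \<cdot> \<gamma>)"
      using c[of "\<kappa> \<cdot> \<gamma>"] g k' assms(2-4) compat_sym by (simp add: cmp_assoc)
    have "prefix (\<alpha> \<cdot> \<kappa>) (\<alpha> \<cdot> \<kappa> \<cdot> \<gamma>)" using prefixI[OF m(1) g(1)] g(2) assms(2) k' by simp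
    from compat_prefix[OF cc prefix_refl this]
    have "compat (\<beta> \<cdot> \<kappa> \<cdot> \<gamma>) (\<alpha> \<cdot> \<kappa>)" using m g assms(3,4) k' by simp
    moreover have "compat (\<beta> \<cdot> \<kappa>) (\<alpha> \<cdot> \<kappa>)" using c[OF k'] by (rule compat_sym)
    ultimately obtain \<rho> \<tau> where "(\<rho>, \<tau>) \<in> min_ext \<Lambda> (\<beta> \<cdot> \<kappa>) (\<alpha> \<cdot> \<kappa>)" "compat \<gamma> \<rho>"
      using compat_comp_right[OF m(2) g(1)] g(2) k' assms(3,4) by auto
    then have "\<rho> \<in> E" "min_ext \<Lambda> \<gamma> \<rho> \<noteq> {}"
      unfolding E_def using imageI[of "(\<rho>, \<tau>)" _ fst] min_ext_nonempty_iff[OF g(1) min_extD(1)]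
      by auto
    then show "\<exists>\<mu>\<in>E. min_ext \<Lambda> \<gamma> \<mu> \<noteq> {}" by blast
  qed
  ultimately obtain \<rho> where "\<rho> \<in> E" "\<kappa> \<cdot> \<rho> \<in> U" using BF_exhaustive[OF assms(1) k(1)] by blast
  then obtain \<tau> where t: "(\<rho>, \<tau>) \<in> min_ext \<Lambda> (\<beta> \<cdot> \<kappa>) (\<alpha> \<cdot> \<kappa>)" "\<kappa> \<cdot> \<rho> \<in> U" by (auto simp: E_def)
  note q = min_extD[OF t(1)]
  have "prefix (\<alpha> \<cdot> \<kappa>) (\<beta> \<cdot> \<kappa> \<cdot> \<rho>)" unfolding q(5) using prefixI m q by simp
  also have "\<beta> \<cdot> \<kappa> \<cdot> \<rho> = \<beta> \<cdot> (\<kappa> \<cdot> \<rho>)" using cmp_assoc q(1,3) assms(3,4) k' by simp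
  finally have "prefix \<delta> (\<beta> \<cdot> (\<kappa> \<cdot> \<rho>))" using prefix_trans[OF k(2)] by simp
  then show "\<delta> \<in> prepend \<beta> U" using t(2) by (auto simp: prepend_def)
qed

lemma prepend_eq_of_compat:
  assumes "U \<in> BF" "\<alpha> \<in> M" "\<beta> \<in> M" "sr \<alpha> = sr \<beta>" "sr \<alpha> \<in> U"
    and "\<And>\<kappa>. \<kappa> \<in> M \<Longrightarrow> rg \<kappa> = sr \<alpha> \<Longrightarrow> compat (\<alpha> \<cdot> \<kappa>) (\<beta> \<cdot> \<kappa>)"
  shows "prepend \<alpha> U = prepend \<beta> U"
  using prepend_subset_of_compat[of U \<alpha> \<beta>] prepend_subset_of_compat[of U \<beta> \<alpha>] assms
  by (intro equalityI) (auto intro: compat_sym)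

end

section \<open>Line points in terms of finite paths\<close>

lemma below_mono: "p \<le> q \<Longrightarrow> below q m \<Longrightarrow> below p m"
  unfolding below_def le_fun_def by (meson enat_ord_simps(1) order_trans)

lemma below_zero [simp]: "below 0 m"
  by (simp add: below_def zero_enat_def[symmetric])

lemma below_sup: "below p m \<Longrightarrow> below q m \<Longrightarrow> below (sup p q) m"
  by (auto simp: below_def sup_fun_def sup_max max_def)

lemma below_eqI:
  assumes "\<And>n. below n m \<longleftrightarrow> below n m'" shows "m = m'"
proof
  fix i
  have "enat k \<le> m i \<longleftrightarrow> enat k \<le> m' i" for k
    using assms[of "\<lambda>j. if j = i then k else 0"]
    by (auto simp: below_def zero_enat_def[symmetric] split: if_splits)
  then show "m i = m' i"
    by (metis dual_order.refl enat_ile enat_ord_simps(1) linorder_not_le not_infinity_eq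
        order.antisym Suc_ile_eq Suc_n_not_le_n)
qed

lemma below_shift:
  assumes "below n m" shows "below q (\<lambda>i. m i - enat (n i)) \<longleftrightarrow> below (n + q) m"
proof -
  have "enat (q i) \<le> m i - enat (n i) \<longleftrightarrow> enat ((n + q) i) \<le> m i" for i
    using assms[unfolded below_def, rule_format, of i] by (cases "m i") auto
  then show ?thesis by (simp add: below_def)
qed

context k_graph
begin

abbreviation path_functor :: "('a, 'k) path \<Rightarrow> bool" where
  "path_functor y \<equiv> degree_preserving_functor (Omega (fst y)) \<Lambda> (snd y) \<and>
     snd y \<in> extensional (Mor (Omega (fst y)))"

definition segs :: "('a, 'k) path \<Rightarrow> 'a set" where
  "segs y = {snd y (0, n) | n. below n (fst y)}"

lemma path_functorD:
  assumes "path_functor y" "p \<le> q" "below q (fst y)"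
  shows "snd y (p, q) \<in> M" "rg (snd y (p, q)) = snd y (p, p)" "sr (snd y (p, q)) = snd y (q, q)"
    "dg (snd y (p, q)) = q - p"
proof -
  have "(p, q) \<in> Mor (Omega (fst y))" using assms(2,3) by (simp add: Omega_def)
  then have "snd y (p, q) \<in> M \<and> snd y (rng (Omega (fst y)) (p, q)) = rg (snd y (p, q)) \<and>
     snd y (src (Omega (fst y)) (p, q)) = sr (snd y (p, q)) \<and>
     dg (snd y (p, q)) = deg (Omega (fst y)) (p, q)"
    using assms(1) unfolding degree_preserving_functor_def by blast
  then show "snd y (p, q) \<in> M" "rg (snd y (p, q)) = snd y (p, p)" "sr (snd y (p, q)) = snd y (q, q)"
    "dg (snd y (p, q)) = q - p" by (simp_all add: Omega_def)
qed

lemma path_functor_comp: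
  assumes "path_functor y" "p \<le> q" "q \<le> n" "below n (fst y)"
  shows "snd y (p, n) = snd y (p, q) \<cdot> snd y (q, n)"
proof -
  let ?\<Omega> = "Omega (fst y)"
  have "(p, q) \<in> Mor ?\<Omega>" "(q, n) \<in> Mor ?\<Omega>" "src ?\<Omega> (p, q) = rng ?\<Omega> (q, n)"
    "cmp ?\<Omega> (p, q) (q, n) = (p, n)"
    using assms below_mono by (auto simp: Omega_def)
  then show ?thesis using assms(1) unfolding degree_preserving_functor_def by metis
qed

lemma path_functor_segment:
  assumes "path_functor y" "p \<le> q" "below q (fst y)"
  shows "prefix (snd y (0, p)) (snd y (0, q))"
proof -
  have p: "0 \<le> p" "below p (fst y)" using below_mono assms by (auto simp: le_fun_def)
  show ?thesis
    using path_functor_comp[OF assms(1) p(1) assms(2,3)] path_functorD[OF assms]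
      path_functorD[OF assms(1) p] prefixI by simp
qed

lemma path_functor_deg0:
  "path_functor y \<Longrightarrow> below n (fst y) \<Longrightarrow> dg (snd y (0, n)) = n"
  using path_functorD(4)[of y 0 n] by (simp add: le_fun_def)

lemma path_eqI:
  assumes y: "path_functor y" "path_functor y'" and eq: "segs y = segs y'"
  shows "y = y'"
proof -
  have below: "below n (fst y) \<longleftrightarrow> (\<exists>\<alpha>\<in>segs y. dg \<alpha> = n)" if "path_functor y" for y n
    unfolding segs_def using path_functor_deg0[OF that] by auto
  have m: "fst y = fst y'" by (rule below_eqI) (simp add: below y eq)
  have x0: "snd y (0, n) = snd y' (0, n)" if n: "below n (fst y)" for n
  proof -
    have "snd y (0, n) \<in> segs y" unfolding segs_def using n by blast
    then have "snd y (0, n) \<in> segs y'" unfolding eq .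
    then obtain n' where "below n' (fst y')" "snd y (0, n) = snd y' (0, n')" by (auto simp: segs_def)
    then show ?thesis using path_functor_deg0 y n by metis
  qed
  have "snd y (p, q) = snd y' (p, q)" if "(p, q) \<in> Mor (Omega (fst y))" for p q
  proof -
    have pq: "p \<le> q" "below q (fst y)" using that by (auto simp: Omega_def)
    then have p: "0 \<le> p" "below p (fst y)" using below_mono by (auto simp: le_fun_def)
    have "snd y (0, q) = snd y (0, p) \<cdot> snd y (p, q)" "snd y' (0, q) = snd y' (0, p) \<cdot> snd y' (p, q)"
      using path_functor_comp y p pq m by metis+
    moreover have "snd y (p, q) \<in> M" "sr (snd y (0, p)) = rg (snd y (p, q))"
       "snd y' (p, q) \<in> M" "sr (snd y' (0, p)) = rg (snd y' (p, q))" "snd y (0, p) \<in> M"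
      using path_functorD[OF y(1)] path_functorD[OF y(2)] p pq m by simp_all
    ultimately show ?thesis using x0 p pq comp_cancel_left by metis
  qed
  then have "snd y = snd y'"
    using y m by (intro extensionalityI[of _ "Mor (Omega (fst y))"]) auto
  then show ?thesis using m by (simp add: prod_eq_iff)
qed

lemma shift_functor:
  assumes y: "path_functor y" and n: "below n (fst y)"
  shows "path_functor (shift n y)" "segs (shift n y) = strip (snd y (0, n)) (segs y)"
proof -
  define m' where "m' = (\<lambda>i. fst y i - enat (n i))"
  have sh: "shift n y = (m', restrict (\<lambda>(p, q). snd y (n + p, n + q)) (Mor (Omega m')))"
    by (cases y) (simp add: shift_def m'_def Let_def)
  have bl: "below q m' \<longleftrightarrow> below (n + q) (fst y)" for q
    unfolding m'_def using below_shift[OF n] .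
  have le: "n + p \<le> n + q \<longleftrightarrow> p \<le> q" "n + q - (n + p) = q - p" for p q :: "'k \<Rightarrow> nat"
    by (auto simp: le_fun_def)
  let ?x = "restrict (\<lambda>(p, q). snd y (n + p, n + q)) (Mor (Omega m'))"
  have "degree_preserving_functor (Omega m') \<Lambda> ?x"
    unfolding degree_preserving_functor_def
  proof (intro conjI ballI impI)
    fix \<alpha> assume "\<alpha> \<in> Mor (Omega m')"
    then obtain p q where a: "\<alpha> = (p, q)" "p \<le> q" "below q m'" by (auto simp: Omega_def)
    then have "below p m'" using below_mono by blast
    then show "?x \<alpha> \<in> M"
      "?x (rng (Omega m') \<alpha>)
        = rg (?x \<alpha>)"
      "?x (src (Omega m') \<alpha>)
        = sr (?x \<alpha>)"
      "dg (?x \<alpha>) = deg (Omega m') \<alpha>"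
      using path_functorD[OF y, of "n + p" "n + q"] a le bl by (simp_all add: Omega_def)
  next
    fix \<alpha> \<beta> assume "\<alpha> \<in> Mor (Omega m')" "\<beta> \<in> Mor (Omega m')" "src (Omega m') \<alpha> = rng (Omega m') \<beta>"
    then obtain p q r where a: "\<alpha> = (p, q)" "\<beta> = (q, r)" "p \<le> q" "q \<le> r" "below q m'" "below r m'"
      by (auto simp: Omega_def)
    then have "p \<le> r" by simp
    then show "?x (cmp (Omega m') \<alpha> \<beta>)
      = ?x \<alpha> \<cdot>
        ?x \<beta>"
      using path_functor_comp[OF y, of "n + p" "n + q" "n + r"] a le bl by (simp add: Omega_def)
  qed
  then show "path_functor (shift n y)" unfolding sh by simp
  have seg: "snd (shift n y) (0, q) = snd y (n, n + q)" if "below q m'" for q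
    unfolding sh using that by (simp add: Omega_def le_fun_def)
  have n0: "0 \<le> n" "n \<le> n + q" for q by (auto simp: le_fun_def)
  note N = path_functorD[OF y n0(1) n]
  show "segs (shift n y) = strip (snd y (0, n)) (segs y)"
  proof (intro equalityI subsetI)
    fix \<alpha> assume "\<alpha> \<in> segs (shift n y)"
    then obtain q where q: "below q m'" "\<alpha> = snd y (n, n + q)" using seg by (auto simp: segs_def sh)
    note Q = path_functorD[OF y n0(2) q(1)[unfolded bl]]
    have "snd y (0, n) \<cdot> \<alpha> = snd y (0, n + q)"
      using path_functor_comp[OF y n0 q(1)[unfolded bl]] q(2) by simp
    then show "\<alpha> \<in> strip (snd y (0, n)) (segs y)"
      using Q N q bl by (auto simp: strip_def segs_def)
  next
    fix \<alpha> assume "\<alpha> \<in> strip (snd y (0, n)) (segs y)"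
    then obtain q where q: "\<alpha> \<in> M" "sr (snd y (0, n)) = rg \<alpha>" "below q (fst y)"
      "snd y (0, n) \<cdot> \<alpha> = snd y (0, q)" by (auto simp: strip_def segs_def)
    have "dg (snd y (0, n) \<cdot> \<alpha>) = n + dg \<alpha>" using q(1,2) N path_functor_deg0[OF y n] by simp
    then have d: "q = n + dg \<alpha>" using q(4) path_functor_deg0[OF y q(3)] by simp
    note b = q(3)[unfolded d]
    have "snd y (0, n) \<cdot> \<alpha> = snd y (0, n) \<cdot> snd y (n, n + dg \<alpha>)"
      using q(4) path_functor_comp[OF y n0 b] d by simp
    then have "\<alpha> = snd y (n, n + dg \<alpha>)"
      using comp_cancel_left[OF N(1) q(1,2)] path_functorD[OF y n0(2) b] N(3) by simp
    then show "\<alpha> \<in> segs (shift n y)" unfolding segs_def using seg[of "dg \<alpha>"] b bl sh by auto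
  qed
qed

lemma BF_degree_cofinal:
  assumes "U \<in> BF" "below n (\<lambda>i. SUP \<mu>\<in>U. enat (dg \<mu> i))"
  shows "\<exists>\<mu>\<in>U. dg \<mu> = n"
proof -
  have one: "\<exists>\<mu>\<in>U. n i \<le> dg \<mu> i" for i
  proof (cases "n i")
    case 0
    then show ?thesis using BF_nonempty[OF assms(1)] by auto
  next
    case (Suc l)
    then have "enat l < enat (n i)" by simp
    also have "\<dots> \<le> (SUP \<mu>\<in>U. enat (dg \<mu> i))" using assms(2) by (simp add: below_def)
    finally obtain \<mu> where "\<mu> \<in> U" "enat l < enat (dg \<mu> i)" by (auto simp: less_SUP_iff)
    then show ?thesis using Suc by (auto intro!: bexI[of _ \<mu>])
  qed
  have "\<exists>\<mu>\<in>U. \<forall>i\<in>I. n i \<le> dg \<mu> i" if "finite I" for I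
    using that
  proof (induction I rule: finite_induct)
    case empty
    then show ?case using BF_nonempty[OF assms(1)] by auto
  next
    case (insert i I)
    then obtain \<mu> \<nu> where "\<mu> \<in> U" "\<forall>i\<in>I. n i \<le> dg \<mu> i" "\<nu> \<in> U" "n i \<le> dg \<nu> i" using one by metis
    moreover then obtain \<gamma> where "\<gamma> \<in> U" "prefix \<mu> \<gamma>" "prefix \<nu> \<gamma>" using BF_directed[OF assms(1)] by blast
    moreover then have "dg \<mu> j \<le> dg \<gamma> j" "dg \<nu> j \<le> dg \<gamma> j" for j
      using prefix_deg unfolding le_fun_def by blast+
    ultimately show ?case by (metis insertE order_trans)
  qed
  from this[of UNIV] obtain \<gamma> where g: "\<gamma> \<in> U" "n \<le> dg \<gamma>" by (auto simp: le_fun_def)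
  then obtain \<mu> \<nu> where "\<mu> \<in> M" "\<nu> \<in> M" "sr \<mu> = rg \<nu>" "dg \<mu> = n" "\<gamma> = \<mu> \<cdot> \<nu>"
    using factor BF_mor[OF assms(1)] by metis
  then show ?thesis using BF_comp_down[OF assms(1)] g(1) by blast
qed

text \<open>The degree of the path is the supremum of the degrees of the members of \<open>U\<close>; by directedness
  \<open>U\<close> has exactly one member of each finite degree below it.\<close>

lemma BF_boundary_path:
  assumes U: "U \<in> BF"
  obtains y where "y \<in> boundary_paths \<Lambda>" "segs y = U"
proof -
  define m where "m = (\<lambda>i. SUP \<mu>\<in>U. enat (dg \<mu> i))"
  (* seg n is the member of U of degree n; arc p q is what leads from seg p to seg q. *)
  define seg where "seg = (\<lambda>n. THE \<mu>. \<mu> \<in> U \<and> dg \<mu> = n)"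
  have seg_eq: "seg (dg \<mu>) = \<mu>" if "\<mu> \<in> U" for \<mu>
    unfolding seg_def using that BF_eq_deg[OF U] by (intro the_equality) blast+
  have seg: "seg n \<in> U" "dg (seg n) = n" if "below n m" for n
    using BF_degree_cofinal[OF U, of n] that seg_eq unfolding m_def by metis+
  have deg_below: "below (dg \<mu>) m" if "\<mu> \<in> U" for \<mu>
    unfolding below_def m_def using that by (auto intro: SUP_upper)
  define arc where "arc = (\<lambda>p q. SOME \<beta>. \<beta> \<in> M \<and> sr (seg p) = rg \<beta> \<and> seg q = seg p \<cdot> \<beta>)"
  have arc: "arc p q \<in> M \<and> sr (seg p) = rg (arc p q) \<and> seg q = seg p \<cdot> arc p q"
    if "p \<le> q" "below q m" for p q
  proof -
    have "below p m" using that below_mono by blast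
    then have s: "seg p \<in> U" "seg q \<in> U" "dg (seg p) \<le> dg (seg q)" using seg that by auto
    then obtain \<gamma> where "prefix (seg p) \<gamma>" "prefix (seg q) \<gamma>" using BF_directed[OF U] by blast
    then have "prefix (seg p) (seg q)" using prefix_of_deg_le s(3) by blast
    then have "\<exists>\<beta>. \<beta> \<in> M \<and> sr (seg p) = rg \<beta> \<and> seg q = seg p \<cdot> \<beta>" by (auto simp: prefix_def)
    then show ?thesis unfolding arc_def by (rule someI_ex)
  qed
  have segM: "seg n \<in> M" if "below n m" for n using seg(1)[OF that] BF_mor[OF U] by blast
  have arc_eq: "arc p q = \<beta>"
    if "p \<le> q" "below q m" "\<beta> \<in> M" "sr (seg p) = rg \<beta>" "seg q = seg p \<cdot> \<beta>" for p q \<beta>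
    using comp_cancel_left[OF segM[OF below_mono[OF that(1,2)]]] that(3-5) arc[OF that(1,2)]
    by metis
  have arc_refl: "arc p p = sr (seg p)" if "below p m" for p
    using arc_eq[of p p "sr (seg p)"] that segM[OF that] by simp
  have arc_comp: "arc p n = arc p q \<cdot> arc q n" and arc_src: "sr (arc p q) = sr (seg q)"
    if "p \<le> q" "q \<le> n" "below n m" for p q n
  proof -
    have b: "below q m" "below p m" "p \<le> n" using that below_mono by (blast, metis order_trans, simp)
    note A = arc[OF that(1) b(1)] arc[OF that(2,3)]
    show s: "sr (arc p q) = sr (seg q)" using A segM[OF b(2)] src_cmp by metis
    show "arc p n = arc p q \<cdot> arc q n"
    proof (rule arc_eq[OF b(3) that(3)])
      show "arc p q \<cdot> arc q n \<in> M" "sr (seg p) = rg (arc p q \<cdot> arc q n)" using A s by simp_all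
      have "seg n = seg p \<cdot> arc p q \<cdot> arc q n" using A by metis
      also have "\<dots> = seg p \<cdot> (arc p q \<cdot> arc q n)" using A s segM[OF b(2)] cmp_assoc by metis
      finally show "seg n = seg p \<cdot> (arc p q \<cdot> arc q n)" .
    qed
  qed
  have arc_deg: "dg (arc p q) = q - p" if "p \<le> q" "below q m" for p q
  proof -
    have b: "below p m" using that below_mono by blast
    have "q = dg (seg p \<cdot> arc p q)" using arc[OF that] seg(2)[OF that(2)] by metis
    also have "\<dots> = p + dg (arc p q)" using arc[OF that] segM[OF b] seg(2)[OF b] by simp
    finally show ?thesis by (metis add_diff_cancel_left')
  qed
  have seg0: "seg 0 = rg (seg n)" "0 \<le> n" if "below n m" for n
    using seg_eq[OF BF_rng[OF U seg(1)[OF that]]] segM[OF that] by (simp_all add: le_fun_def)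
  have arc0: "arc 0 n = seg n" if "below n m" for n
    using arc_eq[OF seg0(2)[OF that] that, of "seg n"] segM[OF that] seg0(1)[OF that] by simp
  define x where "x = restrict (\<lambda>(p, q). arc p q) (Mor (Omega m))"
  have x: "x (p, q) = arc p q" if "p \<le> q" "below q m" for p q
    unfolding x_def using that by (simp add: Omega_def)
  have "degree_preserving_functor (Omega m) \<Lambda> x"
    unfolding degree_preserving_functor_def
  proof (intro conjI ballI impI)
    fix \<alpha> assume "\<alpha> \<in> Mor (Omega m)"
    then obtain p q where a: "\<alpha> = (p, q)" "p \<le> q" "below q m" by (auto simp: Omega_def)
    have b: "below p m" using a below_mono by blast
    show "x \<alpha> \<in> M" "x (rng (Omega m) \<alpha>) = rg (x \<alpha>)" "x (src (Omega m) \<alpha>) = sr (x \<alpha>)"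
      "dg (x \<alpha>) = deg (Omega m) \<alpha>"
      using a b x arc[OF a(2,3)] arc_refl arc_src[OF a(2) order_refl a(3)] arc_deg
      by (simp_all add: Omega_def)
  next
    fix \<alpha> \<beta> assume "\<alpha> \<in> Mor (Omega m)" "\<beta> \<in> Mor (Omega m)" "src (Omega m) \<alpha> = rng (Omega m) \<beta>"
    then obtain p q n where a: "\<alpha> = (p, q)" "\<beta> = (q, n)" "p \<le> q" "q \<le> n" "below q m" "below n m"
      by (auto simp: Omega_def)
    then have "p \<le> n" by simp
    then show "x (cmp (Omega m) \<alpha> \<beta>) = x \<alpha> \<cdot> x \<beta>"
      using a x arc_comp[OF a(3,4,6)] by (simp add: Omega_def)
  qed
  moreover have "\<exists>\<epsilon>\<in>E. below (n + dg \<epsilon>) m \<and> x (n, n + dg \<epsilon>) = \<epsilon>"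
    if n: "below n m" and E: "E \<in> FE_at \<Lambda> (x (n, n))" for n E
  proof -
    have "x (n, n) = sr (seg n)" using x arc_refl n by simp
    then obtain \<epsilon> where e: "\<epsilon> \<in> E" "seg n \<cdot> \<epsilon> \<in> U" using BF_FE[OF U seg(1)[OF n]] E by metis
    have e': "\<epsilon> \<in> M" "sr (seg n) = rg \<epsilon>"
      using e(1) E \<open>x (n, n) = _\<close> by (auto simp: FE_at_def paths_from_def)
    have d: "dg (seg n \<cdot> \<epsilon>) = n + dg \<epsilon>" using segM[OF n] e' seg(2)[OF n] by simp
    have b: "below (n + dg \<epsilon>) m" using deg_below[OF e(2)] d by simp
    have "n \<le> n + dg \<epsilon>" by (simp add: le_fun_def)
    then have "x (n, n + dg \<epsilon>) = \<epsilon>" using x b arc_eq e' seg_eq[OF e(2)] d by metis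
    then show ?thesis using e(1) b by blast
  qed
  moreover have "x \<in> extensional (Mor (Omega m))" by (simp add: x_def)
  ultimately have "(m, x) \<in> boundary_paths \<Lambda>" unfolding boundary_paths_def by blast
  moreover have "segs (m, x) = U"
  proof (intro equalityI subsetI)
    fix \<alpha> assume "\<alpha> \<in> segs (m, x)"
    then show "\<alpha> \<in> U" using x arc0 seg seg0 by (auto simp: segs_def)
  next
    fix \<alpha> assume "\<alpha> \<in> U"
    then have "x (0, dg \<alpha>) = \<alpha>" "below (dg \<alpha>) m" using x arc0 seg_eq deg_below seg0 by simp_all
    then show "\<alpha> \<in> segs (m, x)" unfolding segs_def by force
  qed
  ultimately show thesis by (rule that)
qed

text \<open>If \<open>v\<delta>\<Lambda> = {x}\<close> then every path with
  range \<open>v\<close> is an initial segment of \<open>x\<close>, since it lies on some boundary path; and two of them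
  with the same source would give two equal shifts of \<open>x\<close>. Conversely, if all paths with range
  \<open>v\<close> are compatible, then each of them forms an exhaustive set, so it is an initial segment of every
  boundary path in \<open>v\<delta>\<Lambda>\<close>, and equal shifts of that path would remove segments with equal sources.\<close>

theorem line_points_iff:
  "v \<in> line_points \<Lambda> \<longleftrightarrow> v \<in> vertices \<Lambda> \<and>
     (\<forall>\<alpha>\<in>paths_from \<Lambda> v. \<forall>\<beta>\<in>paths_from \<Lambda> v. compat \<alpha> \<beta> \<and> (sr \<alpha> = sr \<beta> \<longrightarrow> \<alpha> = \<beta>))"
  (is "_ \<longleftrightarrow> _ \<and> ?R")
proof (intro iffI conjI)
  assume L: "v \<in> line_points \<Lambda>"
  then obtain y where v: "v \<in> vertices \<Lambda>" and y: "boundary_paths_from \<Lambda> v = {y}" "aperiodic y"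
    by (auto simp: line_points_def)
  show "v \<in> vertices \<Lambda>" by fact
  have "y \<in> boundary_paths_from \<Lambda> v" using y(1) by simp
  then have bp: "y \<in> boundary_paths \<Lambda>" "snd y (0, 0) = v"
    by (auto simp: boundary_paths_from_def)
  then have F: "path_functor y" by (auto simp: boundary_paths_def)
  have sub: "\<mu> \<in> segs y" if m: "\<mu> \<in> paths_from \<Lambda> v" for \<mu>
  proof -
    have m': "\<mu> \<in> M" "rg \<mu> = v" using m by (auto simp: paths_from_def)
    then obtain U where U: "U \<in> BF" "\<mu> \<in> U" using BF_exists by blast
    then obtain y' where y': "y' \<in> boundary_paths \<Lambda>" "segs y' = U" using BF_boundary_path by blast
    then have F': "path_functor y'" by (auto simp: boundary_paths_def)
    have "snd y' (0, 0) \<in> segs y'" unfolding segs_def using below_zero by blast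
    moreover have "v \<in> U" using BF_rng[OF U] m' by simp
    ultimately have "snd y' (0, 0) = v"
      using BF_eq_deg[OF U(1)] y'(2) path_functor_deg0[OF F' below_zero] v
      by (simp add: vertices_def)
    then have "y' \<in> boundary_paths_from \<Lambda> v" using y'(1) by (cases y') (simp add: boundary_paths_from_def)
    then show ?thesis using y U(2) y'(2) by simp
  qed
  show ?R
  proof (intro ballI conjI impI)
    fix \<alpha> \<beta> assume ab: "\<alpha> \<in> paths_from \<Lambda> v" "\<beta> \<in> paths_from \<Lambda> v"
    obtain p q where p: "below p (fst y)" "\<alpha> = snd y (0, p)" and q: "below q (fst y)" "\<beta> = snd y (0, q)"
      using sub[OF ab(1)] sub[OF ab(2)] unfolding segs_def by blast
    show "compat \<alpha> \<beta>"
      unfolding p(2) q(2)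
      by (rule compatI[of _ "snd y (0, sup p q)"])
        (auto intro!: path_functor_segment[OF F] below_sup p q)
    assume s: "sr \<alpha> = sr \<beta>"
    have "segs (shift p y) = segs (shift q y)"
    proof -
      have "\<alpha> \<in> M" "\<beta> \<in> M" "rg \<alpha> = v" "rg \<beta> = v" using ab by (auto simp: paths_from_def)
      then have "\<alpha> \<cdot> \<gamma> \<in> segs y" "\<beta> \<cdot> \<gamma> \<in> segs y" if "\<gamma> \<in> M" "sr \<beta> = rg \<gamma>" for \<gamma>
        using sub s that by (simp_all add: paths_from_def)
      then show ?thesis
        unfolding shift_functor(2)[OF F p(1)] shift_functor(2)[OF F q(1)] p(2)[symmetric] q(2)[symmetric]
        using s by (auto simp: strip_def)
    qed
    then have "shift p y = shift q y"
      using path_eqI[OF shift_functor(1)[OF F p(1)] shift_functor(1)[OF F q(1)]] by blast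
    then have "p = q" using y(2) p q unfolding aperiodic_def by blast
    then show "\<alpha> = \<beta>" using p q by simp
  qed
next
  assume R: "v \<in> vertices \<Lambda> \<and> ?R"
  then have v: "v \<in> M" "rg v = v" "v \<in> vertices \<Lambda>" using vertex_rng_src by auto
  have F: "path_functor y" if "y \<in> boundary_paths_from \<Lambda> v" for y
    using that by (auto simp: boundary_paths_from_def boundary_paths_def)
  have segs: "segs y = paths_from \<Lambda> v" if y: "y \<in> boundary_paths_from \<Lambda> v" for y
  proof (intro equalityI subsetI)
    fix \<alpha> assume "\<alpha> \<in> segs y"
    then obtain n where n: "below n (fst y)" "\<alpha> = snd y (0, n)" by (auto simp: segs_def)
    have "snd y (0, 0) = v" using y by (auto simp: boundary_paths_from_def)
    then show "\<alpha> \<in> paths_from \<Lambda> v"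
      using path_functorD[OF F[OF y] _ n(1), of 0] n(2) by (simp add: paths_from_def le_fun_def)
  next
    fix \<mu> assume m: "\<mu> \<in> paths_from \<Lambda> v"
    have y0: "snd y (0, 0) = v" using y by (auto simp: boundary_paths_from_def)
    show "\<mu> \<in> segs y"
    proof (cases "\<mu> = v")
      case True
      then show ?thesis unfolding segs_def using y0 below_zero by blast
    next
      case False
      have "{\<mu>} \<in> FE_at \<Lambda> (snd y (0, 0))"
      proof -
        have "min_ext \<Lambda> \<alpha> \<mu> \<noteq> {}" if "\<alpha> \<in> paths_from \<Lambda> v" for \<alpha>
          using R m that min_ext_nonempty_iff[of \<alpha> \<mu>] unfolding paths_from_def by blast
        then show ?thesis unfolding y0 FE_at_def exhaustive_def using m False by simp
      qed
      moreover have "\<forall>n. below n (fst y) \<longrightarrow> (\<forall>E\<in>FE_at \<Lambda> (snd y (n, n)).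
        \<exists>\<alpha>\<in>E. below (n + dg \<alpha>) (fst y) \<and> snd y (n, n + dg \<alpha>) = \<alpha>)"
        using y by (auto simp: boundary_paths_from_def boundary_paths_def)
      ultimately have "below (0 + dg \<mu>) (fst y) \<and> snd y (0, 0 + dg \<mu>) = \<mu>"
        using below_zero[of "fst y"] by blast
      then have "snd y (0, dg \<mu>) = \<mu>" "below (dg \<mu>) (fst y)" by simp_all
      then show ?thesis unfolding segs_def by force
    qed
  qed
  obtain U where U: "U \<in> BF" "v \<in> U" using BF_exists v by blast
  then obtain y where y: "y \<in> boundary_paths \<Lambda>" "segs y = U" using BF_boundary_path by blast
  have Fy: "path_functor y" using y(1) by (auto simp: boundary_paths_def)
  have "snd y (0, 0) \<in> segs y" unfolding segs_def using below_zero by blast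
  then have "snd y (0, 0) = v"
    using BF_eq_deg[OF U(1)] y(2) path_functor_deg0[OF Fy below_zero] U(2) v
    by (simp add: vertices_def)
  then have yv: "y \<in> boundary_paths_from \<Lambda> v" using y(1) by (cases y) (simp add: boundary_paths_from_def)
  then have one: "boundary_paths_from \<Lambda> v = {y}"
  proof -
    have "z = y" if z: "z \<in> boundary_paths_from \<Lambda> v" for z
      using path_eqI[OF F[OF z] F[OF yv]] segs[OF z] segs[OF yv] by simp
    then show ?thesis using yv by blast
  qed
  have "aperiodic y" unfolding aperiodic_def
  proof (intro allI impI notI)
    fix m n assume b: "below m (fst y)" "below n (fst y)" "m \<noteq> n" and eq: "shift m y = shift n y"
    have "snd (shift l y) (0, 0) = sr (snd y (0, l))" if "below l (fst y)" for l
      using path_functorD(3)[OF Fy _ that, of 0]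
      by (cases y) (simp add: shift_def Omega_def le_fun_def Let_def)
    then have "sr (snd y (0, m)) = sr (snd y (0, n))" using b eq by metis
    moreover have "snd y (0, m) \<in> segs y" "snd y (0, n) \<in> segs y" using b by (auto simp: segs_def)
    ultimately have "snd y (0, m) = snd y (0, n)" using R segs[OF yv] by blast
    then show False using path_functor_deg0[OF Fy] b by metis
  qed
  then show "v \<in> line_points \<Lambda>" using one v unfolding line_points_def by blast
qed

end

section \<open>The ring of Laurent polynomials\<close>

lemma poly_mapping_induct_sum [case_names zero single add]:
  fixes f :: "'w \<Rightarrow>\<^sub>0 'c::comm_monoid_add"
  assumes "P 0" "\<And>w c. P (Poly_Mapping.single w c)" "\<And>f g. P f \<Longrightarrow> P g \<Longrightarrow> P (f + g)"
  shows "P f"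
proof (induction f rule: update_induct)
  case const
  then show ?case using assms(1) .
next
  case (update f a b)
  have "Poly_Mapping.update a b f = f + Poly_Mapping.single a b"
    using update(1)
    by (intro poly_mapping_eqI)
      (auto simp: lookup_update lookup_add lookup_single when_def in_keys_iff)
  then show ?case using assms(2,3) update by metis
qed

lemma single_zero_mult_commute:
  fixes f :: "'w::monoid_add \<Rightarrow>\<^sub>0 'c::comm_semiring_0"
  shows "Poly_Mapping.single 0 c * f = f * Poly_Mapping.single 0 c"
  by (induction f rule: poly_mapping_induct_sum)
    (simp_all add: mult_single mult.commute distrib_left distrib_right)

text \<open>Laurent polynomials in countably many variables. Degrees are embedded as exponents by
  \<open>expo\<close>; finitely supported functions \<open>nat \<Rightarrow>\<^sub>0 int\<close> carry a linear group order, the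
  lexicographic one, which makes this ring an integral domain.\<close>

type_synonym 'f laurent = "(nat \<Rightarrow>\<^sub>0 int) \<Rightarrow>\<^sub>0 'f"

definition expo :: "('k::finite \<Rightarrow> nat) \<Rightarrow> nat \<Rightarrow>\<^sub>0 int" where
  "expo n = (\<Sum>i\<in>UNIV. Poly_Mapping.single (to_nat i) (int (n i)))"

lemma expo_add: "expo (m + n) = expo m + expo n"
  by (simp add: expo_def single_add sum.distrib)

lemma lookup_expo: "Poly_Mapping.lookup (expo n) (to_nat i) = int (n i)"
  by (simp add: expo_def lookup_sum lookup_single when_def)

lemma expo_inject [simp]: "expo m = expo n \<longleftrightarrow> m = n"
proof
  assume "expo m = expo n"
  then have "int (m i) = int (n i)" for i using lookup_expo by metis
  then show "m = n" by auto
qed simp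

lemma expo_zero [simp]: "expo 0 = 0"
  by (simp add: expo_def)

definition zpow :: "(nat \<Rightarrow>\<^sub>0 int) \<Rightarrow> 'f::field laurent" where
  "zpow e = Poly_Mapping.single e 1"

lemma zpow_mult: "zpow a * zpow b = zpow (a + b)"
  by (simp add: zpow_def mult_single)

lemma zpow_zero [simp]: "zpow 0 = 1"
  by (simp add: zpow_def)

lemma zpow_inject [simp]: "zpow a = (zpow b :: 'f::field laurent) \<longleftrightarrow> a = b"
proof
  assume "zpow a = (zpow b :: 'f laurent)"
  then have "Poly_Mapping.keys (zpow a :: 'f laurent) = Poly_Mapping.keys (zpow b :: 'f laurent)" by simp
  then show "a = b" by (simp add: zpow_def)
qed simp

text \<open>Evaluation at \<open>(1, 1, \<dots>)\<close>. It is multiplicative and kills \<open>zpow e - 1\<close>, so the latter is not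
  a unit.\<close>

definition augment :: "'f::field laurent \<Rightarrow> 'f" where
  "augment p = (\<Sum>e\<in>Poly_Mapping.keys p. Poly_Mapping.lookup p e)"

lemma augment_add: "augment (p + q) = augment p + augment q"
  unfolding augment_def by (rule setsum_keys_plus_distrib) auto

lemma augment_single: "augment (Poly_Mapping.single e c) = c"
  by (simp add: augment_def)

lemma augment_zero [simp]: "augment 0 = 0"
  by (simp add: augment_def)

lemma augment_mult: "augment (p * q) = augment p * augment q"
proof (induction p rule: poly_mapping_induct_sum)
  case (single w c)
  show ?case
    by (induction q rule: poly_mapping_induct_sum)
      (simp_all add: augment_single augment_add mult_single distrib_left)
qed (simp_all add: augment_add distrib_right)

lemma zpow_minus_one_not_unit:
  fixes u :: "'f::field laurent"
  shows "(zpow e - 1) * u \<noteq> 1"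
proof
  assume "(zpow e - 1) * u = 1"
  then have "zpow e * u = 1 + u" by (simp add: algebra_simps)
  then have "augment (zpow e * u) = augment (1 + u)" by simp
  moreover have "augment (1 :: 'f laurent) = 1" using augment_single[of 0 1] by simp
  ultimately show False by (simp add: augment_mult augment_add zpow_def augment_single)
qed

section \<open>The action on functions of boundary paths\<close>

context k_graph
begin

text \<open>The path \<open>\<kappa>\<close> sends the point mass at \<open>x\<close> to a multiple of the point mass at \<open>\<kappa>x\<close>, and its
  ghost reverses this. The Laurent monomials keep track of degrees; without them,
  \<open>s\<^sub>\<alpha> s\<^sub>\<beta>*\<close> would fix the point mass at \<open>\<alpha>x\<close> whenever \<open>\<alpha>x = \<beta>x\<close>, just as a vertex does.\<close>

primrec letter_op :: "'a letter \<Rightarrow> ('a set \<Rightarrow> 'f::field laurent) \<Rightarrow> 'a set \<Rightarrow> 'f laurent" where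
  "letter_op (Path \<kappa>) m = (\<lambda>U. if U \<in> BF \<and> \<kappa> \<in> U then zpow (expo (dg \<kappa>)) * m (strip \<kappa> U) else 0)"
| "letter_op (Ghost \<kappa>) m = (\<lambda>U. if U \<in> BF \<and> sr \<kappa> \<in> U then zpow (- expo (dg \<kappa>)) * m (prepend \<kappa> U) else 0)"

definition act :: "('a, 'f) free \<Rightarrow> ('a set \<Rightarrow> 'f::field laurent) \<Rightarrow> 'a set \<Rightarrow> 'f laurent" where
  "act f m U = (\<Sum>w\<in>Poly_Mapping.keys f. Poly_Mapping.single 0 (Poly_Mapping.lookup f w) * foldr letter_op w m U)"

lemma act_zero [simp]: "act 0 m = (\<lambda>U. 0)"
  by (simp add: act_def fun_eq_iff)

lemma act_add: "act (f + g) m = (\<lambda>U. act f m U + act g m U)"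
  unfolding act_def fun_eq_iff
  by (intro allI setsum_keys_plus_distrib) (simp_all add: single_add distrib_right)

lemma act_single: "act (Poly_Mapping.single w c) m = (\<lambda>U. Poly_Mapping.single 0 c * foldr letter_op w m U)"
  by (simp add: act_def fun_eq_iff)

lemma act_uminus: "act (- f) m = (\<lambda>U. - act f m U)"
proof -
  have "act (- f + f) m = (\<lambda>U. act (- f) m U + act f m U)" by (rule act_add)
  then show ?thesis by (simp add: fun_eq_iff eq_neg_iff_add_eq_0)
qed

lemma act_diff: "act (f - g) m = (\<lambda>U. act f m U - act g m U)"
  using act_add[of f "- g"] act_uminus[of g] by simp

lemma act_sum: "act (sum f A) m = (\<lambda>U. \<Sum>i\<in>A. act (f i) m U)"
  by (induction A rule: infinite_finite_induct) (simp_all add: act_add)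

lemma letter_op_linear:
  "letter_op l (\<lambda>U. m U + m' U) = (\<lambda>U. letter_op l m U + letter_op l m' U)"
  "letter_op l (\<lambda>U. a * m U) = (\<lambda>U. a * letter_op l m U)"
  by (cases l; auto simp: fun_eq_iff algebra_simps)+

lemma word_op_linear:
  "foldr letter_op w (\<lambda>U. m U + m' U) = (\<lambda>U. foldr letter_op w m U + foldr letter_op w m' U)"
  "foldr letter_op w (\<lambda>U. a * m U) = (\<lambda>U. a * foldr letter_op w m U)"
  by (induction w) (simp_all add: letter_op_linear)

lemma act_scale: "act f (\<lambda>U. a * m U) = (\<lambda>U. a * act f m U)"
  by (simp add: act_def fun_eq_iff word_op_linear sum_distrib_left mult.left_commute)

lemma act_add_right: "act f (\<lambda>U. m U + m' U) = (\<lambda>U. act f m U + act f m' U)"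
  by (simp add: act_def fun_eq_iff word_op_linear sum.distrib distrib_left)

lemma act_zero_right [simp]: "act f (\<lambda>U. 0) = (\<lambda>U. 0)"
  using act_scale[of f 0 "\<lambda>U. 0"] by simp

lemma act_mult: "act (f * g) m = act f (act g m)"
proof (induction f rule: poly_mapping_induct_sum)
  case (single w c)
  show ?case
  proof (induction g rule: poly_mapping_induct_sum)
    case (single w' c')
    show ?case
      by (simp add: mult_single act_single word_op_linear fun_eq_iff plus_list_def mult.assoc[symmetric])
  qed (simp_all add: act_add distrib_left act_add_right)
qed (simp_all add: act_add distrib_right)

lemma act_path: "act (gen (Path \<kappa>)) m = (\<lambda>U. if U \<in> BF \<and> \<kappa> \<in> U then zpow (expo (dg \<kappa>)) * m (strip \<kappa> U) else 0)"
  and act_ghost: "act (gen (Ghost \<kappa>)) m =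
    (\<lambda>U. if U \<in> BF \<and> sr \<kappa> \<in> U then zpow (- expo (dg \<kappa>)) * m (prepend \<kappa> U) else 0)"
  by (simp_all add: act_single)

lemma act_scalar: "act (Poly_Mapping.single 0 c * f) m = (\<lambda>U. Poly_Mapping.single 0 c * act f m U)"
  by (simp add: act_mult act_single zero_list_def)

lemma act_one: "act 1 m = m"
  by (simp add: act_def zero_list_def fun_eq_iff lookup_one)

lemma strip_vertex:
  assumes "v \<in> vertices \<Lambda>" "U \<in> BF" "v \<in> U" shows "strip v U = U"
proof -
  have "\<alpha> \<in> strip v U \<longleftrightarrow> \<alpha> \<in> U" for \<alpha>
  proof (cases "\<alpha> \<in> M \<and> rg \<alpha> = v")
    case True
    then have "v \<cdot> \<alpha> = \<alpha>" "sr v = rg \<alpha>" using cmp_rng vertex_rng_src(3)[OF assms(1)] by auto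
    then show ?thesis using True by (simp add: strip_def)
  next
    case False
    then have "\<alpha> \<notin> U"
      using BF_mor[OF assms(2)] BF_rng_eq[OF assms(2) _ assms(3)] vertex_rng_src[OF assms(1)] by metis
    then show ?thesis using False vertex_rng_src(3)[OF assms(1)] unfolding strip_def by auto
  qed
  then show ?thesis by blast
qed

lemma prepend_vertex:
  assumes "v \<in> vertices \<Lambda>" "U \<in> BF" "v \<in> U" shows "prepend v U = U"
proof -
  have *: "\<alpha> \<in> M" "v \<cdot> \<alpha> = \<alpha>" if "\<alpha> \<in> U" for \<alpha>
    using BF_mor[OF assms(2) that] BF_rng_eq[OF assms(2) that assms(3)] vertex_rng_src[OF assms(1)]
      cmp_rng by (simp, metis)
  show ?thesis
  proof (intro equalityI subsetI)
    fix \<alpha> assume "\<alpha> \<in> prepend v U"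
    then show "\<alpha> \<in> U" using *(2) BF_down[OF assms(2)] unfolding prepend_def by auto
  next
    fix \<alpha> assume "\<alpha> \<in> U"
    then show "\<alpha> \<in> prepend v U" using * prefix_refl unfolding prepend_def by force
  qed
qed

lemma act_vertex:
  assumes "v \<in> vertices \<Lambda>"
  shows "act (gen (Path v)) m = (\<lambda>U. if U \<in> BF \<and> v \<in> U then m U else 0)"
    "act (gen (Ghost v)) m = (\<lambda>U. if U \<in> BF \<and> v \<in> U then m U else 0)"
proof -
  have d: "expo (dg v) = 0" using assms by (simp add: vertices_def)
  have s: "sr v = v" using vertex_rng_src(3)[OF assms] .
  have "act (gen (Path v)) m U = (if U \<in> BF \<and> v \<in> U then m U else 0)"
    "act (gen (Ghost v)) m U = (if U \<in> BF \<and> v \<in> U then m U else 0)" for U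
    unfolding act_path act_ghost s d using strip_vertex[OF assms] prepend_vertex[OF assms] by simp_all
  then show "act (gen (Path v)) m = (\<lambda>U. if U \<in> BF \<and> v \<in> U then m U else 0)"
    "act (gen (Ghost v)) m = (\<lambda>U. if U \<in> BF \<and> v \<in> U then m U else 0)"
    by blast+
qed

end

context finitely_aligned_k_graph
begin

lemma act_path_path:
  assumes "\<alpha> \<in> M" "\<mu> \<in> M" "sr \<alpha> = rg \<mu>"
  shows "act (gen (Path \<alpha>)) (act (gen (Path \<mu>)) m) = act (gen (Path (\<alpha> \<cdot> \<mu>))) m"
proof
  fix U
  have "(\<alpha> \<in> U \<and> strip \<alpha> U \<in> BF \<and> \<mu> \<in> strip \<alpha> U) \<longleftrightarrow> \<alpha> \<cdot> \<mu> \<in> U" if "U \<in> BF"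
  proof -
    have "\<mu> \<in> strip \<alpha> U \<longleftrightarrow> \<alpha> \<cdot> \<mu> \<in> U" using assms by (simp add: strip_def)
    then show ?thesis using strip_BF[OF that] BF_comp_down[OF that _ assms] by blast
  qed
  then show "act (gen (Path \<alpha>)) (act (gen (Path \<mu>)) m) U = act (gen (Path (\<alpha> \<cdot> \<mu>))) m U"
    using assms strip_comp[OF assms] by (auto simp: act_path zpow_mult expo_add mult.assoc[symmetric])
qed

lemma act_ghost_ghost:
  assumes "\<alpha> \<in> M" "\<mu> \<in> M" "sr \<alpha> = rg \<mu>"
  shows "act (gen (Ghost \<mu>)) (act (gen (Ghost \<alpha>)) m) = act (gen (Ghost (\<alpha> \<cdot> \<mu>))) m"
proof
  fix U
  show "act (gen (Ghost \<mu>)) (act (gen (Ghost \<alpha>)) m) U = act (gen (Ghost (\<alpha> \<cdot> \<mu>))) m U"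
  proof (cases "U \<in> BF \<and> sr \<mu> \<in> U")
    case True
    then have "prepend \<mu> U \<in> BF" "sr \<alpha> \<in> prepend \<mu> U"
      using prepend_BF[of U \<mu>] BF_rng[OF _ mem_prepend_self[of \<mu> U]] assms by auto
    then show ?thesis
      using True assms prepend_comp[OF assms, of U]
      by (simp add: act_ghost zpow_mult expo_add mult.assoc[symmetric])
  next
    case False
    then show ?thesis using assms by (auto simp: act_ghost)
  qed
qed

lemma act_path_ghost:
  assumes "\<alpha> \<in> M" "\<beta> \<in> M" "sr \<alpha> = sr \<beta>"
  shows "act (gen (Path \<alpha>)) (act (gen (Ghost \<beta>)) m) =
    (\<lambda>U. if U \<in> BF \<and> \<alpha> \<in> U then zpow (expo (dg \<alpha>) - expo (dg \<beta>)) * m (prepend \<beta> (strip \<alpha> U)) else 0)"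
proof
  fix U
  have "sr \<beta> \<in> strip \<alpha> U" if "\<alpha> \<in> U" using that assms by (simp add: strip_def assms(3)[symmetric])
  then show "act (gen (Path \<alpha>)) (act (gen (Ghost \<beta>)) m) U =
    (if U \<in> BF \<and> \<alpha> \<in> U then zpow (expo (dg \<alpha>) - expo (dg \<beta>)) * m (prepend \<beta> (strip \<alpha> U)) else 0)"
    using strip_BF by (simp add: act_path act_ghost zpow_mult mult.assoc[symmetric])
qed

lemma act_ghost_path:
  assumes "\<alpha> \<in> M" "\<beta> \<in> M"
  shows "act (gen (Ghost \<alpha>)) (act (gen (Path \<beta>)) m) =
    (\<lambda>U. if U \<in> BF \<and> sr \<alpha> \<in> U \<and> \<beta> \<in> prepend \<alpha> U
      then zpow (expo (dg \<beta>) - expo (dg \<alpha>)) * m (strip \<beta> (prepend \<alpha> U)) else 0)"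
proof
  fix U
  have "- expo (dg \<alpha>) + expo (dg \<beta>) = expo (dg \<beta>) - expo (dg \<alpha>)" by simp
  then show "act (gen (Ghost \<alpha>)) (act (gen (Path \<beta>)) m) U =
    (if U \<in> BF \<and> sr \<alpha> \<in> U \<and> \<beta> \<in> prepend \<alpha> U
      then zpow (expo (dg \<beta>) - expo (dg \<alpha>)) * m (strip \<beta> (prepend \<alpha> U)) else 0)"
    using prepend_BF[of U \<alpha>] assms by (simp add: act_path act_ghost zpow_mult mult.assoc[symmetric])
qed

text \<open>The third relation. A boundary path \<open>x\<close> contributes to the left-hand side iff \<open>\<mu>\<close> is an
  initial segment of \<open>\<alpha>x\<close>; then exactly one minimal extension \<open>(\<rho>, \<tau>)\<close> has \<open>\<rho>\<close> as an initial
  segment of \<open>x\<close>, and its summand gives the same value.\<close>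

lemma act_ghost_path_min_ext:
  assumes "\<alpha> \<in> M" "\<mu> \<in> M"
  shows "act (gen (Ghost \<alpha>)) (act (gen (Path \<mu>)) m) =
    (\<lambda>U. \<Sum>(\<rho>, \<tau>)\<in>min_ext \<Lambda> \<alpha> \<mu>. act (gen (Path \<rho>)) (act (gen (Ghost \<tau>)) m) U)"
proof
  fix U
  define summand where "summand = (\<lambda>p. act (gen (Path (fst p))) (act (gen (Ghost (snd p))) m) U)"
  have summand: "summand (\<rho>, \<tau>) =
      (if U \<in> BF \<and> \<rho> \<in> U then zpow (expo (dg \<rho>) - expo (dg \<tau>)) * m (prepend \<tau> (strip \<rho> U)) else 0)"
    if "(\<rho>, \<tau>) \<in> min_ext \<Lambda> \<alpha> \<mu>" for \<rho> \<tau>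
    unfolding summand_def fst_conv snd_conv
      act_path_ghost[OF min_extD(1,2)[OF that] min_ext_src[OF that assms]] ..
  have in_iff: "sr \<alpha> \<in> U \<and> \<mu> \<in> prepend \<alpha> U"
    if "U \<in> BF" "(\<rho>, \<tau>) \<in> min_ext \<Lambda> \<alpha> \<mu>" "\<rho> \<in> U" for \<rho> \<tau>
  proof -
    note q = min_extD[OF that(2)]
    have s: "sr \<alpha> \<in> U" using BF_rng[OF that(1,3)] q by simp
    have "\<mu> \<cdot> \<tau> \<in> prepend \<alpha> U" unfolding q(5)[symmetric] using comp_mem_prepend[OF assms(1) q(1,3) that(3)] .
    then show ?thesis using s BF_comp_down[OF prepend_BF[OF that(1) assms(1) s]] assms q by blast
  qed
  have "act (gen (Ghost \<alpha>)) (act (gen (Path \<mu>)) m) U = sum summand (min_ext \<Lambda> \<alpha> \<mu>)"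
  proof (cases "U \<in> BF \<and> sr \<alpha> \<in> U \<and> \<mu> \<in> prepend \<alpha> U")
    case True
    then have U: "U \<in> BF" "sr \<alpha> \<in> U" "\<mu> \<in> prepend \<alpha> U" by auto
    note V = prepend_BF[OF U(1) assms(1) U(2)] mem_prepend_self[OF assms(1) U(2)]
    obtain \<gamma> where g: "\<gamma> \<in> prepend \<alpha> U" "prefix \<alpha> \<gamma>" "prefix \<mu> \<gamma>" using BF_directed[OF V U(3)] by blast
    obtain \<rho> \<tau> where p: "(\<rho>, \<tau>) \<in> min_ext \<Lambda> \<alpha> \<mu>" "prefix (\<alpha> \<cdot> \<rho>) \<gamma>" using min_ext_below g(2,3) by blast
    note q = min_extD[OF p(1)]
    have "\<alpha> \<cdot> \<rho> \<in> prepend \<alpha> U" using BF_down[OF V(1) g(1) p(2)] .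
    then have "\<rho> \<in> strip \<alpha> (prepend \<alpha> U)" using q by (simp add: strip_def)
    then have r: "\<rho> \<in> U" using strip_prepend[OF U(1) assms(1) U(2)] by simp
    have "summand (\<rho>', \<tau>') = 0" if o: "(\<rho>', \<tau>') \<in> min_ext \<Lambda> \<alpha> \<mu>" "(\<rho>', \<tau>') \<noteq> (\<rho>, \<tau>)" for \<rho>' \<tau>'
    proof (rule ccontr)
      assume "summand (\<rho>', \<tau>') \<noteq> 0"
      then have r': "\<rho>' \<in> U" using summand[OF o(1)] by (auto split: if_splits)
      note q' = min_extD[OF o(1)]
      have "dg \<alpha> + dg \<rho>' = dg \<alpha> + dg \<rho>" using q(6) q'(6) q(1,3) q'(1,3) assms(1) by simp
      then have "dg \<rho>' = dg \<rho>" by (simp only: add_left_cancel)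
      then have e: "\<rho>' = \<rho>" using BF_eq_deg[OF U(1) r' r] by blast
      then have "\<mu> \<cdot> \<tau>' = \<mu> \<cdot> \<tau>" using q(5) q'(5) by simp
      then have "\<tau>' = \<tau>" using comp_cancel_left assms(2) q(2,4) q'(2,4) by blast
      then show False using o(2) e by simp
    qed
    then have "sum summand (min_ext \<Lambda> \<alpha> \<mu> - {(\<rho>, \<tau>)}) = 0" by (intro sum.neutral) auto
    then have sm: "sum summand (min_ext \<Lambda> \<alpha> \<mu>) = summand (\<rho>, \<tau>)"
      using sum.remove[OF finite_min_ext[OF assms] p(1), of "summand"] by simp
    have s': "strip \<rho> U \<in> BF" "sr \<rho> \<in> strip \<rho> U" using strip_BF[OF U(1) r] r q(1) by (auto simp: strip_def)
    have st: "sr \<tau> \<in> strip \<rho> U" using s'(2) min_ext_src[OF p(1) assms] by simp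
    have "prepend \<alpha> U = prepend (\<alpha> \<cdot> \<rho>) (strip \<rho> U)"
      using prepend_comp[OF assms(1) q(1,3) s'] prepend_strip[OF U(1) r] by simp
    also have "\<dots> = prepend \<mu> (prepend \<tau> (strip \<rho> U))"
      unfolding q(5) using prepend_comp[OF assms(2) q(2,4) s'(1) st] .
    finally have "strip \<mu> (prepend \<alpha> U) = prepend \<tau> (strip \<rho> U)"
      using strip_prepend[OF prepend_BF[OF s'(1) q(2) st] assms(2)]
        BF_rng[OF prepend_BF[OF s'(1) q(2) st] mem_prepend_self[OF q(2) st]] q(4) by simp
    moreover have "expo (dg \<mu>) - expo (dg \<alpha>) = expo (dg \<rho>) - expo (dg \<tau>)"
    proof -
      have "dg \<alpha> + dg \<rho> = dg \<mu> + dg \<tau>" using q(5) deg_cmp assms q(1-4) by metis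
      then have "expo (dg \<alpha>) + expo (dg \<rho>) = expo (dg \<mu>) + expo (dg \<tau>)" using expo_add by metis
      then show ?thesis by (simp add: algebra_simps)
    qed
    ultimately show ?thesis using sm summand[OF p(1)] U r act_ghost_path[OF assms, of m] by simp
  next
    case False
    then have "summand p = 0" if "p \<in> min_ext \<Lambda> \<alpha> \<mu>" for p
      using summand in_iff that by (cases p) auto
    then have "sum summand (min_ext \<Lambda> \<alpha> \<mu>) = 0" by (intro sum.neutral) blast
    then show ?thesis using False act_ghost_path[OF assms, of m] by auto
  qed
  then show "act (gen (Ghost \<alpha>)) (act (gen (Path \<mu>)) m) U =
      (\<Sum>(\<rho>, \<tau>)\<in>min_ext \<Lambda> \<alpha> \<mu>. act (gen (Path \<rho>)) (act (gen (Ghost \<tau>)) m) U)"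
    by (simp add: summand_def case_prod_beta)
qed

lemma act_gap:
  assumes "v \<in> vertices \<Lambda>" "\<alpha> \<in> M" "rg \<alpha> = v"
  shows "act (gen (Path v) - gen (Path \<alpha>) * gen (Ghost \<alpha>)) m =
    (\<lambda>U. if U \<in> BF \<and> v \<in> U \<and> \<alpha> \<notin> U then m U else 0)"
proof -
  have "v \<in> U" "prepend \<alpha> (strip \<alpha> U) = U" if "U \<in> BF" "\<alpha> \<in> U" for U
    using BF_rng[OF that] prepend_strip[OF that] assms by auto
  then show ?thesis
    by (auto simp: act_diff act_mult act_vertex[OF assms(1)] act_path_ghost[OF assms(2,2)] fun_eq_iff)
qed

text \<open>The fourth relation. Each factor acts as multiplication by the indicator of the boundary paths
  that avoid one member of \<open>E\<close>; no boundary path avoids them all.\<close>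

lemma act_gap_product:
  assumes "v \<in> vertices \<Lambda>" "set xs \<in> FE_at \<Lambda> v"
  shows "act (prod_list (map (\<lambda>\<alpha>. gen (Path v) - gen (Path \<alpha>) * gen (Ghost \<alpha>)) xs)) m = (\<lambda>U. 0)"
proof
  fix U
  have E: "\<alpha> \<in> M" "rg \<alpha> = v" if "\<alpha> \<in> set xs" for \<alpha>
    using that assms(2) by (auto simp: FE_at_def paths_from_def)
  have gaps: "act (prod_list (map (\<lambda>\<alpha>. gen (Path v) - gen (Path \<alpha>) * gen (Ghost \<alpha>)) ys)) m U =
    (if \<exists>\<alpha>\<in>set ys. \<not> (U \<in> BF \<and> v \<in> U \<and> \<alpha> \<notin> U) then 0 else m U)" if "set ys \<subseteq> set xs" for ys
    using that
    by (induction ys) (auto simp: act_one act_mult act_gap[OF assms(1) E])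
  have v: "v \<in> M" "rg v = v" "sr v = v" using vertex_rng_src[OF assms(1)] .
  then have "v \<in> paths_from \<Lambda> v" by (simp add: paths_from_def)
  then have "xs \<noteq> []" using assms(2) by (auto simp: FE_at_def exhaustive_def)
  moreover have "\<exists>\<alpha>\<in>set xs. \<alpha> \<in> U" if U: "U \<in> BF" "v \<in> U"
  proof -
    obtain \<epsilon> where "\<epsilon> \<in> set xs" "v \<cdot> \<epsilon> \<in> U" using BF_FE[OF U] assms(2) v by auto
    then show ?thesis using E cmp_rng by metis
  qed
  ultimately have "\<exists>\<alpha>\<in>set xs. \<not> (U \<in> BF \<and> v \<in> U \<and> \<alpha> \<notin> U)"
    by (cases xs) auto
  then show "act (prod_list (map (\<lambda>\<alpha>. gen (Path v) - gen (Path \<alpha>) * gen (Ghost \<alpha>)) xs)) m U = 0"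
    using gaps by simp
qed

lemma act_relation:
  assumes "f \<in> kp_relations K \<Lambda>" shows "act f m = (\<lambda>U. 0)"
  using assms unfolding kp_relations_def
proof (elim UnE CollectE exE conjE)
  fix v assume "f = gen (Path v) - gen (Ghost v)" "v \<in> vertices \<Lambda>"
  then show ?thesis by (simp add: act_diff act_vertex)
next
  fix v assume "f = gen (Path v) * gen (Path v) - gen (Path v)" "v \<in> vertices \<Lambda>"
  then show ?thesis by (auto simp: act_diff act_mult act_vertex)
next
  fix v w assume f: "f = gen (Path v) * gen (Path w)" and vw: "v \<in> vertices \<Lambda>" "w \<in> vertices \<Lambda>" "v \<noteq> w"
  have "\<not> (v \<in> U \<and> w \<in> U)" if "U \<in> BF" for U
    using BF_rng_eq[OF that, of v w] vw vertex_rng_src(2) by auto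
  then show ?thesis unfolding f using vw by (auto simp: act_mult act_vertex)
next
  fix \<alpha> \<mu> assume "f = gen (Path \<alpha>) * gen (Path \<mu>) - gen (Path (\<alpha> \<cdot> \<mu>))"
    "\<alpha> \<in> M" "\<mu> \<in> M" "sr \<alpha> = rg \<mu>"
  then show ?thesis by (simp add: act_diff act_mult act_path_path)
next
  fix \<alpha> \<mu> assume "f = gen (Ghost \<mu>) * gen (Ghost \<alpha>) - gen (Ghost (\<alpha> \<cdot> \<mu>))"
    "\<alpha> \<in> M" "\<mu> \<in> M" "sr \<alpha> = rg \<mu>"
  then show ?thesis by (simp add: act_diff act_mult act_ghost_ghost)
next
  fix \<alpha> \<mu> assume "f = gen (Ghost \<alpha>) * gen (Path \<mu>)
      - (\<Sum>(\<rho>, \<tau>)\<in>min_ext \<Lambda> \<alpha> \<mu>. gen (Path \<rho>) * gen (Ghost \<tau>))" "\<alpha> \<in> M" "\<mu> \<in> M"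
  then show ?thesis
    by (simp add: act_diff act_mult act_sum act_ghost_path_min_ext case_prod_beta)
next
  fix v xs assume "f = prod_list (map (\<lambda>\<alpha>. gen (Path v) - gen (Path \<alpha>) * gen (Ghost \<alpha>)) xs)"
    "v \<in> vertices \<Lambda>" "set xs \<in> FE_at \<Lambda> v"
  then show ?thesis by (simp add: act_gap_product)
qed

end

section \<open>Computing modulo the Kumjian--Pask relations\<close>

locale kumjian_pask = finitely_aligned_k_graph \<Lambda> for \<Lambda> :: "('a, 'k::finite) kgraph" +
  fixes K :: "'f::field itself"
begin

abbreviation FA :: "('a, 'f) free ring" where "FA \<equiv> free_algebra K \<Lambda>"
abbreviation C :: "('a, 'f) free set" where "C \<equiv> carrier FA"
abbreviation S :: "'a \<Rightarrow> ('a, 'f) free" where "S \<alpha> \<equiv> gen (Path \<alpha>)"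
abbreviation G :: "'a \<Rightarrow> ('a, 'f) free" where "G \<alpha> \<equiv> gen (Ghost \<alpha>)"
abbreviation gap :: "'a \<Rightarrow> 'a \<Rightarrow> ('a, 'f) free" where "gap v \<alpha> \<equiv> S v - S \<alpha> * G \<alpha>"
abbreviation sc :: "'f \<Rightarrow> ('a, 'f) free" where "sc c \<equiv> Poly_Mapping.single 0 c"

lemma C_iff: "f \<in> C \<longleftrightarrow> Poly_Mapping.keys f \<subseteq> lists (letters \<Lambda>)"
  by (simp add: free_algebra_def)

lemma FA_simps [simp]:
  "mult FA = (*)" "one FA = 1" "zero FA = 0" "add FA = (+)"
  by (simp_all add: free_algebra_def)

lemma C_zero [simp]: "0 \<in> C" by (simp add: C_iff)
lemma C_one [simp]: "1 \<in> C" by (simp add: C_iff zero_list_def)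
lemma C_sc [simp]: "sc c \<in> C" by (simp add: C_iff zero_list_def)
lemma C_add [simp]: "f \<in> C \<Longrightarrow> g \<in> C \<Longrightarrow> f + g \<in> C"
  using keys_add[of f g] by (auto simp: C_iff)
lemma C_uminus [simp]: "f \<in> C \<Longrightarrow> - f \<in> C"
  by (auto simp: C_iff in_keys_iff)
lemma C_diff [simp]: "f \<in> C \<Longrightarrow> g \<in> C \<Longrightarrow> f - g \<in> C"
  using C_add[of f "- g"] by simp
lemma C_mult [simp]: "f \<in> C \<Longrightarrow> g \<in> C \<Longrightarrow> f * g \<in> C"
  using keys_mult[of f g] by (fastforce simp: C_iff plus_list_def)
lemma C_S [simp]: "\<alpha> \<in> M \<Longrightarrow> S \<alpha> \<in> C" by (simp add: C_iff letters_def)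
lemma C_G [simp]: "\<alpha> \<in> M \<Longrightarrow> G \<alpha> \<in> C" by (simp add: C_iff letters_def)
lemma C_sum [simp]: "(\<And>i. i \<in> A \<Longrightarrow> f i \<in> C) \<Longrightarrow> sum f A \<in> C"
  by (induction A rule: infinite_finite_induct) simp_all
lemma C_prod_list: "(\<And>x. x \<in> set xs \<Longrightarrow> f x \<in> C) \<Longrightarrow> prod_list (map f xs) \<in> C"
  by (induction xs) simp_all

lemma ring_FA: "ring FA"
proof (rule ringI)
  show "abelian_group FA"
  proof (rule abelian_groupI)
    show "\<exists>g\<in>C. g \<oplus>\<^bsub>FA\<^esub> f = \<zero>\<^bsub>FA\<^esub>" if "f \<in> C" for f
      using that by (intro bexI[of _ "- f"]) simp_all
  qed (simp_all add: ac_simps)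
  show "monoid FA" by (rule monoidI) (simp_all add: mult.assoc)
qed (simp_all add: algebra_simps)

lemma FA_a_inv: "f \<in> C \<Longrightarrow> \<ominus>\<^bsub>FA\<^esub> f = - f"
  using abelian_group.minus_equality[OF ring.is_abelian_group[OF ring_FA], of "- f" f] by simp

lemma relations_subset: "kp_relations K \<Lambda> \<subseteq> C"
proof
  fix f assume "f \<in> kp_relations K \<Lambda>"
  then show "f \<in> C" unfolding kp_relations_def
  proof (elim UnE CollectE exE conjE)
    fix \<alpha> \<mu> assume f: "f = G \<alpha> * S \<mu> - (\<Sum>(\<rho>, \<tau>)\<in>min_ext \<Lambda> \<alpha> \<mu>. S \<rho> * G \<tau>)" "\<alpha> \<in> M" "\<mu> \<in> M"
    then show ?thesis by (auto intro!: C_diff C_mult C_sum dest: min_extD(1,2))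
  next
    fix v xs assume f: "f = prod_list (map (gap v) xs)"
      and v: "v \<in> vertices \<Lambda>" and "set xs \<in> FE_at \<Lambda> v"
    then have "\<alpha> \<in> M" if "\<alpha> \<in> set xs" for \<alpha>
      using that by (auto simp: FE_at_def paths_from_def)
    then show ?thesis unfolding f using vertex_rng_src(1)[OF v] by (intro C_prod_list) simp
  qed (auto intro!: C_diff C_mult simp: vertex_rng_src(1))
qed

abbreviation I :: "('a, 'f) free set" where "I \<equiv> kp_ideal K \<Lambda>"

lemma ideal_I: "ideal I FA"
  unfolding kp_ideal_def using ring.genideal_ideal[OF ring_FA relations_subset] .

lemma relation_in_I: "f \<in> kp_relations K \<Lambda> \<Longrightarrow> f \<in> I"
  unfolding kp_ideal_def using ring.genideal_self[OF ring_FA relations_subset] by blast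

lemma I_zero: "0 \<in> I"
  and I_add: "f \<in> I \<Longrightarrow> g \<in> I \<Longrightarrow> f + g \<in> I"
  and I_uminus: "f \<in> I \<Longrightarrow> - f \<in> I"
  and I_left: "f \<in> I \<Longrightarrow> g \<in> C \<Longrightarrow> g * f \<in> I"
  and I_right: "f \<in> I \<Longrightarrow> g \<in> C \<Longrightarrow> f * g \<in> I"
proof -
  interpret ideal I FA by (rule ideal_I)
  show "0 \<in> I" using additive_subgroup.zero_closed[OF ideal.axioms(1)[OF ideal_I]] by simp
  show "f \<in> I \<Longrightarrow> g \<in> I \<Longrightarrow> f + g \<in> I" using additive_subgroup.a_closed[OF ideal.axioms(1)[OF ideal_I]] by simp
  show "f \<in> I \<Longrightarrow> - f \<in> I" using additive_subgroup.a_inv_closed[OF ideal.axioms(1)[OF ideal_I]] FA_a_inv[of f] Icarr by metis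
  show "f \<in> I \<Longrightarrow> g \<in> C \<Longrightarrow> g * f \<in> I" using I_l_closed by simp
  show "f \<in> I \<Longrightarrow> g \<in> C \<Longrightarrow> f * g \<in> I" using I_r_closed by simp
qed

lemma act_I: "f \<in> I \<Longrightarrow> act f m = (\<lambda>U. 0)"
proof -
  let ?J = "{f \<in> C. \<forall>m :: 'a set \<Rightarrow> 'f laurent. act f m = (\<lambda>U. 0)}"
  have "ideal ?J FA"
  proof (rule idealI[OF ring_FA])
    have "group (add_monoid FA)"
      using abelian_group.a_group[OF ring.is_abelian_group[OF ring_FA]] .
    then show "subgroup ?J (add_monoid FA)"
    proof (rule group.subgroupI)
      show "inv\<^bsub>add_monoid FA\<^esub> f \<in> ?J" if "f \<in> ?J" for f
        using that FA_a_inv[of f] by (simp add: a_inv_def act_uminus)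
    qed (auto simp: act_add intro: exI[of _ 0])
  qed (auto simp: act_mult)
  then have "I \<subseteq> ?J"
    unfolding kp_ideal_def using relations_subset act_relation
    by (intro ring.genideal_minimal[OF ring_FA]) auto
  then show "f \<in> I \<Longrightarrow> act f m = (\<lambda>U. 0)" by blast
qed

text \<open>Calculations take place in the free algebra, whose ring operations are those of a type class,
  modulo this congruence.\<close>

definition eqv :: "('a, 'f) free \<Rightarrow> ('a, 'f) free \<Rightarrow> bool" (infix "\<doteq>" 50) where
  "f \<doteq> g \<longleftrightarrow> f \<in> C \<and> g \<in> C \<and> f - g \<in> I"

lemma eqv_refl [simp]: "f \<in> C \<Longrightarrow> f \<doteq> f"
  by (simp add: eqv_def I_zero)

lemma eqv_sym: "f \<doteq> g \<Longrightarrow> g \<doteq> f"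
  using I_uminus[of "f - g"] by (simp add: eqv_def)

lemma eqv_trans [trans]: "f \<doteq> g \<Longrightarrow> g \<doteq> h \<Longrightarrow> f \<doteq> h"
  using I_add[of "f - g" "g - h"] by (simp add: eqv_def)

lemma eqv_add: "f \<doteq> g \<Longrightarrow> f' \<doteq> g' \<Longrightarrow> f + f' \<doteq> g + g'"
  using I_add[of "f - g" "f' - g'"] by (simp add: eqv_def algebra_simps)

lemma eqv_diff: "f \<doteq> g \<Longrightarrow> f' \<doteq> g' \<Longrightarrow> f - f' \<doteq> g - g'"
  using I_add[of "f - g" "- (f' - g')"] I_uminus[of "f' - g'"] by (simp add: eqv_def algebra_simps)

lemma eqv_left: "f \<doteq> g \<Longrightarrow> h \<in> C \<Longrightarrow> h * f \<doteq> h * g"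
  using I_left[of "f - g" h] by (simp add: eqv_def algebra_simps)

lemma eqv_right: "f \<doteq> g \<Longrightarrow> h \<in> C \<Longrightarrow> f * h \<doteq> g * h"
  using I_right[of "f - g" h] by (simp add: eqv_def algebra_simps)

lemma eqv_sum: "(\<And>i. i \<in> A \<Longrightarrow> f i \<doteq> g i) \<Longrightarrow> sum f A \<doteq> sum g A"
  by (induction A rule: infinite_finite_induct) (auto intro: eqv_add)

lemma eqv_sum_zero: "(\<And>i. i \<in> A \<Longrightarrow> f i \<doteq> 0) \<Longrightarrow> sum f A \<doteq> 0"
  using eqv_sum[of A f "\<lambda>_. 0"] by simp

lemma eqv_zero_left: "f \<doteq> 0 \<Longrightarrow> h \<in> C \<Longrightarrow> h * f \<doteq> 0"
  using eqv_left[of f 0 h] by simp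

lemma eqv_zero_right: "f \<doteq> 0 \<Longrightarrow> h \<in> C \<Longrightarrow> f * h \<doteq> 0"
  using eqv_right[of f 0 h] by simp

lemma act_eqv: "f \<doteq> g \<Longrightarrow> act f m = act g m"
  using act_I[of "f - g" m] by (simp add: eqv_def act_diff fun_eq_iff)

lemma eqv_relation: "f - g \<in> kp_relations K \<Lambda> \<Longrightarrow> f \<in> C \<Longrightarrow> g \<in> C \<Longrightarrow> f \<doteq> g"
  by (simp add: eqv_def relation_in_I)

lemma S_G_vertex: "v \<in> vertices \<Lambda> \<Longrightarrow> S v \<doteq> G v"
  by (rule eqv_relation) (auto simp: kp_relations_def vertex_rng_src(1))

lemma vertex_orthogonal: "v \<in> vertices \<Lambda> \<Longrightarrow> w \<in> vertices \<Lambda> \<Longrightarrow> v \<noteq> w \<Longrightarrow> S v * S w \<doteq> 0"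
  by (rule eqv_relation) (auto simp: kp_relations_def vertex_rng_src(1))

lemma S_comp: "\<alpha> \<in> M \<Longrightarrow> \<mu> \<in> M \<Longrightarrow> sr \<alpha> = rg \<mu> \<Longrightarrow> S \<alpha> * S \<mu> \<doteq> S (\<alpha> \<cdot> \<mu>)"
  by (rule eqv_relation) (unfold kp_relations_def, blast, simp_all)

lemma G_comp: "\<alpha> \<in> M \<Longrightarrow> \<mu> \<in> M \<Longrightarrow> sr \<alpha> = rg \<mu> \<Longrightarrow> G \<mu> * G \<alpha> \<doteq> G (\<alpha> \<cdot> \<mu>)"
  by (rule eqv_relation) (unfold kp_relations_def, blast, simp_all)

lemma G_S: "\<alpha> \<in> M \<Longrightarrow> \<mu> \<in> M \<Longrightarrow> G \<alpha> * S \<mu> \<doteq> (\<Sum>(\<rho>, \<tau>)\<in>min_ext \<Lambda> \<alpha> \<mu>. S \<rho> * G \<tau>)"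
proof (rule eqv_relation)
  show "(\<Sum>(\<rho>, \<tau>)\<in>min_ext \<Lambda> \<alpha> \<mu>. S \<rho> * G \<tau>) \<in> C"
    using min_extD(1,2) by (intro C_sum) (auto intro!: C_mult C_S C_G)
qed (unfold kp_relations_def, blast, simp)

lemma gap_product:
  assumes "v \<in> vertices \<Lambda>" "distinct xs" "set xs \<in> FE_at \<Lambda> v"
  shows "prod_list (map (gap v) xs) \<doteq> 0"
proof -
  have "prod_list (map (gap v) xs) \<in> kp_relations K \<Lambda>"
    unfolding kp_relations_def using assms by blast
  then show ?thesis using relations_subset by (intro eqv_relation) auto
qed

lemma S_rng: "\<alpha> \<in> M \<Longrightarrow> S (rg \<alpha>) * S \<alpha> \<doteq> S \<alpha>" using S_comp[of "rg \<alpha>" \<alpha>] by simp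
lemma S_src: "\<alpha> \<in> M \<Longrightarrow> S \<alpha> * S (sr \<alpha>) \<doteq> S \<alpha>" using S_comp[of \<alpha> "sr \<alpha>"] by simp

lemma G_src: "\<alpha> \<in> M \<Longrightarrow> S (sr \<alpha>) * G \<alpha> \<doteq> G \<alpha>"
proof -
  assume a: "\<alpha> \<in> M"
  have "S (sr \<alpha>) * G \<alpha> \<doteq> G (sr \<alpha>) * G \<alpha>" using a by (intro eqv_right S_G_vertex) simp_all
  also have "\<dots> \<doteq> G \<alpha>" using G_comp[of \<alpha> "sr \<alpha>"] a by simp
  finally show ?thesis .
qed

lemma G_rng: "\<alpha> \<in> M \<Longrightarrow> G \<alpha> * S (rg \<alpha>) \<doteq> G \<alpha>"
proof -
  assume a: "\<alpha> \<in> M"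
  have "G \<alpha> * S (rg \<alpha>) \<doteq> G \<alpha> * G (rg \<alpha>)" using a by (intro eqv_left S_G_vertex) simp_all
  also have "\<dots> \<doteq> G \<alpha>" using G_comp[of "rg \<alpha>" \<alpha>] a by simp
  finally show ?thesis .
qed

lemma vertex_S_zero:
  assumes "v \<in> vertices \<Lambda>" "\<alpha> \<in> M" "rg \<alpha> \<noteq> v" shows "S v * S \<alpha> \<doteq> 0"
proof -
  have v: "v \<in> M" using vertex_rng_src(1)[OF assms(1)] .
  have "S v * S \<alpha> \<doteq> S v * (S (rg \<alpha>) * S \<alpha>)" using v assms by (intro eqv_left eqv_sym[OF S_rng]) simp_all
  also have "\<dots> = S v * S (rg \<alpha>) * S \<alpha>" by (simp only: mult.assoc)
  also have "\<dots> \<doteq> 0" using assms by (intro eqv_zero_right vertex_orthogonal) auto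
  finally show ?thesis .
qed

lemma S_S_zero:
  assumes "\<alpha> \<in> M" "\<mu> \<in> M" "sr \<alpha> \<noteq> rg \<mu>" shows "S \<alpha> * S \<mu> \<doteq> 0"
proof -
  have "S \<alpha> * S \<mu> \<doteq> S \<alpha> * S (sr \<alpha>) * S \<mu>" using assms by (intro eqv_right eqv_sym[OF S_src]) simp_all
  also have "\<dots> = S \<alpha> * (S (sr \<alpha>) * S \<mu>)" by (simp only: mult.assoc)
  also have "\<dots> \<doteq> 0" using assms by (intro eqv_zero_left vertex_S_zero) auto
  finally show ?thesis .
qed

lemma G_vertex_zero:
  assumes "v \<in> vertices \<Lambda>" "\<alpha> \<in> M" "rg \<alpha> \<noteq> v" shows "G \<alpha> * S v \<doteq> 0"
proof -
  have v: "v \<in> M" using vertex_rng_src(1)[OF assms(1)] .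
  have "G \<alpha> * S v \<doteq> G \<alpha> * S (rg \<alpha>) * S v" using v assms by (intro eqv_right eqv_sym[OF G_rng]) simp_all
  also have "\<dots> = G \<alpha> * (S (rg \<alpha>) * S v)" by (simp only: mult.assoc)
  also have "\<dots> \<doteq> 0" using assms by (intro eqv_zero_left vertex_orthogonal) auto
  finally show ?thesis .
qed

lemma G_S_zero:
  assumes "\<alpha> \<in> M" "\<beta> \<in> M" "\<not> compat \<alpha> \<beta>" shows "G \<alpha> * S \<beta> \<doteq> 0"
  using G_S[OF assms(1,2)] assms min_ext_nonempty_iff[OF assms(1,2)] by simp

lemma G_S_self: "\<alpha> \<in> M \<Longrightarrow> G \<alpha> * S \<alpha> \<doteq> S (sr \<alpha>)"
proof -
  assume a: "\<alpha> \<in> M"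
  have "min_ext \<Lambda> \<alpha> \<alpha> = {(sr \<alpha>, sr \<alpha>)}" using min_ext_comp[of \<alpha> "sr \<alpha>"] a by simp
  then have "G \<alpha> * S \<alpha> \<doteq> S (sr \<alpha>) * G (sr \<alpha>)" using G_S[OF a a] by simp
  also have "\<dots> \<doteq> G (sr \<alpha>)" using G_src[of "sr \<alpha>"] a by simp
  also have "\<dots> \<doteq> S (sr \<alpha>)" using a by (intro eqv_sym[OF S_G_vertex]) simp
  finally show ?thesis .
qed

lemma G_comp_S:
  assumes "\<alpha> \<in> M" "\<beta> \<in> M" "sr \<alpha> = rg \<beta>" shows "G (\<alpha> \<cdot> \<beta>) * S \<alpha> \<doteq> G \<beta>"
proof -
  have "G (\<alpha> \<cdot> \<beta>) * S \<alpha> \<doteq> G \<beta> * G \<alpha> * S \<alpha>" using assms by (intro eqv_right eqv_sym[OF G_comp]) simp_all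
  also have "\<dots> = G \<beta> * (G \<alpha> * S \<alpha>)" by (simp only: mult.assoc)
  also have "\<dots> \<doteq> G \<beta> * S (sr \<alpha>)" using assms by (intro eqv_left G_S_self) simp_all
  also have "\<dots> \<doteq> G \<beta>" using G_rng[of \<beta>] assms by simp
  finally show ?thesis .
qed

text \<open>By the third relation, the product of two range projections is the sum of the range projections of
  the minimal common extensions, and this is symmetric in the two paths.\<close>

lemma projections_commute:
  assumes "\<alpha> \<in> M" "\<beta> \<in> M"
  shows "(S \<alpha> * G \<alpha>) * (S \<beta> * G \<beta>) \<doteq> (S \<beta> * G \<beta>) * (S \<alpha> * G \<alpha>)"
proof -
  have prod: "(S \<alpha> * G \<alpha>) * (S \<beta> * G \<beta>) \<doteq> (\<Sum>(\<rho>, \<tau>)\<in>min_ext \<Lambda> \<alpha> \<beta>. S (\<alpha> \<cdot> \<rho>) * G (\<beta> \<cdot> \<tau>))"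
    if "\<alpha> \<in> M" "\<beta> \<in> M" for \<alpha> \<beta>
  proof -
    have "(S \<alpha> * G \<alpha>) * (S \<beta> * G \<beta>) = S \<alpha> * (G \<alpha> * S \<beta>) * G \<beta>" by (simp only: mult.assoc)
    also have "\<dots> \<doteq> S \<alpha> * (\<Sum>(\<rho>, \<tau>)\<in>min_ext \<Lambda> \<alpha> \<beta>. S \<rho> * G \<tau>) * G \<beta>"
      using that by (intro eqv_right eqv_left G_S) simp_all
    also have "\<dots> = (\<Sum>(\<rho>, \<tau>)\<in>min_ext \<Lambda> \<alpha> \<beta>. (S \<alpha> * S \<rho>) * (G \<tau> * G \<beta>))"
      by (simp only: sum_distrib_left sum_distrib_right case_prod_unfold mult.assoc)
    also have "\<dots> \<doteq> (\<Sum>(\<rho>, \<tau>)\<in>min_ext \<Lambda> \<alpha> \<beta>. S (\<alpha> \<cdot> \<rho>) * G (\<beta> \<cdot> \<tau>))"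
    proof (rule eqv_sum, clarify)
      fix \<rho> \<tau> assume p: "(\<rho>, \<tau>) \<in> min_ext \<Lambda> \<alpha> \<beta>"
      note q = min_extD[OF p]
      have "S \<alpha> * S \<rho> * (G \<tau> * G \<beta>) \<doteq> S (\<alpha> \<cdot> \<rho>) * (G \<tau> * G \<beta>)"
        using that q by (intro eqv_right S_comp) simp_all
      also have "\<dots> \<doteq> S (\<alpha> \<cdot> \<rho>) * G (\<beta> \<cdot> \<tau>)"
        using that q(1-4) by (intro eqv_left G_comp C_S) simp_all
      finally show "S \<alpha> * S \<rho> * (G \<tau> * G \<beta>) \<doteq> S (\<alpha> \<cdot> \<rho>) * G (\<beta> \<cdot> \<tau>)" .
    qed
    finally show ?thesis .
  qed
  have "(\<Sum>(\<rho>, \<tau>)\<in>min_ext \<Lambda> \<beta> \<alpha>. S (\<beta> \<cdot> \<rho>) * G (\<alpha> \<cdot> \<tau>)) = (\<Sum>(\<rho>, \<tau>)\<in>min_ext \<Lambda> \<alpha> \<beta>. S (\<alpha> \<cdot> \<rho>) * G (\<beta> \<cdot> \<tau>))"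
    unfolding min_ext_swap[of \<beta> \<alpha>]
    by (subst sum.reindex) (auto intro!: sum.cong dest: min_extD(5))
  then show ?thesis using eqv_trans[OF prod[OF assms] eqv_sym] prod[OF assms(2,1)] by simp
qed

lemma vertex_projection:
  assumes "\<alpha> \<in> M" shows "S (rg \<alpha>) * (S \<alpha> * G \<alpha>) \<doteq> S \<alpha> * G \<alpha>" "S \<alpha> * G \<alpha> * S (rg \<alpha>) \<doteq> S \<alpha> * G \<alpha>"
  using eqv_right[OF S_rng[OF assms], of "G \<alpha>"] eqv_left[OF G_rng[OF assms], of "S \<alpha>"] assms
  by (simp_all add: mult.assoc)

text \<open>The factor for \<open>\<alpha>\<close> annihilates \<open>S \<alpha>\<close>, and it can be moved next to it because range
  projections commute.\<close>

lemma gap_product_S_zero: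
  assumes "set xs \<subseteq> paths_from \<Lambda> v" "\<alpha> \<in> set xs" "v \<in> vertices \<Lambda>"
  shows "prod_list (map (gap v) xs) * S \<alpha> \<doteq> 0"
proof -
  have v: "v \<in> M" using vertex_rng_src(1)[OF assms(3)] .
  have gapC: "gap v \<beta> \<in> C" if "\<beta> \<in> M" for \<beta> using v that by simp
  have comm: "gap v \<beta> * (S \<alpha> * G \<alpha>) \<doteq> (S \<alpha> * G \<alpha>) * gap v \<beta>"
    if "\<beta> \<in> M" "\<alpha> \<in> M" "rg \<alpha> = v" for \<alpha> \<beta>
  proof -
    have "S v * (S \<alpha> * G \<alpha>) - S \<beta> * G \<beta> * (S \<alpha> * G \<alpha>) \<doteq> S \<alpha> * G \<alpha> * S v - S \<alpha> * G \<alpha> * (S \<beta> * G \<beta>)"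
      using vertex_projection[OF that(2)] that
      by (intro eqv_diff projections_commute) (auto intro: eqv_trans eqv_sym)
    then show ?thesis by (simp only: left_diff_distrib right_diff_distrib)
  qed
  have comm_prod: "prod_list (map (gap v) ys) * (S \<alpha> * G \<alpha>) \<doteq>
      (S \<alpha> * G \<alpha>) * prod_list (map (gap v) ys)"
    if "set ys \<subseteq> M" "\<alpha> \<in> M" "rg \<alpha> = v" for ys \<alpha>
    using that(1)
  proof (induction ys)
    case Nil
    then show ?case using that by simp
  next
    case (Cons \<beta> ys)
    let ?Q = "prod_list (map (gap v) ys)"
    have QC: "?Q \<in> C" using Cons gapC by (intro C_prod_list) auto
    have b: "\<beta> \<in> M" using Cons by simp
    have "gap v \<beta> * (?Q * (S \<alpha> * G \<alpha>)) \<doteq> gap v \<beta> * (S \<alpha> * G \<alpha> * ?Q)"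
      using Cons gapC by (intro eqv_left) auto
    also have "\<dots> = gap v \<beta> * (S \<alpha> * G \<alpha>) * ?Q" by (simp only: mult.assoc)
    also have "\<dots> \<doteq> S \<alpha> * G \<alpha> * gap v \<beta> * ?Q"
      using comm[OF b that(2,3)] QC by (rule eqv_right)
    finally show ?case by (simp only: list.map prod_list.Cons mult.assoc)
  qed
  show ?thesis using assms(1,2)
  proof (induction xs)
    case (Cons \<beta> xs)
    let ?Q = "prod_list (map (gap v) xs)"
    have xsM: "set xs \<subseteq> M" and b: "\<beta> \<in> M" "rg \<beta> = v" and a: "\<alpha> \<in> M" "rg \<alpha> = v"
      using Cons.prems by (auto simp: paths_from_def)
    have QC: "?Q \<in> C" using xsM gapC by (intro C_prod_list) auto
    have "gap v \<beta> * (?Q * S \<alpha>) \<doteq> 0"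
    proof (cases "\<alpha> \<in> set xs")
      case True
      then have "?Q * S \<alpha> \<doteq> 0" using Cons by simp
      then show ?thesis using gapC[OF b(1)] by (rule eqv_zero_left)
    next
      case False
      then have ab: "\<beta> = \<alpha>" using Cons.prems by simp
      have "S \<alpha> \<doteq> S \<alpha> * S (sr \<alpha>)" using S_src[OF a(1)] by (rule eqv_sym)
      also have "\<dots> \<doteq> S \<alpha> * (G \<alpha> * S \<alpha>)" using a by (intro eqv_left eqv_sym[OF G_S_self]) simp_all
      finally have sgs: "S \<alpha> \<doteq> S \<alpha> * (G \<alpha> * S \<alpha>)" .
      have "gap v \<alpha> * S \<alpha> = S v * S \<alpha> - S \<alpha> * (G \<alpha> * S \<alpha>)"
        by (simp only: left_diff_distrib mult.assoc)
      also have "\<dots> \<doteq> S \<alpha> - S \<alpha>" using S_rng[OF a(1)] sgs a by (intro eqv_diff) (auto intro: eqv_sym)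
      finally have z: "gap v \<alpha> * S \<alpha> \<doteq> 0" by simp
      have "gap v \<alpha> * (?Q * S \<alpha>) \<doteq> gap v \<alpha> * (?Q * (S \<alpha> * (G \<alpha> * S \<alpha>)))"
        using sgs gapC[OF a(1)] QC by (intro eqv_left) simp_all
      also have "\<dots> = gap v \<alpha> * (?Q * (S \<alpha> * G \<alpha>)) * S \<alpha>" by (simp only: mult.assoc)
      also have "\<dots> \<doteq> gap v \<alpha> * (S \<alpha> * G \<alpha> * ?Q) * S \<alpha>"
        using comm_prod[OF xsM a] gapC a by (intro eqv_right eqv_left) simp_all
      also have "\<dots> = gap v \<alpha> * S \<alpha> * (G \<alpha> * ?Q * S \<alpha>)" by (simp only: mult.assoc)
      also have "\<dots> \<doteq> 0" using z QC a by (intro eqv_zero_right[OF z]) simp_all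
      finally show ?thesis unfolding ab .
    qed
    then show ?case by (simp only: list.map prod_list.Cons mult.assoc)
  qed simp
qed

text \<open>The free non-unital algebra; its classes make up the Kumjian--Pask algebra.\<close>

definition N :: "('a, 'f) free set" where
  "N = {f \<in> C. [] \<notin> Poly_Mapping.keys f}"

lemma N_C: "f \<in> N \<Longrightarrow> f \<in> C" by (simp add: N_def)
lemma N_zero [simp]: "0 \<in> N" by (simp add: N_def)
lemma N_add [simp]: "f \<in> N \<Longrightarrow> g \<in> N \<Longrightarrow> f + g \<in> N"
  using keys_add[of f g] by (auto simp: N_def)
lemma N_uminus [simp]: "f \<in> N \<Longrightarrow> - f \<in> N"
  by (auto simp: N_def in_keys_iff)
lemma N_diff [simp]: "f \<in> N \<Longrightarrow> g \<in> N \<Longrightarrow> f - g \<in> N"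
  using N_add[of f "- g"] by simp
lemma N_left [simp]: "f \<in> N \<Longrightarrow> g \<in> C \<Longrightarrow> g * f \<in> N"
  using keys_mult[of g f] by (fastforce simp: N_def plus_list_def)
lemma N_right [simp]: "f \<in> N \<Longrightarrow> g \<in> C \<Longrightarrow> f * g \<in> N"
  using keys_mult[of f g] by (fastforce simp: N_def plus_list_def)
lemma N_S [simp]: "\<alpha> \<in> M \<Longrightarrow> S \<alpha> \<in> N" by (simp add: N_def)
lemma N_G [simp]: "\<alpha> \<in> M \<Longrightarrow> G \<alpha> \<in> N" by (simp add: N_def)
lemma N_sum [simp]: "(\<And>i. i \<in> A \<Longrightarrow> f i \<in> N) \<Longrightarrow> sum f A \<in> N"
  by (induction A rule: infinite_finite_induct) simp_all

lemma sc_commute: "sc c * f = f * sc c"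
  by (rule single_zero_mult_commute)

lemma sc_left_commute: "f * (sc c * g) = sc c * (f * g)"
  by (metis mult.assoc sc_commute)

definition comb :: "('f \<times> 'a \<times> 'a) list \<Rightarrow> ('a, 'f) free" where
  "comb xs = sum_list (map (\<lambda>(c, \<alpha>, \<beta>). sc c * (S \<alpha> * G \<beta>)) xs)"

definition triples :: "('f \<times> 'a \<times> 'a) set" where
  "triples = {(c, \<alpha>, \<beta>). \<alpha> \<in> M \<and> \<beta> \<in> M \<and> sr \<alpha> = sr \<beta>}"

definition spanned :: "('a, 'f) free \<Rightarrow> bool" where
  "spanned f \<longleftrightarrow> (\<exists>xs\<in>lists triples. f \<doteq> comb xs)"

lemma comb_append: "comb (xs @ ys) = comb xs + comb ys"
  by (simp add: comb_def)

lemma spanned_zero: "spanned 0"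
  unfolding spanned_def by (intro bexI[of _ "[]"]) (simp_all add: comb_def)

lemma spanned_add: "spanned f \<Longrightarrow> spanned g \<Longrightarrow> spanned (f + g)"
  unfolding spanned_def by (metis append_in_lists_conv comb_append eqv_add)

lemma spanned_eqv: "f \<doteq> g \<Longrightarrow> spanned g \<Longrightarrow> spanned f"
  unfolding spanned_def using eqv_trans by blast

lemma spanned_sum: "(\<And>i. i \<in> A \<Longrightarrow> spanned (f i)) \<Longrightarrow> spanned (sum f A)"
  by (induction A rule: infinite_finite_induct) (simp_all add: spanned_zero spanned_add)

lemma spanned_monomial: "\<alpha> \<in> M \<Longrightarrow> \<beta> \<in> M \<Longrightarrow> sr \<alpha> = sr \<beta> \<Longrightarrow> spanned (sc c * (S \<alpha> * G \<beta>))"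
  unfolding spanned_def by (intro bexI[of _ "[(c, \<alpha>, \<beta>)]"]) (simp_all add: comb_def triples_def)

lemma sc_mult: "sc c * sc d = sc (c * d)"
  by (simp add: mult_single)

lemma spanned_sc: "spanned f \<Longrightarrow> spanned (sc d * f)"
proof -
  assume "spanned f"
  then obtain xs where xs: "xs \<in> lists triples" "f \<doteq> comb xs" by (auto simp: spanned_def)
  have "spanned (sc d * comb xs)" using xs(1)
  proof (induction xs)
    case Nil
    then show ?case by (simp add: comb_def spanned_zero)
  next
    case (Cons x xs)
    then obtain c \<alpha> \<beta> where x: "x = (c, \<alpha>, \<beta>)" "\<alpha> \<in> M" "\<beta> \<in> M" "sr \<alpha> = sr \<beta>"
      by (auto simp: triples_def)
    have "sc d * comb (x # xs) = sc (d * c) * (S \<alpha> * G \<beta>) + sc d * comb xs"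
      by (simp add: x comb_def distrib_left sc_mult[symmetric] mult.assoc)
    then show ?case using Cons x spanned_add spanned_monomial by auto
  qed
  then show ?thesis using spanned_eqv[OF eqv_left[OF xs(2)]] by simp
qed

lemma spanned_letter:
  assumes "l \<in> letters \<Lambda>" "spanned f" shows "spanned (gen l * f)"
proof -
  have lC: "gen l \<in> C" using assms(1) by (simp add: C_iff)
  obtain xs where xs: "xs \<in> lists triples" "f \<doteq> comb xs" using assms(2) by (auto simp: spanned_def)
  have "spanned (gen l * comb xs)" using xs(1)
  proof (induction xs)
    case Nil
    then show ?case by (simp add: comb_def spanned_zero)
  next
    case (Cons x xs)
    then obtain c \<alpha> \<beta> where x: "x = (c, \<alpha>, \<beta>)" "\<alpha> \<in> M" "\<beta> \<in> M" "sr \<alpha> = sr \<beta>"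
      by (auto simp: triples_def)
    have "spanned (gen l * (S \<alpha> * G \<beta>))"
    proof -
      consider \<kappa> where "l = Path \<kappa>" "\<kappa> \<in> M" | \<kappa> where "l = Ghost \<kappa>" "\<kappa> \<in> M"
        using assms(1) by (auto simp: letters_def)
      then show ?thesis
      proof cases
        case 1
        have e: "gen l * (S \<alpha> * G \<beta>) = S \<kappa> * S \<alpha> * G \<beta>" by (simp only: 1 mult.assoc)
        show ?thesis
        proof (cases "sr \<kappa> = rg \<alpha>")
          case True
          have "S \<kappa> * S \<alpha> * G \<beta> \<doteq> S (\<kappa> \<cdot> \<alpha>) * G \<beta>" using 1 x True by (intro eqv_right S_comp) simp_all
          moreover have "spanned (sc 1 * (S (\<kappa> \<cdot> \<alpha>) * G \<beta>))" using 1 x True by (intro spanned_monomial) simp_all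
          ultimately show ?thesis unfolding e by (auto intro: spanned_eqv)
        next
          case False
          then have "S \<kappa> * S \<alpha> * G \<beta> \<doteq> 0" using 1 x by (intro eqv_zero_right S_S_zero) simp_all
          then show ?thesis unfolding e using spanned_eqv spanned_zero by blast
        qed
      next
        case 2
        have "gen l * (S \<alpha> * G \<beta>) = G \<kappa> * S \<alpha> * G \<beta>" by (simp only: 2 mult.assoc)
        also have "\<dots> \<doteq> (\<Sum>(\<rho>, \<tau>)\<in>min_ext \<Lambda> \<kappa> \<alpha>. S \<rho> * G \<tau>) * G \<beta>"
          using 2 x by (intro eqv_right G_S) simp_all
        also have "\<dots> = (\<Sum>(\<rho>, \<tau>)\<in>min_ext \<Lambda> \<kappa> \<alpha>. S \<rho> * (G \<tau> * G \<beta>))"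
          by (simp only: sum_distrib_right case_prod_unfold mult.assoc)
        finally have e: "gen l * (S \<alpha> * G \<beta>) \<doteq> (\<Sum>(\<rho>, \<tau>)\<in>min_ext \<Lambda> \<kappa> \<alpha>. S \<rho> * (G \<tau> * G \<beta>))" .
        have "spanned (\<Sum>(\<rho>, \<tau>)\<in>min_ext \<Lambda> \<kappa> \<alpha>. S \<rho> * (G \<tau> * G \<beta>))"
        proof (rule spanned_sum, clarify)
          fix \<rho> \<tau> assume p: "(\<rho>, \<tau>) \<in> min_ext \<Lambda> \<kappa> \<alpha>"
          note q = min_extD(1-4)[OF p] min_ext_src[OF p 2(2) x(2)]
          have "S \<rho> * (G \<tau> * G \<beta>) \<doteq> S \<rho> * G (\<beta> \<cdot> \<tau>)"
            using q x by (intro eqv_left G_comp) simp_all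
          moreover have "spanned (sc 1 * (S \<rho> * G (\<beta> \<cdot> \<tau>)))"
            using q x by (intro spanned_monomial) simp_all
          ultimately show "spanned (S \<rho> * (G \<tau> * G \<beta>))" by (auto intro: spanned_eqv)
        qed
        then show ?thesis using e spanned_eqv by blast
      qed
    qed
    then have "spanned (sc c * (gen l * (S \<alpha> * G \<beta>)))" by (rule spanned_sc)
    moreover have "gen l * comb (x # xs) = sc c * (gen l * (S \<alpha> * G \<beta>)) + gen l * comb xs"
      by (simp add: x comb_def distrib_left sc_left_commute)
    ultimately show ?case using Cons spanned_add by auto
  qed
  then show ?thesis using spanned_eqv[OF eqv_left[OF xs(2) lC]] by simp
qed

lemma spanned_word: "w \<in> lists (letters \<Lambda>) \<Longrightarrow> w \<noteq> [] \<Longrightarrow> spanned (Poly_Mapping.single w 1)"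
proof (induction w)
  case (Cons l w)
  show ?case
  proof (cases "w = []")
    case True
    consider \<kappa> where "l = Path \<kappa>" "\<kappa> \<in> M" | \<kappa> where "l = Ghost \<kappa>" "\<kappa> \<in> M"
      using Cons by (auto simp: letters_def)
    then show ?thesis
    proof cases
      case 1
      have "S \<kappa> \<doteq> S \<kappa> * S (sr \<kappa>)" using 1 by (intro eqv_sym[OF S_src])
      also have "\<dots> \<doteq> S \<kappa> * G (sr \<kappa>)" using 1 by (intro eqv_left S_G_vertex) simp_all
      finally show ?thesis
        using spanned_monomial[of \<kappa> "sr \<kappa>" 1] 1 True spanned_eqv by simp
    next
      case 2
      have "G \<kappa> \<doteq> S (sr \<kappa>) * G \<kappa>" using 2 by (intro eqv_sym[OF G_src])
      then show ?thesis
        using spanned_monomial[of "sr \<kappa>" \<kappa> 1] 2 True spanned_eqv by simp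
    qed
  next
    case False
    have "Poly_Mapping.single (l # w) (1 :: 'f) = gen l * Poly_Mapping.single w 1"
      by (simp add: mult_single plus_list_def)
    then show ?thesis using spanned_letter[of l] Cons False by simp
  qed
qed simp

lemma N_spanned: "f \<in> N \<Longrightarrow> spanned f"
proof -
  assume f: "f \<in> N"
  have "f = (\<Sum>w\<in>Poly_Mapping.keys f. Poly_Mapping.single w (Poly_Mapping.lookup f w))"
    by (intro poly_mapping_eqI) (simp add: lookup_sum lookup_single when_def in_keys_iff)
  also have "\<dots> = (\<Sum>w\<in>Poly_Mapping.keys f. sc (Poly_Mapping.lookup f w) * Poly_Mapping.single w 1)"
    by (simp add: mult_single)
  finally have e: "f = \<dots>" .
  have "spanned (\<Sum>w\<in>Poly_Mapping.keys f. sc (Poly_Mapping.lookup f w) * Poly_Mapping.single w 1)"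
  proof (rule spanned_sum)
    fix w assume w: "w \<in> Poly_Mapping.keys f"
    then have "w \<in> lists (letters \<Lambda>)" "w \<noteq> []" using f by (auto simp: N_def C_iff)
    then show "spanned (sc (Poly_Mapping.lookup f w) * Poly_Mapping.single w 1)"
      by (intro spanned_sc spanned_word)
  qed
  then show ?thesis using e by simp
qed

lemma N_sum_form:
  assumes "f \<in> N"
  shows "\<exists>(n :: nat) c l \<mu>. f \<doteq> (\<Sum>i<n. sc (c i) * (S (l i) * G (\<mu> i))) \<and>
    (\<forall>i<n. l i \<in> M \<and> \<mu> i \<in> M \<and> sr (l i) = sr (\<mu> i))"
proof -
  obtain xs where xs: "xs \<in> lists triples" "f \<doteq> comb xs" using N_spanned[OF assms] by (auto simp: spanned_def)
  have "comb xs = (\<Sum>i<length xs. sc (fst (xs ! i)) * (S (fst (snd (xs ! i))) * G (snd (snd (xs ! i)))))"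
    unfolding comb_def by (simp add: sum_list_sum_nth atLeast0LessThan case_prod_beta)
  moreover have "fst (snd (xs ! i)) \<in> M \<and> snd (snd (xs ! i)) \<in> M \<and> sr (fst (snd (xs ! i))) = sr (snd (snd (xs ! i)))"
    if "i < length xs" for i
  proof -
    have "xs ! i \<in> triples" using nth_mem[OF that] xs(1) by blast
    then show ?thesis by (cases "xs ! i") (simp add: triples_def)
  qed
  ultimately show ?thesis using xs(2)
    by (intro exI[of _ "length xs"] exI[of _ "\<lambda>i. fst (xs ! i)"] exI[of _ "\<lambda>i. fst (snd (xs ! i))"]
        exI[of _ "\<lambda>i. snd (snd (xs ! i))"]) simp
qed

lemma local_unit:
  assumes "f \<in> N"
  obtains V where "finite V" "V \<subseteq> vertices \<Lambda>" "(\<Sum>v\<in>V. S v) * f \<doteq> f"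
proof -
  obtain n :: nat and c l \<mu> where f: "f \<doteq> (\<Sum>i<n. sc (c i) * (S (l i) * G (\<mu> i)))"
    and M: "\<forall>i<n. l i \<in> M \<and> \<mu> i \<in> M \<and> sr (l i) = sr (\<mu> i)"
    using N_sum_form[OF assms] by blast
  define V where "V = (\<lambda>i. rg (l i)) ` {..<n}"
  have V: "finite V" "V \<subseteq> vertices \<Lambda>" using M by (auto simp: V_def)
  have eC: "(\<Sum>v\<in>V. S v) \<in> C" using V(2) vertex_rng_src(1) by (intro C_sum) auto
  have unit: "(\<Sum>v\<in>V. S v) * S (l i) \<doteq> S (l i)" if "i < n" for i
  proof -
    have i: "rg (l i) \<in> V" "l i \<in> M" using that M by (auto simp: V_def)
    have "(\<Sum>v\<in>V. S v) * S (l i) = S (rg (l i)) * S (l i) + (\<Sum>v\<in>V - {rg (l i)}. S v * S (l i))"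
      using sum.remove[OF V(1) i(1), of "\<lambda>v. S v * S (l i)"] by (simp add: sum_distrib_right)
    also have "\<dots> \<doteq> S (l i) + 0"
      using V(2) i(2) by (intro eqv_add S_rng eqv_sum_zero vertex_S_zero) auto
    finally show ?thesis by simp
  qed
  have "(\<Sum>v\<in>V. S v) * f \<doteq> (\<Sum>v\<in>V. S v) * (\<Sum>i<n. sc (c i) * (S (l i) * G (\<mu> i)))"
    using f eC by (rule eqv_left)
  also have "\<dots> = (\<Sum>i<n. sc (c i) * ((\<Sum>v\<in>V. S v) * S (l i) * G (\<mu> i)))"
    by (simp only: sum_distrib_left[of "\<Sum>v\<in>V. S v"] sc_left_commute mult.assoc)
  also have "\<dots> \<doteq> (\<Sum>i<n. sc (c i) * (S (l i) * G (\<mu> i)))"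
    using M unit by (intro eqv_sum eqv_left eqv_right) auto
  also have "\<dots> \<doteq> f" using f by (rule eqv_sym)
  finally show thesis using that V by blast
qed

section \<open>Reduction to combinations of ghosts\<close>

text \<open>At a boundary path \<open>U\<close> starting at the common source, those \<open>\<nu>\<close> that lead to the same
  path \<open>\<nu>U\<close> have different degrees, and the exponent of the Laurent monomial records the degree.\<close>

lemma ghost_sum_nonzero:
  assumes "finite X" "X \<subseteq> M" "\<nu>\<^sub>0 \<in> X" "c \<nu>\<^sub>0 \<noteq> 0" "\<And>\<nu>. \<nu> \<in> X \<Longrightarrow> sr \<nu> = u"
  shows "\<not> (\<Sum>\<nu>\<in>X. sc (c \<nu>) * G \<nu>) \<doteq> 0"
proof
  assume z: "(\<Sum>\<nu>\<in>X. sc (c \<nu>) * G \<nu>) \<doteq> 0"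
  have "u \<in> M" using assms(2,3,5) src_closed by blast
  then obtain U where U: "U \<in> BF" "u \<in> U" using BF_exists by blast
  define m where "m = (\<lambda>V. if V = prepend \<nu>\<^sub>0 U then 1 else 0 :: 'f laurent)"
  have "act (\<Sum>\<nu>\<in>X. sc (c \<nu>) * G \<nu>) m U =
    (\<Sum>\<nu>\<in>X. sc' (c \<nu>) * (zpow (- expo (dg \<nu>)) * m (prepend \<nu> U)))"
    if "sc' = (\<lambda>c. Poly_Mapping.single 0 c :: 'f laurent)" for sc'
    unfolding act_sum act_scalar act_ghost using U assms(5) that by (intro sum.cong) simp_all
  then have sum: "(\<Sum>\<nu>\<in>X. Poly_Mapping.single 0 (c \<nu>) * (zpow (- expo (dg \<nu>)) * m (prepend \<nu> U))) = 0"
    using act_eqv[OF z, of m] by simp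
  have "Poly_Mapping.lookup (Poly_Mapping.single 0 (c \<nu>) * (zpow (- expo (dg \<nu>)) * m (prepend \<nu> U)))
      (- expo (dg \<nu>\<^sub>0)) = (if \<nu> = \<nu>\<^sub>0 then c \<nu>\<^sub>0 else 0)" if n: "\<nu> \<in> X" for \<nu>
  proof (cases "prepend \<nu> U = prepend \<nu>\<^sub>0 U \<and> dg \<nu> = dg \<nu>\<^sub>0")
    case True
    have M: "\<nu> \<in> M" "sr \<nu> \<in> U" "\<nu>\<^sub>0 \<in> M" "sr \<nu>\<^sub>0 \<in> U" using assms n U by auto
    have "\<nu> \<in> prepend \<nu> U" "\<nu>\<^sub>0 \<in> prepend \<nu> U"
      using mem_prepend_self[OF M(1,2)] mem_prepend_self[OF M(3,4)] True by auto
    then have "\<nu> = \<nu>\<^sub>0" using BF_eq_deg[OF prepend_BF[OF U(1) M(1,2)]] True by blast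
    then show ?thesis by (simp add: m_def zpow_def mult_single)
  next
    case False
    then show ?thesis by (auto simp: m_def zpow_def mult_single lookup_single when_def)
  qed
  then have "Poly_Mapping.lookup (\<Sum>\<nu>\<in>X. Poly_Mapping.single 0 (c \<nu>) * (zpow (- expo (dg \<nu>)) * m (prepend \<nu> U)))
      (- expo (dg \<nu>\<^sub>0)) = c \<nu>\<^sub>0"
    using assms(1,3) by (simp add: lookup_sum)
  then show False unfolding sum using assms(4) by simp
qed

lemma vertex_nonzero: "v \<in> vertices \<Lambda> \<Longrightarrow> \<not> S v \<doteq> 0"
proof
  assume v: "v \<in> vertices \<Lambda>" and "S v \<doteq> 0"
  then have "G v \<doteq> 0" using S_G_vertex eqv_sym eqv_trans by blast
  then show False
    using ghost_sum_nonzero[of "{v}" v "\<lambda>_. 1"] vertex_rng_src(1)[OF v] by simp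
qed

lemma gap_product_fixes:
  assumes "v \<in> vertices \<Lambda>" "set xs \<subseteq> M" "g \<in> C" "S v * g \<doteq> g" "\<And>\<alpha>. \<alpha> \<in> set xs \<Longrightarrow> G \<alpha> * g \<doteq> 0"
  shows "prod_list (map (gap v) xs) * g \<doteq> g"
  using assms(2,5)
proof (induction xs)
  case Nil
  then show ?case using assms(3) by simp
next
  case (Cons \<alpha> xs)
  let ?Q = "prod_list (map (gap v) xs)"
  have a: "\<alpha> \<in> M" "gap v \<alpha> \<in> C" using Cons.prems vertex_rng_src(1)[OF assms(1)] by simp_all
  have "?Q * g \<doteq> g" using Cons by simp
  then have "gap v \<alpha> * (?Q * g) \<doteq> gap v \<alpha> * g" using a(2) by (rule eqv_left)
  also have "\<dots> = S v * g - S \<alpha> * (G \<alpha> * g)" by (simp only: left_diff_distrib mult.assoc)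
  also have "\<dots> \<doteq> g - 0" using Cons.prems a(1)
    by (intro eqv_diff[OF assms(4)] eqv_zero_left[of "G \<alpha> * g"]) simp_all
  finally show ?case by (simp only: list.map prod_list.Cons mult.assoc diff_0_right)
qed

lemma gap_product_C: "v \<in> vertices \<Lambda> \<Longrightarrow> set xs \<subseteq> M \<Longrightarrow> prod_list (map (gap v) xs) \<in> C"
  by (intro C_prod_list C_diff C_mult C_S C_G) (auto simp: vertex_rng_src(1))

text \<open>Write \<open>f\<close> as a combination of monomials \<open>S (l i) * G (\<mu> i)\<close> and choose \<open>\<rho>\<close> with
  \<open>g = G \<rho> * f\<close> nonzero such that \<open>\<rho>\<close> has passed as many of the \<open>l i\<close> as possible. The passed
  ones contribute ghosts to \<open>g\<close>. The others contribute terms beginning with some \<open>S \<alpha>\<close>,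
  \<open>\<alpha> \<in> B\<close>, where \<open>G \<alpha> * g\<close> vanishes by maximality of \<open>\<rho>\<close>. By the fourth relation \<open>B\<close>
  cannot be exhaustive, so there is a \<open>\<tau>\<close> that has no common extension with any member of \<open>B\<close>, and
  \<open>G \<tau>\<close> removes those terms. The product \<open>?Q\<close> of the gaps at members of \<open>B\<close> also removes
  them, but fixes \<open>g\<close>; hence some coefficient of a ghost is nonzero.\<close>

lemma reduction:
  assumes f: "f \<in> N" "\<not> f \<doteq> 0"
  shows "\<exists>\<sigma>\<in>M. \<exists>X c. finite X \<and> X \<noteq> {} \<and> X \<subseteq> M \<and> (\<forall>\<nu>\<in>X. sr \<nu> = sr \<sigma> \<and> c \<nu> \<noteq> 0) \<and>
    G \<sigma> * f \<doteq> (\<Sum>\<nu>\<in>X. sc (c \<nu>) * G \<nu>)"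
proof -
  have fC: "f \<in> C" using f(1) by (rule N_C)
  obtain n :: nat and c l \<mu> where fs: "f \<doteq> (\<Sum>i<n. sc (c i) * (S (l i) * G (\<mu> i)))"
    and lm: "\<forall>i<n. l i \<in> M \<and> \<mu> i \<in> M \<and> sr (l i) = sr (\<mu> i)"
    using N_sum_form[OF f(1)] by blast
  define passed where "passed = (\<lambda>\<rho>. {i. i < n \<and> prefix (l i) \<rho>})"
  define ok where "ok = (\<lambda>\<rho>. \<rho> \<in> M \<and> \<not> G \<rho> * f \<doteq> 0)"
  have "\<exists>v. ok v"
  proof (rule ccontr)
    assume none: "\<nexists>v. ok v"
    obtain V where V: "V \<subseteq> vertices \<Lambda>" "(\<Sum>v\<in>V. S v) * f \<doteq> f" using local_unit[OF f(1)] by metis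
    have "S v * f \<doteq> 0" if "v \<in> V" for v
    proof -
      have v: "v \<in> vertices \<Lambda>" "v \<in> M" using that V(1) vertex_rng_src(1) by auto
      have "S v * f \<doteq> G v * f" using S_G_vertex[OF v(1)] fC by (rule eqv_right)
      also have "G v * f \<doteq> 0" using none v(2) unfolding ok_def by blast
      finally show ?thesis .
    qed
    then have "(\<Sum>v\<in>V. S v) * f \<doteq> 0" unfolding sum_distrib_right by (intro eqv_sum_zero)
    then show False using V(2) f(2) eqv_sym eqv_trans by blast
  qed
  moreover have "card (passed \<rho>) < Suc n" for \<rho>
    using card_mono[of "{..<n}" "passed \<rho>"] by (auto simp: passed_def less_Suc_eq_le)
  ultimately obtain \<rho> where \<rho>: "ok \<rho>" and max: "\<And>\<rho>'. ok \<rho>' \<Longrightarrow> card (passed \<rho>') \<le> card (passed \<rho>)"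
    using ex_has_greatest_nat[of ok _ "\<lambda>\<rho>. card (passed \<rho>)" "Suc n"] by blast
  have r: "\<rho> \<in> M" using \<rho> by (simp add: ok_def)
  let ?v = "sr \<rho>"
  define g where "g = G \<rho> * f"
  have gC: "g \<in> C" and gn: "\<not> g \<doteq> 0" using \<rho> fC by (auto simp: g_def ok_def)
  define L where "L = passed \<rho>"
  define R where "R = {..<n} - L"
  have LR: "{..<n} = L \<union> R" "L \<inter> R = {}" "finite L" "finite R"
    by (auto simp: L_def R_def passed_def)
  define B where "B = (\<Union>i\<in>R. fst ` min_ext \<Lambda> \<rho> (l i))"
  have lM: "l i \<in> M" "\<mu> i \<in> M" "sr (l i) = sr (\<mu> i)" if "i \<in> R \<or> i \<in> L" for i
    using that lm LR(1) by auto
  have Bfin: "finite B" unfolding B_def using LR(4) lM finite_min_ext[OF r] by auto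
  have BM: "\<alpha> \<in> M" "rg \<alpha> = ?v" if "\<alpha> \<in> B" for \<alpha>
    using that min_extD(1,3) unfolding B_def by force+
  have Bzero: "G \<alpha> * g \<doteq> 0" if aB: "\<alpha> \<in> B" for \<alpha>
  proof (rule ccontr)
    assume nz: "\<not> G \<alpha> * g \<doteq> 0"
    obtain i \<beta> where i: "i \<in> R" "(\<alpha>, \<beta>) \<in> min_ext \<Lambda> \<rho> (l i)" using aB by (auto simp: B_def)
    note q = min_extD[OF i(2)]
    have "G \<alpha> * G \<rho> * f \<doteq> G (\<rho> \<cdot> \<alpha>) * f" using q(1,3) r fC by (intro eqv_right G_comp) simp_all
    then have "ok (\<rho> \<cdot> \<alpha>)"
      using nz q(1,3) r unfolding ok_def g_def by (auto simp: mult.assoc intro: eqv_trans)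
    then have "card (passed (\<rho> \<cdot> \<alpha>)) \<le> card (passed \<rho>)" by (rule max)
    moreover have "passed \<rho> \<subset> passed (\<rho> \<cdot> \<alpha>)"
    proof -
      have "prefix \<rho> (\<rho> \<cdot> \<alpha>)" using prefixI r q(1,3) by blast
      then have "passed \<rho> \<subseteq> passed (\<rho> \<cdot> \<alpha>)" using prefix_trans by (auto simp: passed_def)
      moreover have "i \<in> passed (\<rho> \<cdot> \<alpha>)" "i \<notin> passed \<rho>"
        using i(1) prefixI[of "l i" \<beta>] lM[of i] q unfolding R_def L_def by (auto simp: passed_def)
      ultimately show ?thesis by blast
    qed
    moreover have "finite (passed (\<rho> \<cdot> \<alpha>))" by (simp add: passed_def)
    ultimately show False using psubset_card_mono by (metis leD)
  qed
  have Sg: "S ?v * g \<doteq> g"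
    using eqv_right[OF G_src[OF r] fC] by (simp only: g_def mult.assoc)
  have vB: "?v \<notin> B"
  proof
    assume "?v \<in> B"
    then have "G ?v * g \<doteq> 0" by (rule Bzero)
    moreover have "S ?v * g \<doteq> G ?v * g" using r gC by (intro eqv_right S_G_vertex) simp_all
    ultimately show False using Sg gn eqv_sym eqv_trans by blast
  qed
  obtain bs where bs: "set bs = B" "distinct bs" using finite_distinct_list[OF Bfin] by blast
  let ?Q = "prod_list (map (gap ?v) bs)"
  have QC: "?Q \<in> C" using gap_product_C[of ?v bs] r BM bs by auto
  have Qg: "?Q * g \<doteq> g"
    using gap_product_fixes[of ?v bs g] r BM bs gC Sg Bzero by auto
  have "\<not> exhaustive \<Lambda> ?v B"
  proof
    assume "exhaustive \<Lambda> ?v B"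
    then have "B \<in> FE_at \<Lambda> ?v" using Bfin vB by (auto simp: FE_at_def exhaustive_def)
    then have "?Q \<doteq> 0" using gap_product[of ?v bs] r bs by simp
    then have "?Q * g \<doteq> 0" using gC by (rule eqv_zero_right)
    then show False using Qg gn eqv_sym eqv_trans by blast
  qed
  then obtain \<tau> where t: "\<tau> \<in> M" "rg \<tau> = ?v" "\<And>\<alpha>. \<alpha> \<in> B \<Longrightarrow> min_ext \<Lambda> \<tau> \<alpha> = {}"
    using BM by (auto simp: exhaustive_def paths_from_def)
  have t0: "G \<tau> * S \<alpha> \<doteq> 0" if "\<alpha> \<in> B" for \<alpha>
    using G_S_zero[OF t(1) BM(1)[OF that]] t(3)[OF that] min_ext_nonempty_iff[OF t(1) BM(1)[OF that]]
    by simp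
  have Q0: "?Q * S \<alpha> \<doteq> 0" if "\<alpha> \<in> B" for \<alpha>
    using gap_product_S_zero[of bs ?v \<alpha>] bs BM that r by (auto simp: paths_from_def)
  have "\<exists>\<kappa>. i \<in> L \<longrightarrow> \<kappa> \<in> M \<and> sr (l i) = rg \<kappa> \<and> \<rho> = l i \<cdot> \<kappa>" for i
    unfolding L_def passed_def by (auto elim!: prefixE)
  then obtain \<kappa> where k: "\<And>i. i \<in> L \<Longrightarrow> \<kappa> i \<in> M \<and> sr (l i) = rg (\<kappa> i) \<and> \<rho> = l i \<cdot> \<kappa> i" by metis
  define \<nu> where "\<nu> = (\<lambda>i. \<mu> i \<cdot> \<kappa> i)"
  have \<nu>: "\<nu> i \<in> M" "sr (\<nu> i) = ?v" if "i \<in> L" for i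
  proof -
    have k1: "\<kappa> i \<in> M" "sr (l i) = rg (\<kappa> i)" and k2: "\<rho> = l i \<cdot> \<kappa> i" using k[OF that] by blast+
    have l1: "l i \<in> M" "\<mu> i \<in> M" "sr (\<mu> i) = rg (\<kappa> i)" using lM[of i] that k1(2) by auto
    have "?v = sr (l i \<cdot> \<kappa> i)" using k2 by (rule arg_cong)
    also have "\<dots> = sr (\<kappa> i)" using src_cmp[OF l1(1) k1] .
    finally show "sr (\<nu> i) = ?v" unfolding \<nu>_def src_cmp[OF l1(2) k1(1) l1(3)] by (rule sym)
    show "\<nu> i \<in> M" unfolding \<nu>_def using cmp_closed[OF l1(2) k1(1) l1(3)] .
  qed
  (* The splitting of g into ghosts (h) and terms beginning with a member of B (rest). *)
  define h where "h = (\<Sum>i\<in>L. sc (c i) * G (\<nu> i))"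
  define rest where "rest = (\<Sum>i\<in>R. sc (c i) * (\<Sum>(\<alpha>, \<beta>)\<in>min_ext \<Lambda> \<rho> (l i). S \<alpha> * G \<beta> * G (\<mu> i)))"
  have hC: "h \<in> C" unfolding h_def using \<nu> by (intro C_sum C_mult C_sc C_G)
  have rest_zero: "x * rest \<doteq> 0" if x: "x \<in> C" "\<And>\<alpha>. \<alpha> \<in> B \<Longrightarrow> x * S \<alpha> \<doteq> 0" for x
  proof -
    have "x * rest = (\<Sum>i\<in>R. sc (c i) * (\<Sum>(\<alpha>, \<beta>)\<in>min_ext \<Lambda> \<rho> (l i). x * S \<alpha> * (G \<beta> * G (\<mu> i))))"
      by (simp only: rest_def sum_distrib_left[of x] sc_left_commute[of x] case_prod_unfold mult.assoc)
    also have "\<dots> \<doteq> 0"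
    proof (rule eqv_sum_zero, rule eqv_zero_left[OF _ C_sc], rule eqv_sum_zero, clarify)
      fix i \<alpha> \<beta> assume i: "i \<in> R" "(\<alpha>, \<beta>) \<in> min_ext \<Lambda> \<rho> (l i)"
      have "\<alpha> \<in> B" unfolding B_def using i(1) imageI[OF i(2), of fst] by auto
      then have "x * S \<alpha> \<doteq> 0" by (rule x(2))
      moreover have "G \<beta> * G (\<mu> i) \<in> C" using min_extD(2)[OF i(2)] lM i(1) by simp
      ultimately show "x * S \<alpha> * (G \<beta> * G (\<mu> i)) \<doteq> 0" by (rule eqv_zero_right)
    qed
    finally show ?thesis .
  qed
  have "g \<doteq> G \<rho> * (\<Sum>i<n. sc (c i) * (S (l i) * G (\<mu> i)))"
    unfolding g_def using fs r by (intro eqv_left) simp_all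
  also have "\<dots> = (\<Sum>i\<in>L \<union> R. sc (c i) * (G \<rho> * S (l i) * G (\<mu> i)))"
    unfolding LR(1)[symmetric] by (simp only: sum_distrib_left sc_left_commute mult.assoc)
  also have "\<dots> = (\<Sum>i\<in>L. sc (c i) * (G \<rho> * S (l i) * G (\<mu> i))) + (\<Sum>i\<in>R. sc (c i) * (G \<rho> * S (l i) * G (\<mu> i)))"
    using LR by (intro sum.union_disjoint)
  also have "\<dots> \<doteq> h + rest"
    unfolding h_def rest_def
  proof (rule eqv_add; rule eqv_sum; rule eqv_left[OF _ C_sc])
    fix i assume i: "i \<in> L"
    have "G \<rho> * S (l i) \<doteq> G (\<kappa> i)" using G_comp_S[of "l i" "\<kappa> i"] k[OF i] lM i by simp
    then have "G \<rho> * S (l i) * G (\<mu> i) \<doteq> G (\<kappa> i) * G (\<mu> i)" using lM i by (intro eqv_right) simp_all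
    also have "\<dots> \<doteq> G (\<nu> i)" unfolding \<nu>_def using k[OF i] lM[of i] i by (intro G_comp) simp_all
    finally show "G \<rho> * S (l i) * G (\<mu> i) \<doteq> G (\<nu> i)" .
  next
    fix i assume i: "i \<in> R"
    have "G \<rho> * S (l i) * G (\<mu> i) \<doteq> (\<Sum>(\<alpha>, \<beta>)\<in>min_ext \<Lambda> \<rho> (l i). S \<alpha> * G \<beta>) * G (\<mu> i)"
      using r lM i by (intro eqv_right G_S) simp_all
    then show "G \<rho> * S (l i) * G (\<mu> i) \<doteq> (\<Sum>(\<alpha>, \<beta>)\<in>min_ext \<Lambda> \<rho> (l i). S \<alpha> * G \<beta> * G (\<mu> i))"
      by (simp only: sum_distrib_right case_prod_unfold)
  qed
  finally have gh: "g \<doteq> h + rest" .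
  have g_via: "x * g \<doteq> x * h" if x: "x \<in> C" "\<And>\<alpha>. \<alpha> \<in> B \<Longrightarrow> x * S \<alpha> \<doteq> 0" for x
  proof -
    have "x * g \<doteq> x * h + x * rest" using eqv_left[OF gh x(1)] by (simp only: distrib_left)
    also have "\<dots> \<doteq> x * h + 0" using rest_zero[OF x] x(1) hC by (intro eqv_add) simp_all
    finally show ?thesis by simp
  qed
  have gQh: "g \<doteq> ?Q * h" using eqv_trans[OF eqv_sym[OF Qg] g_via[OF QC Q0]] .
  (* Different i may lead to the same ghost, so coefficients are collected before zeros are dropped. *)
  define d where "d = (\<lambda>w. \<Sum>i\<in>{i \<in> L. \<nu> i = w}. c i)"
  define X where "X = {w \<in> \<nu> ` L. d w \<noteq> 0}"
  have sc_sum: "sc (sum c A) = (\<Sum>i\<in>A. sc (c i))" for A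
    by (induction A rule: infinite_finite_induct) (simp_all add: single_add)
  have "h = (\<Sum>w\<in>\<nu> ` L. \<Sum>i\<in>{i \<in> L. \<nu> i = w}. sc (c i) * G (\<nu> i))"
    unfolding h_def using LR(3) by (rule sum.image_gen)
  also have "\<dots> = (\<Sum>w\<in>\<nu> ` L. sc (d w) * G w)"
    by (intro sum.cong) (simp_all add: d_def sc_sum sum_distrib_right)
  also have "\<dots> = (\<Sum>w\<in>X. sc (d w) * G w)"
    unfolding X_def using LR(3) by (intro sum.mono_neutral_right) auto
  finally have hX: "h = (\<Sum>w\<in>X. sc (d w) * G w)" .
  have X: "finite X" "\<And>w. w \<in> X \<Longrightarrow> w \<in> M \<and> sr w = ?v \<and> d w \<noteq> 0"
    using LR(3) \<nu> by (auto simp: X_def)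
  have "X \<noteq> {}"
  proof
    assume "X = {}"
    then have "g \<doteq> 0" using gQh hX by simp
    then show False using gn by simp
  qed
  have inj: "inj_on (\<lambda>w. w \<cdot> \<tau>) X"
    using X(2) comp_cancel_right t by (intro inj_onI) metis
  define e where "e = (\<lambda>w. d (inv_into X (\<lambda>w. w \<cdot> \<tau>) w))"
  have e: "e (w \<cdot> \<tau>) = d w" if "w \<in> X" for w
    unfolding e_def using inv_into_f_f[OF inj that] by simp
  have "G (\<rho> \<cdot> \<tau>) * f \<doteq> G \<tau> * G \<rho> * f" using r t fC by (intro eqv_right eqv_sym[OF G_comp]) simp_all
  also have "\<dots> = G \<tau> * g" by (simp only: g_def mult.assoc)
  also have "\<dots> \<doteq> G \<tau> * h" using g_via[OF C_G[OF t(1)] t0] .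
  also have "\<dots> = (\<Sum>w\<in>X. sc (d w) * (G \<tau> * G w))"
    unfolding hX by (simp only: sum_distrib_left sc_left_commute)
  also have "\<dots> \<doteq> (\<Sum>w\<in>X. sc (e (w \<cdot> \<tau>)) * G (w \<cdot> \<tau>))"
    using X t by (intro eqv_sum) (simp add: e eqv_left G_comp)
  also have "\<dots> = (\<Sum>w\<in>(\<lambda>w. w \<cdot> \<tau>) ` X. sc (e w) * G w)"
    by (simp add: sum.reindex[OF inj])
  finally have "G (\<rho> \<cdot> \<tau>) * f \<doteq> (\<Sum>w\<in>(\<lambda>w. w \<cdot> \<tau>) ` X. sc (e w) * G w)" .
  moreover have "w \<cdot> \<tau> \<in> M" "sr (w \<cdot> \<tau>) = sr (\<rho> \<cdot> \<tau>)" "e (w \<cdot> \<tau>) \<noteq> 0" if "w \<in> X" for w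
    using X(2)[OF that] e[OF that] t r by simp_all
  moreover have "\<rho> \<cdot> \<tau> \<in> M" using r t by simp
  ultimately show ?thesis using \<open>X \<noteq> {}\<close> X(1)
    by (intro bexI[of _ "\<rho> \<cdot> \<tau>"] exI[of _ "(\<lambda>w. w \<cdot> \<tau>) ` X"] exI[of _ e]) auto
qed

section \<open>Simple elements and line points\<close>

definition simple :: "('a, 'f) free \<Rightarrow> bool" where
  "simple f \<longleftrightarrow> \<not> f \<doteq> 0 \<and> (\<forall>g\<in>N. \<not> g * f \<doteq> 0 \<longrightarrow> (\<exists>h\<in>N. f \<doteq> h * (g * f)))"

lemma simple_left:
  assumes "simple f" "f \<in> N" "g \<in> N" "\<not> g * f \<doteq> 0" shows "simple (g * f)"
  unfolding simple_def
proof (intro conjI ballI impI)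
  fix h assume h: "h \<in> N" "\<not> h * (g * f) \<doteq> 0"
  then have "\<not> (h * g) * f \<doteq> 0" "h * g \<in> N" using assms N_C by (simp_all add: mult.assoc)
  then obtain k where k: "k \<in> N" "f \<doteq> k * ((h * g) * f)" using assms(1) unfolding simple_def by blast
  have "g * f \<doteq> g * (k * ((h * g) * f))" using k(2) N_C[OF assms(3)] by (rule eqv_left)
  then show "\<exists>k\<in>N. g * f \<doteq> k * (h * (g * f))"
    using k(1) assms(3) N_C by (intro bexI[of _ "g * k"]) (simp_all add: mult.assoc)
qed (use assms in simp)

lemma simple_right:
  assumes "simple f" "f \<in> N" "g \<in> C" "\<not> f * g \<doteq> 0" shows "simple (f * g)"
  unfolding simple_def
proof (intro conjI ballI impI)
  fix h assume h: "h \<in> N" "\<not> h * (f * g) \<doteq> 0"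
  then have "\<not> h * f \<doteq> 0" using eqv_zero_right[OF _ assms(3), of "h * f"] by (auto simp: mult.assoc)
  then obtain k where k: "k \<in> N" "f \<doteq> k * (h * f)" using assms(1) h(1) unfolding simple_def by blast
  have "f * g \<doteq> k * (h * f) * g" using k(2) assms(3) by (rule eqv_right)
  then show "\<exists>k\<in>N. f * g \<doteq> k * (h * (f * g))" using k(1) by (auto simp: mult.assoc)
qed (use assms in simp)

lemma simple_eqv:
  assumes "f \<doteq> g" "simple f" shows "simple g"
  unfolding simple_def
proof (intro conjI ballI impI)
  show "\<not> g \<doteq> 0" using assms eqv_trans unfolding simple_def by blast
  fix h assume h: "h \<in> N" "\<not> h * g \<doteq> 0"
  have hh: "h * f \<doteq> h * g" using assms(1) N_C[OF h(1)] by (rule eqv_left)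
  then have "\<not> h * f \<doteq> 0" using h(2) eqv_sym eqv_trans by blast
  then obtain k where k: "k \<in> N" "f \<doteq> k * (h * f)" using assms(2) h(1) unfolding simple_def by blast
  have "g \<doteq> f" using assms(1) by (rule eqv_sym)
  also note k(2)
  also have "k * (h * f) \<doteq> k * (h * g)" using hh N_C[OF k(1)] by (rule eqv_left)
  finally show "\<exists>k\<in>N. g \<doteq> k * (h * g)" using k(1) by blast
qed

definition delta :: "'a set \<Rightarrow> 'a set \<Rightarrow> 'f laurent" where
  "delta U V = (if V = U then 1 else 0)"

text \<open>Everything in the left ideal generated by \<open>te\<close> acts on \<open>\<delta>\<^sub>U\<close> with coefficients divisible by
  \<open>P * (zpow z - 1)\<close>. As \<open>zpow z - 1\<close> is not a unit, \<open>e\<close> itself is not in this ideal, although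
  \<open>te\<close> is nonzero.\<close>

lemma not_simple_of_monomial:
  assumes "e \<in> N" "t \<in> N" "P \<noteq> 0" "z \<noteq> 0"
    and e: "act e (delta U) = (\<lambda>V. P * delta U V)"
    and t: "act t (delta U) = (\<lambda>V. (zpow z - 1) * delta U V)"
  shows "\<not> simple e"
proof
  assume s: "simple e"
  have te: "act (t * e) (delta U) = (\<lambda>V. (P * (zpow z - 1)) * delta U V)"
    by (simp add: act_mult e act_scale t mult.assoc)
  have "zpow z \<noteq> (zpow 0 :: 'f laurent)" using assms(4) zpow_inject[of z 0] by blast
  then have "act (t * e) (delta U) U \<noteq> 0" using assms(3) by (simp add: te delta_def)
  then have "\<not> t * e \<doteq> 0" using act_eqv[of "t * e" 0 "delta U"] by auto
  then obtain h where "e \<doteq> h * (t * e)" using s assms(2) unfolding simple_def by blast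
  then have "act e (delta U) = act (h * (t * e)) (delta U)" by (rule act_eqv)
  also have "\<dots> = (\<lambda>V. P * (zpow z - 1) * act h (delta U) V)"
    unfolding act_mult[of h] te by (rule act_scale)
  finally have "P * delta U U = P * (zpow z - 1) * act h (delta U) U"
    unfolding e by (rule fun_cong)
  then have "P * ((zpow z - 1) * act h (delta U) U) = P * 1" by (simp add: mult.assoc delta_def)
  then have "(zpow z - 1) * act h (delta U) U = 1" using assms(3) by (simp only: mult_cancel_left) simp
  then show False using zpow_minus_one_not_unit by blast
qed

lemma path_nonzero: "\<alpha> \<in> M \<Longrightarrow> \<not> S \<alpha> \<doteq> 0"
proof
  assume a: "\<alpha> \<in> M" "S \<alpha> \<doteq> 0"
  then have "G \<alpha> * S \<alpha> \<doteq> 0" by (intro eqv_zero_left) simp_all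
  then show False using G_S_self[OF a(1)] vertex_nonzero[of "sr \<alpha>"] a(1) eqv_sym eqv_trans by (metis src_vertex)
qed

text \<open>Simplicity gives \<open>S v \<doteq> h * G \<mu>\<close> for some \<open>h\<close>; if \<open>\<beta>\<close> had no common extension with
  \<open>\<mu>\<close>, multiplying by \<open>S \<beta>\<close> on the right would give \<open>S \<beta> \<doteq> 0\<close>.\<close>

lemma simple_vertex_compat:
  assumes v: "v \<in> vertices \<Lambda>" and s: "simple (S v)"
    and "\<mu> \<in> paths_from \<Lambda> v" "\<beta> \<in> paths_from \<Lambda> v"
  shows "compat \<mu> \<beta>"
proof (rule ccontr)
  assume nc: "\<not> compat \<mu> \<beta>"
  have M: "\<mu> \<in> M" "\<beta> \<in> M" "rg \<mu> = v" "rg \<beta> = v" "v \<in> M"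
    using assms(3,4) vertex_rng_src(1)[OF v] by (auto simp: paths_from_def)
  have Gv: "G \<mu> * S v \<doteq> G \<mu>" using G_rng[OF M(1)] M(3) by simp
  have "\<not> G \<mu> * S v \<doteq> 0"
  proof
    assume "G \<mu> * S v \<doteq> 0"
    then have "G \<mu> \<doteq> 0" using Gv eqv_sym eqv_trans by blast
    then have "G \<mu> * S \<mu> \<doteq> 0" using M(1) by (intro eqv_zero_right) simp_all
    then have "S (sr \<mu>) \<doteq> 0" using G_S_self[OF M(1)] eqv_sym eqv_trans by blast
    then show False using vertex_nonzero M(1) by simp
  qed
  then obtain h where h: "h \<in> N" "S v \<doteq> h * (G \<mu> * S v)" using s M(1) unfolding simple_def by (metis N_G)
  have "S \<beta> \<doteq> S v * S \<beta>" using eqv_sym[OF S_rng[OF M(2)]] M(4) by simp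
  also have "\<dots> \<doteq> h * (G \<mu> * S v) * S \<beta>" using h(2) M(2) by (intro eqv_right) simp_all
  also have "\<dots> \<doteq> h * G \<mu> * S \<beta>" using Gv h(1) M(2) N_C by (intro eqv_right eqv_left) simp_all
  also have "\<dots> = h * (G \<mu> * S \<beta>)" by (simp only: mult.assoc)
  also have "\<dots> \<doteq> 0" by (rule eqv_zero_left[OF G_S_zero[OF M(1,2) nc] N_C[OF h(1)]])
  finally show False using path_nonzero[OF M(2)] by simp
qed

theorem simple_vertex_iff:
  assumes v: "v \<in> vertices \<Lambda>"
  shows "simple (S v) \<longleftrightarrow> v \<in> line_points \<Lambda>"
proof
  have vM: "v \<in> M" "rg v = v" "sr v = v" using vertex_rng_src[OF v] .
  assume s: "simple (S v)"
  have com: "compat \<alpha> \<beta>" if "\<alpha> \<in> paths_from \<Lambda> v" "\<beta> \<in> paths_from \<Lambda> v" for \<alpha> \<beta>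
    using simple_vertex_compat[OF v s that] .
  (* Every singleton is exhaustive at v, so there is only one boundary filter at v. *)
  have all: "U = paths_from \<Lambda> v" if U: "U \<in> BF" "v \<in> U" for U
  proof (intro equalityI subsetI)
    fix \<alpha> assume "\<alpha> \<in> U"
    then show "\<alpha> \<in> paths_from \<Lambda> v"
      using BF_mor[OF U(1)] BF_rng_eq[OF U(1) _ U(2)] vM by (auto simp: paths_from_def)
  next
    fix \<mu> assume m: "\<mu> \<in> paths_from \<Lambda> v"
    have "exhaustive \<Lambda> (sr v) {\<mu>}"
      unfolding exhaustive_def vM(3)
    proof (intro conjI ballI)
      fix \<alpha> assume a: "\<alpha> \<in> paths_from \<Lambda> v"
      then have "\<alpha> \<in> M" "\<mu> \<in> M" using m by (auto simp: paths_from_def)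
      then have "min_ext \<Lambda> \<alpha> \<mu> \<noteq> {}" using com[OF a m] min_ext_nonempty_iff by blast
      then show "\<exists>\<mu>'\<in>{\<mu>}. min_ext \<Lambda> \<alpha> \<mu>' \<noteq> {}" by blast
    qed (use m in simp)
    then obtain \<epsilon> where "\<epsilon> \<in> {\<mu>}" "v \<cdot> \<epsilon> \<in> U" using BF_exhaustive[OF U] by blast
    then show "\<mu> \<in> U" using cmp_rng[of \<mu>] m by (auto simp: paths_from_def)
  qed
  have "\<alpha> = \<beta>" if ab: "\<alpha> \<in> paths_from \<Lambda> v" "\<beta> \<in> paths_from \<Lambda> v" "sr \<alpha> = sr \<beta>" for \<alpha> \<beta>
  proof (rule ccontr)
    assume ne: "\<alpha> \<noteq> \<beta>"
    then have d: "dg \<alpha> \<noteq> dg \<beta>" using compat_eq_deg[OF com[OF ab(1,2)]] by blast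
    have M: "\<alpha> \<in> M" "\<beta> \<in> M" "rg \<alpha> = v" "rg \<beta> = v" using ab by (auto simp: paths_from_def)
    obtain U where U: "U \<in> BF" "sr \<alpha> \<in> U" using BF_exists[of "sr \<alpha>"] M by auto
    define W where "W = prepend \<alpha> U"
    have W: "W \<in> BF" "v \<in> W" "\<alpha> \<in> W"
      using prepend_BF[OF U(1) M(1) U(2)] mem_prepend_self[OF M(1) U(2)] BF_rng M(3) unfolding W_def by blast+
    have "strip \<alpha> W = U" unfolding W_def using strip_prepend[OF U(1) M(1) U(2)] .
    moreover have "prepend \<beta> U = W"
      using all[OF W(1,2)] all[OF prepend_BF[OF U(1) M(2)]] U(2) ab(3) mem_prepend_self[OF M(2)]
        BF_rng[OF prepend_BF[OF U(1) M(2)]] M(4) by metis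
    ultimately have bW: "prepend \<beta> (strip \<alpha> W) = W" by simp
    (* Both \<alpha> and \<beta> lead from U to the only filter at v, so S \<alpha> * G \<beta> fixes W up to a monomial. *)
    define z where "z = expo (dg \<alpha>) - expo (dg \<beta>)"
    have "act (S \<alpha> * G \<beta> - S v) (delta W) V = (zpow z - 1) * delta W V" for V
    proof (cases "V = W")
      case True
      then show ?thesis
        using W bW by (simp add: act_diff act_mult act_path_ghost[OF M(1,2) ab(3)] act_vertex[OF v] delta_def z_def)
    next
      case False
      then have "\<not> (V \<in> BF \<and> v \<in> V)" using all W by blast
      then have "\<not> (V \<in> BF \<and> \<alpha> \<in> V)" using BF_rng M(3) by blast
      then show ?thesis using False
        by (auto simp: act_diff act_mult act_path_ghost[OF M(1,2) ab(3)] act_vertex[OF v] delta_def)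
    qed
    moreover have "act (S v) (delta W) V = 1 * delta W V" for V
      using W all by (auto simp: act_vertex[OF v] delta_def)
    moreover have "S \<alpha> * G \<beta> - S v \<in> N" "S v \<in> N" using M vM by simp_all
    moreover have "z \<noteq> 0" using d by (simp add: z_def)
    ultimately have "\<not> simple (S v)"
      using not_simple_of_monomial[of "S v" "S \<alpha> * G \<beta> - S v" 1 z W] by (simp add: fun_eq_iff)
    then show False using s by simp
  qed
  then show "v \<in> line_points \<Lambda>" using line_points_iff v com by blast
next
  assume "v \<in> line_points \<Lambda>"
  then have lp: "compat \<alpha> \<beta>" "sr \<alpha> = sr \<beta> \<Longrightarrow> \<alpha> = \<beta>"
    if "\<alpha> \<in> paths_from \<Lambda> v" "\<beta> \<in> paths_from \<Lambda> v" for \<alpha> \<beta>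
    using that line_points_iff by blast+
  have vM: "v \<in> M" "rg v = v" "sr v = v" using vertex_rng_src[OF v] .
  show "simple (S v)" unfolding simple_def
  proof (intro conjI ballI impI)
    show "\<not> S v \<doteq> 0" using vertex_nonzero[OF v] .
    fix g assume g: "g \<in> N" "\<not> g * S v \<doteq> 0"
    have gv: "g * S v \<in> N" using g(1) vM by simp
    obtain \<sigma> X c where s: "\<sigma> \<in> M" and X: "finite X" "X \<noteq> {}" "X \<subseteq> M"
      and Xc: "\<forall>\<nu>\<in>X. sr \<nu> = sr \<sigma> \<and> c \<nu> \<noteq> 0"
      and e: "G \<sigma> * (g * S v) \<doteq> (\<Sum>\<nu>\<in>X. sc (c \<nu>) * G \<nu>)"
      using reduction[OF gv g(2)] by blast
    have C: "g \<in> C" "G \<sigma> \<in> C" "S v \<in> C" using g(1) N_C s vM by simp_all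
    define Y where "Y = {\<nu> \<in> X. rg \<nu> = v}"
    have "S v * S v \<doteq> S v" using S_rng[OF vM(1)] vM(2) by simp
    then have "G \<sigma> * (g * S v) \<doteq> G \<sigma> * (g * (S v * S v))" using C by (intro eqv_left eqv_sym[of "S v * S v"])
    also have "\<dots> = G \<sigma> * (g * S v) * S v" by (simp only: mult.assoc)
    also have "\<dots> \<doteq> (\<Sum>\<nu>\<in>X. sc (c \<nu>) * G \<nu>) * S v" using e C by (intro eqv_right)
    also have "\<dots> = (\<Sum>\<nu>\<in>X. sc (c \<nu>) * (G \<nu> * S v))" by (simp only: sum_distrib_right mult.assoc)
    also have "\<dots> \<doteq> (\<Sum>\<nu>\<in>X. if rg \<nu> = v then sc (c \<nu>) * G \<nu> else 0)"
    proof (rule eqv_sum)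
      fix \<nu> assume "\<nu> \<in> X"
      then have n: "\<nu> \<in> M" using X by blast
      show "sc (c \<nu>) * (G \<nu> * S v) \<doteq> (if rg \<nu> = v then sc (c \<nu>) * G \<nu> else 0)"
        using eqv_left[OF G_rng[OF n] C_sc] eqv_zero_left[OF G_vertex_zero[OF v n] C_sc] by auto
    qed
    also have "\<dots> = (\<Sum>\<nu>\<in>Y. sc (c \<nu>) * G \<nu>)"
      unfolding Y_def using X(1) by (simp add: sum.inter_filter)
    finally have eY: "G \<sigma> * (g * S v) \<doteq> (\<Sum>\<nu>\<in>Y. sc (c \<nu>) * G \<nu>)" .
    have "Y \<noteq> {}"
    proof
      assume "Y = {}"
      then have "(\<Sum>\<nu>\<in>X. sc (c \<nu>) * G \<nu>) \<doteq> 0" using eY eqv_trans[OF eqv_sym[OF e]] by simp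
      then show False using ghost_sum_nonzero[OF X(1,3)] X(2) Xc by blast
    qed
    then obtain \<nu> where n: "\<nu> \<in> Y" by blast
    have nM: "\<nu> \<in> M" "rg \<nu> = v" "c \<nu> \<noteq> 0" using n X Xc by (auto simp: Y_def)
    (* All members of Y have the same source, and at a line point that determines the path. *)
    have "Y = {\<nu>}"
    proof -
      have "\<nu>' = \<nu>" if "\<nu>' \<in> Y" for \<nu>'
        using lp(2)[of \<nu>' \<nu>] that n X Xc by (auto simp: Y_def paths_from_def)
      then show ?thesis using n by blast
    qed
    then have e1: "G \<sigma> * (g * S v) \<doteq> sc (c \<nu>) * G \<nu>" using eY by simp
    have SG: "S \<nu> * G \<nu> \<doteq> S v"
    proof (cases "\<nu> = v")
      case True
      have "S v * G v \<doteq> S v * S v" using C(3) eqv_sym[OF S_G_vertex[OF v]] by (intro eqv_left)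
      also have "\<dots> \<doteq> S v" using \<open>S v * S v \<doteq> S v\<close> .
      finally show ?thesis using True by simp
    next
      case False
      have "{\<nu>} \<in> FE_at \<Lambda> v"
      proof -
        have "min_ext \<Lambda> \<alpha> \<nu> \<noteq> {}" if "\<alpha> \<in> paths_from \<Lambda> v" for \<alpha>
          using lp(1)[OF that, of \<nu>] that nM min_ext_nonempty_iff by (auto simp: paths_from_def)
        then show ?thesis using False nM by (auto simp: FE_at_def exhaustive_def paths_from_def)
      qed
      then have "S v - S \<nu> * G \<nu> \<doteq> 0" using gap_product[OF v, of "[\<nu>]"] by simp
      from eqv_add[OF this eqv_refl[of "S \<nu> * G \<nu>"]] have "S v \<doteq> S \<nu> * G \<nu>" using nM by simp
      then show ?thesis by (rule eqv_sym)
    qed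
    define h where "h = sc (inverse (c \<nu>)) * (S \<nu> * G \<sigma>)"
    have "h * (g * S v) = sc (inverse (c \<nu>)) * (S \<nu> * (G \<sigma> * (g * S v)))" by (simp only: h_def mult.assoc)
    also have "\<dots> \<doteq> sc (inverse (c \<nu>)) * (S \<nu> * (sc (c \<nu>) * G \<nu>))" using e1 nM by (intro eqv_left) simp_all
    also have "\<dots> = sc (inverse (c \<nu>) * c \<nu>) * (S \<nu> * G \<nu>)"
      by (simp only: sc_left_commute[of "S \<nu>"] sc_mult[symmetric] mult.assoc)
    also have "\<dots> = S \<nu> * G \<nu>" using nM(3) by simp
    also have "\<dots> \<doteq> S v" by (rule SG)
    finally have "S v \<doteq> h * (g * S v)" by (rule eqv_sym)
    moreover have "h \<in> N" unfolding h_def using nM s by simp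
    ultimately show "\<exists>h\<in>N. S v \<doteq> h * (g * S v)" by blast
  qed
qed

lemma act_isotropy:
  assumes "\<alpha> \<in> M" "\<beta> \<in> M" "sr \<alpha> = sr \<beta>" "U \<in> BF" "sr \<alpha> \<in> U" "prepend \<alpha> U = prepend \<beta> U"
  shows "act (G \<alpha> * S \<beta>) (delta U) = (\<lambda>V. zpow (expo (dg \<beta>) - expo (dg \<alpha>)) * delta U V)"
proof
  fix V
  show "act (G \<alpha> * S \<beta>) (delta U) V = zpow (expo (dg \<beta>) - expo (dg \<alpha>)) * delta U V"
  proof (cases "V = U")
    case True
    have "sr \<beta> \<in> U" using assms(3,5) by simp
    then have "\<beta> \<in> prepend \<alpha> U" "strip \<beta> (prepend \<alpha> U) = U"
      unfolding assms(6) using mem_prepend_self strip_prepend assms(2,4) by blast+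
    then show ?thesis using True assms(4,5)
      by (simp add: act_mult act_ghost_path[OF assms(1,2)] delta_def)
  next
    case False
    have "strip \<beta> (prepend \<alpha> V) \<noteq> U" if V: "V \<in> BF" "sr \<alpha> \<in> V" "\<beta> \<in> prepend \<alpha> V"
    proof
      assume "strip \<beta> (prepend \<alpha> V) = U"
      then have "prepend \<beta> U = prepend \<alpha> V"
        using prepend_strip[OF prepend_BF[OF V(1) assms(1) V(2)] V(3)] by simp
      then have "strip \<alpha> (prepend \<alpha> U) = strip \<alpha> (prepend \<alpha> V)" using assms(6) by simp
      then show False using False strip_prepend assms(1,4,5) V by simp
    qed
    then show ?thesis using False by (auto simp: act_mult act_ghost_path[OF assms(1,2)] delta_def)
  qed
qed

text \<open>Here \<open>J \<tau>\<close> indexes the terms that survive multiplication by \<open>G \<tau>\<close> on the left and by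
  \<open>S (\<nu>\<^sub>1 \<cdot> \<tau>)\<close> on the right. As it can only shrink when \<open>\<tau>\<close> is extended, a \<open>\<tau>\<close> with the fewest
  survivors makes \<open>\<nu>\<tau>\<kappa>\<close> and \<open>\<nu>\<^sub>1\<tau>\<kappa>\<close> compatible for all \<open>\<kappa>\<close> and all survivors \<open>\<nu>\<close>, so
  that \<open>\<nu>\<tau>x = \<nu>\<^sub>1\<tau>x\<close> for every boundary path \<open>x\<close> at the source of \<open>\<tau>\<close>.\<close>

theorem simple_reaches_line_point:
  assumes a: "a \<in> N" "simple a"
  shows "\<exists>w\<in>line_points \<Lambda>. \<exists>k\<in>N. S w * (k * a) \<doteq> k * a \<and> \<not> k * a \<doteq> 0"
proof -
  have aC: "a \<in> C" using a(1) by (rule N_C)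
  have "\<not> a \<doteq> 0" using a(2) by (simp add: simple_def)
  then obtain \<sigma> X c where s: "\<sigma> \<in> M" and X: "finite X" "X \<noteq> {}" "X \<subseteq> M"
    and Xc: "\<forall>\<nu>\<in>X. sr \<nu> = sr \<sigma> \<and> c \<nu> \<noteq> 0" and e: "G \<sigma> * a \<doteq> (\<Sum>\<nu>\<in>X. sc (c \<nu>) * G \<nu>)"
    using reduction[OF a(1)] by blast
  obtain \<nu>\<^sub>1 where n1: "\<nu>\<^sub>1 \<in> X" using X(2) by blast
  define J where "J = (\<lambda>\<tau>. {\<nu> \<in> X. compat (\<nu> \<cdot> \<tau>) (\<nu>\<^sub>1 \<cdot> \<tau>)})"
  have Jfin: "finite (J \<tau>)" for \<tau> unfolding J_def using X(1) by simp
  have "sr \<sigma> \<in> M \<and> rg (sr \<sigma>) = sr \<sigma>" using s by simp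
  from ex_has_least_nat[of "\<lambda>\<tau>. \<tau> \<in> M \<and> rg \<tau> = sr \<sigma>", OF this, of "\<lambda>\<tau>. card (J \<tau>)"]
  obtain \<tau> where t: "\<tau> \<in> M" "rg \<tau> = sr \<sigma>"
    and least: "\<And>\<tau>'. \<tau>' \<in> M \<Longrightarrow> rg \<tau>' = sr \<sigma> \<Longrightarrow> card (J \<tau>) \<le> card (J \<tau>')" by blast
  let ?w = "sr \<tau>"
  have w: "?w \<in> vertices \<Lambda>" "?w \<in> M" using t by simp_all
  have XM: "\<nu> \<in> M" "sr \<nu> = rg \<tau>" "\<nu> \<cdot> \<tau> \<in> M" "sr (\<nu> \<cdot> \<tau>) = ?w" if "\<nu> \<in> X" for \<nu>
    using that X(3) Xc t by auto
  let ?\<beta> = "\<nu>\<^sub>1 \<cdot> \<tau>"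
  have J1: "\<nu>\<^sub>1 \<in> J \<tau>" unfolding J_def using n1 XM[OF n1] prefix_refl compatI by blast
  have stable: "compat (\<nu> \<cdot> \<tau> \<cdot> \<kappa>) (?\<beta> \<cdot> \<kappa>)" if n: "\<nu> \<in> J \<tau>" and k: "\<kappa> \<in> M" "rg \<kappa> = ?w" for \<nu> \<kappa>
  proof -
    have assoc: "\<nu>' \<cdot> (\<tau> \<cdot> \<kappa>) = \<nu>' \<cdot> \<tau> \<cdot> \<kappa>" if "\<nu>' \<in> X" for \<nu>'
      using cmp_assoc XM[OF that] t k by simp
    have "J (\<tau> \<cdot> \<kappa>) \<subseteq> J \<tau>"
    proof
      fix \<nu>' assume "\<nu>' \<in> J (\<tau> \<cdot> \<kappa>)"
      then have n': "\<nu>' \<in> X" "compat (\<nu>' \<cdot> \<tau> \<cdot> \<kappa>) (?\<beta> \<cdot> \<kappa>)" using assoc n1 by (auto simp: J_def)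
      have "prefix (\<nu>' \<cdot> \<tau>) (\<nu>' \<cdot> \<tau> \<cdot> \<kappa>)" "prefix ?\<beta> (?\<beta> \<cdot> \<kappa>)"
        using prefixI XM[OF n'(1)] XM[OF n1] k by simp_all
      then show "\<nu>' \<in> J \<tau>" unfolding J_def using n' compat_prefix by blast
    qed
    moreover have "card (J \<tau>) \<le> card (J (\<tau> \<cdot> \<kappa>))" using t k by (intro least) simp_all
    ultimately have "J (\<tau> \<cdot> \<kappa>) = J \<tau>" using Jfin card_seteq by blast
    then have "\<nu> \<in> J (\<tau> \<cdot> \<kappa>)" using n by simp
    then show ?thesis using assoc n1 by (auto simp: J_def)
  qed
  define k where "k = G \<tau> * G \<sigma>"
  have kN: "k \<in> N" unfolding k_def using t s by simp
  have kaN: "k * a \<in> N" using a(1) N_C[OF kN] by simp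
  define q where "q = (\<Sum>\<nu>\<in>J \<tau>. sc (c \<nu>) * (G (\<nu> \<cdot> \<tau>) * S ?\<beta>))"
  have \<beta>M: "?\<beta> \<in> M" "sr ?\<beta> = ?w" using XM[OF n1] by simp_all
  have "k * a * S ?\<beta> = G \<tau> * (G \<sigma> * a) * S ?\<beta>" by (simp only: k_def mult.assoc)
  also have "\<dots> \<doteq> G \<tau> * (\<Sum>\<nu>\<in>X. sc (c \<nu>) * G \<nu>) * S ?\<beta>"
    using e t \<beta>M by (intro eqv_right eqv_left) simp_all
  also have "\<dots> = (\<Sum>\<nu>\<in>X. sc (c \<nu>) * (G \<tau> * G \<nu> * S ?\<beta>))"
    by (simp only: sum_distrib_left sum_distrib_right sc_left_commute mult.assoc)
  also have "\<dots> \<doteq> (\<Sum>\<nu>\<in>X. if compat (\<nu> \<cdot> \<tau>) ?\<beta> then sc (c \<nu>) * (G (\<nu> \<cdot> \<tau>) * S ?\<beta>) else 0)"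
  proof (rule eqv_sum)
    fix \<nu> assume n: "\<nu> \<in> X"
    have 1: "G \<tau> * G \<nu> * S ?\<beta> \<doteq> G (\<nu> \<cdot> \<tau>) * S ?\<beta>"
      using XM[OF n] t \<beta>M by (intro eqv_right G_comp) simp_all
    have 2: "G (\<nu> \<cdot> \<tau>) * S ?\<beta> \<doteq> 0" if "\<not> compat (\<nu> \<cdot> \<tau>) ?\<beta>"
      using G_S_zero[OF XM(3)[OF n] \<beta>M(1) that] .
    show "sc (c \<nu>) * (G \<tau> * G \<nu> * S ?\<beta>) \<doteq>
        (if compat (\<nu> \<cdot> \<tau>) ?\<beta> then sc (c \<nu>) * (G (\<nu> \<cdot> \<tau>) * S ?\<beta>) else 0)"
      using eqv_left[OF 1 C_sc] eqv_zero_left[OF eqv_trans[OF 1 2] C_sc] by simp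
  qed
  also have "\<dots> = q" unfolding q_def J_def using X(1) by (simp add: sum.inter_filter)
  finally have kq: "k * a * S ?\<beta> \<doteq> q" .
  obtain U where U: "U \<in> BF" "?w \<in> U" using BF_exists w(2) by blast
  have iso: "act (G (\<nu> \<cdot> \<tau>) * S ?\<beta>) (delta U) =
      (\<lambda>V. zpow (expo (dg ?\<beta>) - expo (dg (\<nu> \<cdot> \<tau>))) * delta U V)" if n: "\<nu> \<in> J \<tau>" for \<nu>
  proof -
    have nX: "\<nu> \<in> X" using n by (simp add: J_def)
    have wn: "sr (\<nu> \<cdot> \<tau>) \<in> U" "sr (\<nu> \<cdot> \<tau>) = sr ?\<beta>" using XM(4)[OF nX] U(2) \<beta>M by simp_all
    have "prepend (\<nu> \<cdot> \<tau>) U = prepend ?\<beta> U"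
      using prepend_eq_of_compat[OF U(1) XM(3)[OF nX] \<beta>M(1) wn(2,1)] stable[OF n] XM(4)[OF nX] by simp
    then show ?thesis using act_isotropy[OF XM(3)[OF nX] \<beta>M(1) wn(2) U(1) wn(1)] by blast
  qed
  define P where "P = (\<Sum>\<nu>\<in>J \<tau>. Poly_Mapping.single 0 (c \<nu>) * zpow (expo (dg ?\<beta>) - expo (dg (\<nu> \<cdot> \<tau>))))"
  have actq: "act q (delta U) = (\<lambda>V. P * delta U V)"
    unfolding q_def P_def act_sum act_scalar sum_distrib_right
    by (intro ext sum.cong) (simp_all add: iso mult.assoc)
  have deg_eq: "dg (\<nu> \<cdot> \<tau>) = dg ?\<beta> \<longleftrightarrow> \<nu> = \<nu>\<^sub>1" if n: "\<nu> \<in> J \<tau>" for \<nu>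
  proof
    assume "dg (\<nu> \<cdot> \<tau>) = dg ?\<beta>"
    moreover have nX: "\<nu> \<in> X" "compat (\<nu> \<cdot> \<tau>) ?\<beta>" using n by (simp_all add: J_def)
    ultimately have "\<nu> \<cdot> \<tau> = ?\<beta>" using compat_eq_deg by blast
    then show "\<nu> = \<nu>\<^sub>1" using comp_cancel_right t(1) XM(1,2)[OF nX(1)] XM(1,2)[OF n1] by blast
  qed simp
  have "Poly_Mapping.lookup (Poly_Mapping.single 0 (c \<nu>) * zpow (expo (dg ?\<beta>) - expo (dg (\<nu> \<cdot> \<tau>)))) 0
      = (if \<nu> = \<nu>\<^sub>1 then c \<nu>\<^sub>1 else 0)" if "\<nu> \<in> J \<tau>" for \<nu>
    using deg_eq[OF that] by (auto simp: zpow_def mult_single lookup_single when_def)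
  then have "Poly_Mapping.lookup P 0 = c \<nu>\<^sub>1" unfolding P_def using J1 Jfin by (simp add: lookup_sum)
  then have P0: "P \<noteq> 0" using Xc n1 by auto
  have qN: "q \<in> N" unfolding q_def using \<beta>M(1) XM(3) by (intro N_sum) (simp add: J_def)
  have "act q (delta U) U \<noteq> 0" using P0 by (simp add: actq delta_def)
  then have q0: "\<not> q \<doteq> 0" using act_eqv[of q 0 "delta U"] by auto
  have ka\<beta>: "\<not> k * a * S ?\<beta> \<doteq> 0" using q0 kq eqv_sym eqv_trans by blast
  then have ka: "\<not> k * a \<doteq> 0" using eqv_zero_right \<beta>M by auto
  have "simple (k * a)" using simple_left[OF a(2,1) kN ka] .
  then have "simple (k * a * S ?\<beta>)" using simple_right[OF _ kaN _ ka\<beta>] \<beta>M by simp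
  then have sq: "simple q" using simple_eqv[OF kq] by blast
  (* A second survivor would act on the point mass at U as a monomial other than 1. *)
  have "J \<tau> = {\<nu>\<^sub>1}"
  proof (rule ccontr)
    assume "J \<tau> \<noteq> {\<nu>\<^sub>1}"
    then obtain \<nu> where n: "\<nu> \<in> J \<tau>" "\<nu> \<noteq> \<nu>\<^sub>1" using J1 by blast
    define z where "z = expo (dg ?\<beta>) - expo (dg (\<nu> \<cdot> \<tau>))"
    have "z \<noteq> 0" using deg_eq[OF n(1)] n(2) by (auto simp: z_def)
    moreover have "act (G (\<nu> \<cdot> \<tau>) * S ?\<beta> - S ?w) (delta U) = (\<lambda>V. (zpow z - 1) * delta U V)"
      using U by (auto simp: act_diff iso[OF n(1)] act_vertex[OF w(1)] z_def delta_def left_diff_distrib)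
    moreover have "G (\<nu> \<cdot> \<tau>) * S ?\<beta> - S ?w \<in> N"
    proof -
      have "\<nu> \<cdot> \<tau> \<in> M" using XM(3) n(1) by (simp add: J_def)
      then show ?thesis using \<beta>M w by simp
    qed
    ultimately have "\<not> simple q" using not_simple_of_monomial[OF qN _ P0 _ actq] by blast
    then show False using sq by simp
  qed
  then have "q = sc (c \<nu>\<^sub>1) * (G ?\<beta> * S ?\<beta>)" by (simp add: q_def)
  moreover have "sc (c \<nu>\<^sub>1) * (G ?\<beta> * S ?\<beta>) \<doteq> sc (c \<nu>\<^sub>1) * S ?w"
    using G_S_self[OF \<beta>M(1)] \<beta>M(2) by (intro eqv_left) simp_all
  ultimately have "simple (sc (c \<nu>\<^sub>1) * S ?w)" using simple_eqv sq by simp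
  moreover have inv: "sc (c \<nu>\<^sub>1) * S ?w * sc (inverse (c \<nu>\<^sub>1)) = S ?w"
  proof -
    have "sc (c \<nu>\<^sub>1) * S ?w * sc (inverse (c \<nu>\<^sub>1)) = sc (inverse (c \<nu>\<^sub>1)) * (sc (c \<nu>\<^sub>1) * S ?w)"
      by (rule sc_commute[symmetric])
    also have "\<dots> = sc (inverse (c \<nu>\<^sub>1) * c \<nu>\<^sub>1) * S ?w" by (simp only: sc_mult[symmetric] mult.assoc)
    also have "\<dots> = S ?w" using Xc n1 by simp
    finally show ?thesis .
  qed
  ultimately have "simple (S ?w)"
    using simple_right[of "sc (c \<nu>\<^sub>1) * S ?w" "sc (inverse (c \<nu>\<^sub>1))"] vertex_nonzero[OF w(1)] w(2) by simp
  then have "?w \<in> line_points \<Lambda>" using simple_vertex_iff w(1) by blast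
  moreover have "S ?w * (k * a) \<doteq> k * a"
  proof -
    have "S ?w * G \<tau> * (G \<sigma> * a) \<doteq> G \<tau> * (G \<sigma> * a)" using G_src[OF t(1)] s aC by (intro eqv_right) simp_all
    then show ?thesis by (simp only: k_def mult.assoc)
  qed
  ultimately show ?thesis using kN ka by blast
qed

section \<open>Transfer to the Kumjian--Pask algebra\<close>

abbreviation A :: "('a, 'f) free set ring" where "A \<equiv> kp_algebra K \<Lambda>"
abbreviation cl :: "('a, 'f) free \<Rightarrow> ('a, 'f) free set" where "cl \<equiv> kp_class K \<Lambda>"

abbreviation LI :: "('a, 'f) free \<Rightarrow> ('a, 'f) free set set" where "LI f \<equiv> PIdl\<^bsub>A\<^esub> (cl f)"

lemma carrier_A: "carrier A = cl ` N"
  by (simp add: kp_algebra_def N_def)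

lemma cl_eq_iff: "f \<in> C \<Longrightarrow> g \<in> C \<Longrightarrow> cl f = cl g \<longleftrightarrow> f \<doteq> g"
  using ring.quotient_eq_iff_same_a_r_cos[OF ring_FA ideal_I, of f g]
  by (simp add: kp_class_def eqv_def a_minus_def FA_a_inv)

lemma cl_mult: "f \<in> C \<Longrightarrow> g \<in> C \<Longrightarrow> cl f \<otimes>\<^bsub>A\<^esub> cl g = cl (f * g)"
  using ideal.rcoset_mult_add[OF ideal_I, of f g] by (simp add: kp_class_def kp_algebra_def FactRing_def)

lemma cl_add: "f \<in> C \<Longrightarrow> g \<in> C \<Longrightarrow> cl f \<oplus>\<^bsub>A\<^esub> cl g = cl (f + g)"
  using ideal.a_rcos_sum[OF ideal_I, of f g] by (simp add: kp_class_def kp_algebra_def FactRing_def)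

lemma cl_zero: "\<zero>\<^bsub>A\<^esub> = cl 0"
  by (auto simp: kp_algebra_def FactRing_def kp_class_def a_r_coset_def')

lemma vertex_cl: "kp_vertex K \<Lambda> v = cl (S v)"
  by (simp add: kp_vertex_def)

lemma abelian_group_A: "abelian_group A"
proof (rule abelian_groupI)
  show "\<exists>y\<in>carrier A. y \<oplus>\<^bsub>A\<^esub> x = \<zero>\<^bsub>A\<^esub>" if x: "x \<in> carrier A" for x
  proof -
    obtain f where f: "f \<in> N" "x = cl f" using x by (auto simp: carrier_A)
    then have "cl (- f) \<oplus>\<^bsub>A\<^esub> x = \<zero>\<^bsub>A\<^esub>" using N_C by (simp add: cl_add cl_zero)
    then show ?thesis using f by (intro bexI[of _ "cl (- f)"]) (simp_all add: carrier_A)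
  qed
qed (auto simp: carrier_A cl_add cl_zero N_C ac_simps)

lemma a_inv_A: "f \<in> N \<Longrightarrow> \<ominus>\<^bsub>A\<^esub> cl f = cl (- f)"
  using abelian_group.minus_equality[OF abelian_group_A, of "cl (- f)" "cl f"]
  by (simp add: carrier_A cl_add cl_zero N_C)

text \<open>Closure under negation comes for free because of local units: \<open>-f = (-e)f\<close>.\<close>

lemma left_ideal_iff:
  "left_ideal J A \<longleftrightarrow> J \<subseteq> carrier A \<and> J \<noteq> {} \<and> (\<forall>x\<in>J. \<forall>y\<in>J. x \<oplus>\<^bsub>A\<^esub> y \<in> J) \<and>
     (\<forall>a\<in>carrier A. \<forall>x\<in>J. a \<otimes>\<^bsub>A\<^esub> x \<in> J)" (is "_ \<longleftrightarrow> ?R")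
proof
  assume L: "left_ideal J A"
  then have "additive_subgroup J A" by (simp add: left_ideal_def)
  note J = additive_subgroup.a_subset[OF this] additive_subgroup.zero_closed[OF this]
    additive_subgroup.a_closed[OF this]
  have "\<forall>b\<in>carrier A. \<forall>x\<in>J. b \<otimes>\<^bsub>A\<^esub> x \<in> J" using L by (simp add: left_ideal_def)
  then show ?R using J(1,2) J(3) by blast
next
  assume R: ?R
  have neg: "\<ominus>\<^bsub>A\<^esub> x \<in> J" if x: "x \<in> J" for x
  proof -
    obtain f where f: "f \<in> N" "x = cl f" using R x by (auto simp: carrier_A)
    obtain V where V: "V \<subseteq> vertices \<Lambda>" "(\<Sum>v\<in>V. S v) * f \<doteq> f" using local_unit[OF f(1)] by metis
    define u where "u = (\<Sum>v\<in>V. S v)"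
    have u: "u \<in> N" unfolding u_def using V(1) vertex_rng_src(1) by (intro N_sum) auto
    have "- u * f = 0 - u * f" by simp
    also have "\<dots> \<doteq> 0 - f" using V(2) unfolding u_def by (intro eqv_diff) simp_all
    finally have "cl (- u) \<otimes>\<^bsub>A\<^esub> cl f = cl (- f)"
      using u f N_C by (simp add: cl_mult cl_eq_iff)
    then have "\<ominus>\<^bsub>A\<^esub> x = cl (- u) \<otimes>\<^bsub>A\<^esub> x" using f a_inv_A by simp
    moreover have "cl (- u) \<in> carrier A" using u by (simp add: carrier_A)
    ultimately show ?thesis using R x by simp
  qed
  have "subgroup J (add_monoid A)"
  proof (rule group.subgroupI)
    show "group (add_monoid A)" using abelian_group.a_group[OF abelian_group_A] .
    show "inv\<^bsub>add_monoid A\<^esub> x \<in> J" if "x \<in> J" for x using neg[OF that] by (simp add: a_inv_def)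
  qed (use R in auto)
  then show "left_ideal J A" using R by (simp add: left_ideal_def additive_subgroup_def)
qed

lemma PIdl_cl: "f \<in> N \<Longrightarrow> LI f = {cl (g * f) | g. g \<in> N}"
  unfolding cgenideal_def carrier_A using N_C by (auto simp: cl_mult) (metis cl_mult imageI)

lemma local_unit_N:
  assumes "f \<in> N" obtains u where "u \<in> N" "u * f \<doteq> f"
proof -
  obtain V where V: "V \<subseteq> vertices \<Lambda>" "(\<Sum>v\<in>V. S v) * f \<doteq> f" using local_unit[OF assms] by metis
  then have "(\<Sum>v\<in>V. S v) \<in> N" using vertex_rng_src(1) by (intro N_sum) auto
  then show thesis using that V(2) by blast
qed

lemma cl_in_PIdl: "f \<in> N \<Longrightarrow> cl f \<in> LI f"
proof -
  assume f: "f \<in> N"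
  then obtain u where "u \<in> N" "u * f \<doteq> f" using local_unit_N by blast
  then have "cl f = cl (u * f)" using f N_C eqv_sym by (simp add: cl_eq_iff)
  then show ?thesis unfolding PIdl_cl[OF f] using \<open>u \<in> N\<close> by blast
qed

lemma PIdl_left_ideal: "f \<in> N \<Longrightarrow> left_ideal (LI f) A"
proof -
  assume f: "f \<in> N"
  have "x \<oplus>\<^bsub>A\<^esub> y \<in> LI f" if xy: "x \<in> LI f" "y \<in> LI f" for x y
  proof -
    obtain g h where gh: "g \<in> N" "h \<in> N" "x = cl (g * f)" "y = cl (h * f)" using xy f by (auto simp: PIdl_cl)
    then have "x \<oplus>\<^bsub>A\<^esub> y = cl ((g + h) * f)" using f N_C by (simp add: cl_add distrib_right)
    then show ?thesis using f gh N_add by (auto simp: PIdl_cl)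
  qed
  moreover have "b \<otimes>\<^bsub>A\<^esub> x \<in> LI f" if bx: "b \<in> carrier A" "x \<in> LI f" for b x
  proof -
    obtain g h where gh: "g \<in> N" "h \<in> N" "b = cl h" "x = cl (g * f)" using bx f by (auto simp: PIdl_cl carrier_A)
    then have "b \<otimes>\<^bsub>A\<^esub> x = cl ((h * g) * f)" using f N_C by (simp add: cl_mult mult.assoc)
    moreover have "h * g \<in> N" using gh N_C by simp
    ultimately show ?thesis using f by (auto simp: PIdl_cl)
  qed
  moreover have "LI f \<subseteq> carrier A" using f N_C by (auto simp: PIdl_cl carrier_A)
  ultimately show ?thesis unfolding left_ideal_iff using cl_in_PIdl[OF f] by blast
qed

theorem minimal_left_ideal_iff_simple:
  assumes f: "f \<in> N"
  shows "minimal_left_ideal (LI f) A \<longleftrightarrow> simple f"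
proof
  assume m: "minimal_left_ideal (LI f) A"
  have nz: "\<not> f \<doteq> 0"
  proof
    assume z: "f \<doteq> 0"
    have "cl (g * f) = \<zero>\<^bsub>A\<^esub>" if "g \<in> N" for g
      using eqv_zero_left[OF z N_C[OF that]] N_C[OF that] N_C[OF f] by (simp add: cl_zero cl_eq_iff)
    then have "LI f \<subseteq> {\<zero>\<^bsub>A\<^esub>}" using f by (auto simp: PIdl_cl)
    then have "LI f = {\<zero>\<^bsub>A\<^esub>}"
      using cl_in_PIdl[OF f] by (metis empty_iff subset_singletonD)
    then show False using m by (simp add: minimal_left_ideal_def)
  qed
  show "simple f" unfolding simple_def
  proof (intro conjI ballI impI)
    fix g assume g: "g \<in> N" "\<not> g * f \<doteq> 0"
    have gf: "g * f \<in> N" using f g(1) N_C by simp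
    have "LI (g * f) \<subseteq> LI f"
    proof
      fix x assume "x \<in> LI (g * f)"
      then obtain h where h: "h \<in> N" "x = cl ((h * g) * f)" using gf by (auto simp: PIdl_cl mult.assoc)
      moreover have "h * g \<in> N" using h g N_C by simp
      ultimately show "x \<in> LI f" using f by (auto simp: PIdl_cl)
    qed
    then have "LI (g * f) = {\<zero>\<^bsub>A\<^esub>} \<or> LI (g * f) = LI f"
      using m PIdl_left_ideal[OF gf] unfolding minimal_left_ideal_def by blast
    moreover have "cl (g * f) \<noteq> \<zero>\<^bsub>A\<^esub>" using g(2) N_C[OF gf] by (simp add: cl_zero cl_eq_iff)
    ultimately have "cl f \<in> LI (g * f)" using cl_in_PIdl[OF f] cl_in_PIdl[OF gf] by auto
    then obtain h where h: "h \<in> N" "cl f = cl (h * (g * f))" using gf by (auto simp: PIdl_cl)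
    then have "f \<doteq> h * (g * f)" using N_C f gf by (simp add: cl_eq_iff)
    then show "\<exists>h\<in>N. f \<doteq> h * (g * f)" using h(1) by blast
  qed (rule nz)
next
  assume s: "simple f"
  show "minimal_left_ideal (LI f) A" unfolding minimal_left_ideal_def
  proof (intro conjI allI impI)
    show "left_ideal (LI f) A" using PIdl_left_ideal[OF f] .
    have "cl f \<noteq> \<zero>\<^bsub>A\<^esub>" using s N_C[OF f] by (simp add: simple_def cl_zero cl_eq_iff)
    then show "LI f \<noteq> {\<zero>\<^bsub>A\<^esub>}" using cl_in_PIdl[OF f] by blast
    fix J assume J: "left_ideal J A \<and> J \<subseteq> LI f"
    show "J = {\<zero>\<^bsub>A\<^esub>} \<or> J = LI f"
    proof (cases "J \<subseteq> {\<zero>\<^bsub>A\<^esub>}")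
      case True
      moreover have "J \<noteq> {}" using J by (simp add: left_ideal_iff)
      ultimately show ?thesis by (metis subset_singletonD)
    next
      case False
      then obtain x where x: "x \<in> J" "x \<noteq> \<zero>\<^bsub>A\<^esub>" by blast
      then obtain g where g: "g \<in> N" "x = cl (g * f)" using J f by (auto simp: PIdl_cl)
      have gf: "g * f \<in> N" using f g(1) N_C by simp
      have "\<not> g * f \<doteq> 0" using x(2) g(2) N_C[OF gf] by (simp add: cl_zero cl_eq_iff)
      then obtain h where h: "h \<in> N" "f \<doteq> h * (g * f)" using s g(1) unfolding simple_def by blast
      have JM: "b \<otimes>\<^bsub>A\<^esub> y \<in> J" if "b \<in> carrier A" "y \<in> J" for b y using J that by (simp add: left_ideal_def)
      have "cl f = cl h \<otimes>\<^bsub>A\<^esub> x" using h g N_C gf f by (simp add: cl_mult cl_eq_iff)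
      then have fJ: "cl f \<in> J" using JM[OF _ x(1)] h(1) by (simp add: carrier_A)
      have "LI f \<subseteq> J" unfolding cgenideal_def using JM fJ by blast
      then show ?thesis using J by blast
    qed
  qed
qed

text \<open>Right multiplication by a nonzero element \<open>ka\<close> of \<open>pAa\<close> is a homomorphism between the
  simple modules \<open>Ap\<close> and \<open>Aa\<close>, hence an isomorphism.\<close>

lemma isomorphic_of_simple:
  assumes p: "p \<in> N" "simple p" and a: "a \<in> N" "simple a"
    and k: "k \<in> N" "p * (k * a) \<doteq> k * a" "\<not> k * a \<doteq> 0"
  shows "left_module_isomorphic A (LI p) (LI a)"
proof -
  define g where "g = k * a"
  have g: "g \<in> N" "g \<in> C" "p * g \<doteq> g" "\<not> g \<doteq> 0" using k a N_C by (simp_all add: g_def)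
  have pC: "p \<in> C" "a \<in> C" "k \<in> C" using p a k N_C by simp_all
  obtain k' where k': "k' \<in> N" "a \<doteq> k' * g" using a(2) k g_def unfolding simple_def by blast
  define \<phi> where "\<phi> = (\<lambda>x. x \<otimes>\<^bsub>A\<^esub> cl g)"
  have \<phi>: "\<phi> (cl (h * p)) = cl (h * g)" if "h \<in> N" for h
  proof -
    have "h * p * g \<doteq> h * g" using eqv_left[OF g(3) N_C[OF that]] by (simp only: mult.assoc)
    then show ?thesis using N_C[OF that] pC g(2) by (simp add: \<phi>_def cl_mult cl_eq_iff)
  qed
  have car: "LI p \<subseteq> carrier A" using PIdl_left_ideal[OF p(1)] by (simp add: left_ideal_iff)
  have "inj_on \<phi> (LI p)"
  proof (rule inj_onI)
    fix x y assume "x \<in> LI p" "y \<in> LI p" and eq: "\<phi> x = \<phi> y"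
    then obtain h h' where h: "h \<in> N" "x = cl (h * p)" "h' \<in> N" "y = cl (h' * p)"
      using p(1) by (auto simp: PIdl_cl)
    have hC: "h \<in> C" "h' \<in> C" using h N_C by simp_all
    have "h * g \<doteq> h' * g" using eq h hC g(2) by (simp add: \<phi> cl_eq_iff)
    then have "h * g - h' * g \<doteq> h' * g - h' * g" using hC g(2) by (intro eqv_diff) simp_all
    then have dg: "(h - h') * g \<doteq> 0" by (simp add: left_diff_distrib)
    have "(h - h') * p \<doteq> 0"
    proof (rule ccontr)
      assume "\<not> (h - h') * p \<doteq> 0"
      moreover have "h - h' \<in> N" using h by simp
      ultimately obtain l where l: "l \<in> N" "p \<doteq> l * ((h - h') * p)"
        using p(2) unfolding simple_def by blast
      have lC: "l \<in> C" using l N_C by simp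
      have "g \<doteq> p * g" using g(3) by (rule eqv_sym)
      also have "\<dots> \<doteq> l * ((h - h') * p) * g" using l(2) g(2) by (rule eqv_right)
      also have "\<dots> = l * (h - h') * (p * g)" by (simp only: mult.assoc)
      also have "\<dots> \<doteq> l * (h - h') * g" using g(3) lC hC by (intro eqv_left) simp_all
      also have "\<dots> = l * ((h - h') * g)" by (simp only: mult.assoc)
      also have "\<dots> \<doteq> 0" using eqv_zero_left[OF dg lC] .
      finally show False using g(4) by simp
    qed
    then have "(h - h') * p + h' * p \<doteq> 0 + h' * p" using hC pC by (intro eqv_add) simp_all
    then have "h * p \<doteq> h' * p" by (simp add: left_diff_distrib)
    then show "x = y" using h hC pC by (simp add: cl_eq_iff)
  qed
  moreover have "\<phi> ` (LI p) = LI a"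
  proof (intro equalityI subsetI)
    fix y assume "y \<in> \<phi> ` (LI p)"
    then obtain h where h: "h \<in> N" "y = cl ((h * k) * a)"
      using p(1) \<phi> by (auto simp: PIdl_cl g_def mult.assoc)
    moreover have "h * k \<in> N" using h(1) pC by simp
    ultimately show "y \<in> LI a" using a(1) by (auto simp: PIdl_cl)
  next
    fix y assume "y \<in> LI a"
    then obtain h where h: "h \<in> N" "y = cl (h * a)" using a(1) by (auto simp: PIdl_cl)
    have "h * a \<doteq> h * (k' * g)" using k'(2) N_C[OF h(1)] by (rule eqv_left)
    then have "y = cl ((h * k') * g)" using h N_C k' g pC by (simp add: cl_eq_iff mult.assoc)
    moreover have hk: "h * k' \<in> N" using h k' N_C by simp
    ultimately have "y = \<phi> (cl ((h * k') * p))" using \<phi> by simp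
    moreover have "cl ((h * k') * p) \<in> LI p" using hk p(1) by (auto simp: PIdl_cl)
    ultimately show "y \<in> \<phi> ` (LI p)" by blast
  qed
  ultimately have "bij_betw \<phi> (LI p) (LI a)" by (simp add: bij_betw_def)
  moreover have "\<phi> (x \<oplus>\<^bsub>A\<^esub> y) = \<phi> x \<oplus>\<^bsub>A\<^esub> \<phi> y" if xy: "x \<in> carrier A" "y \<in> carrier A" for x y
  proof -
    obtain h h' where "x = cl h" "y = cl h'" "h \<in> C" "h' \<in> C" using xy N_C by (auto simp: carrier_A)
    then show ?thesis using g(2) by (simp add: \<phi>_def cl_add cl_mult distrib_right)
  qed
  moreover have "\<phi> (b \<otimes>\<^bsub>A\<^esub> x) = b \<otimes>\<^bsub>A\<^esub> \<phi> x" if bx: "b \<in> carrier A" "x \<in> carrier A" for b x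
  proof -
    obtain h h' where "b = cl h" "x = cl h'" "h \<in> C" "h' \<in> C" using bx N_C by (auto simp: carrier_A)
    then show ?thesis using g(2) by (simp add: \<phi>_def cl_mult mult.assoc)
  qed
  ultimately show ?thesis unfolding left_module_isomorphic_def using car by blast
qed

text \<open>The image of \<open>cl p\<close> under the isomorphism generates \<open>Aa\<close>, so the way back from \<open>hp\<close> to \<open>p\<close>
  carries over to \<open>a\<close>.\<close>

lemma simple_of_isomorphic:
  assumes p: "p \<in> N" "simple p" and a: "a \<in> N"
    and iso: "left_module_isomorphic A (LI p) (LI a)"
  shows "simple a"
proof -
  obtain \<phi> where bij: "bij_betw \<phi> (LI p) (LI a)"
    and lin: "\<And>b x. b \<in> carrier A \<Longrightarrow> x \<in> LI p \<Longrightarrow> \<phi> (b \<otimes>\<^bsub>A\<^esub> x) = b \<otimes>\<^bsub>A\<^esub> \<phi> x"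
    using iso unfolding left_module_isomorphic_def by blast
  have C: "p \<in> C" "a \<in> C" using p a N_C by simp_all
  have pp: "cl p \<in> LI p" using cl_in_PIdl[OF p(1)] .
  then have "\<phi> (cl p) \<in> LI a" using bij by (auto simp: bij_betw_def)
  then obtain k where k: "k \<in> N" "\<phi> (cl p) = cl (k * a)" using a by (auto simp: PIdl_cl)
  have \<phi>: "\<phi> (cl (h * p)) = cl (h * (k * a))" if "h \<in> N" for h
    using lin[of "cl h", OF _ pp] that k C N_C by (simp add: carrier_A cl_mult)
  have hit: "\<exists>h\<in>N. cl (g * a) = cl (h * (k * a))" if g: "g \<in> N" for g
  proof -
    have "cl (g * a) \<in> \<phi> ` (LI p)" using bij g a by (auto simp: bij_betw_def PIdl_cl)
    then show ?thesis using p(1) \<phi> by (auto simp: PIdl_cl)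
  qed
  show ?thesis unfolding simple_def
  proof (intro conjI ballI impI notI)
    assume z: "a \<doteq> 0"
    have "k * a \<doteq> 0" "0 * (k * a) \<doteq> 0" using eqv_zero_left[OF z] N_C[OF k(1)] by simp_all
    then have "\<phi> (cl p) = \<phi> (cl (0 * p))" using k \<phi>[of 0] C N_C by (simp add: cl_eq_iff)
    moreover have "cl (0 * p) \<in> LI p" using p(1) N_zero by (auto simp: PIdl_cl simp del: mult_zero_left)
    ultimately have "cl p = cl (0 * p)" using bij pp by (auto simp: bij_betw_def dest: inj_onD)
    then show False using p(2) C by (simp add: simple_def cl_eq_iff)
  next
    fix g assume g: "g \<in> N" "\<not> g * a \<doteq> 0"
    obtain h where h: "h \<in> N" "cl (g * a) = cl (h * (k * a))" using hit[OF g(1)] by blast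
    have GC: "g \<in> C" "h \<in> C" "k \<in> C" using g h k N_C by simp_all
    have "\<not> h * p \<doteq> 0"
    proof
      assume "h * p \<doteq> 0"
      then have "cl (h * p) = cl (0 * p)" using GC C by (simp add: cl_eq_iff)
      then have "\<phi> (cl (h * p)) = \<phi> (cl (0 * p))" by (rule arg_cong)
      then have "cl (g * a) = cl 0" using h \<phi>[OF h(1)] \<phi>[of 0] by simp
      then show False using g(2) GC C by (simp add: cl_eq_iff)
    qed
    then obtain l where l: "l \<in> N" "p \<doteq> l * (h * p)" using p(2) h(1) unfolding simple_def by blast
    have lC: "l \<in> C" using l N_C by simp
    have "cl (k * a) = \<phi> (cl ((l * h) * p))"
      using k(2) l(2) lC GC C by (simp add: cl_eq_iff[THEN iffD2, of p "l * (h * p)"] mult.assoc)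
    also have "\<dots> = cl (l * h * (k * a))" using \<phi>[of "l * h"] h(1) lC by simp
    finally have kla: "k * a \<doteq> l * (h * (k * a))" using lC GC C by (simp add: cl_eq_iff mult.assoc)
    obtain u where u: "u \<in> N" "u * a \<doteq> a" using local_unit_N[OF a] by blast
    obtain m where m: "m \<in> N" "cl (u * a) = cl (m * (k * a))" using hit[OF u(1)] by blast
    have uC: "u \<in> C" "m \<in> C" using u m N_C by simp_all
    have "g * a \<doteq> h * (k * a)" using h(2) GC C by (simp add: cl_eq_iff)
    then have "l * (h * (k * a)) \<doteq> l * (g * a)" using eqv_sym lC by (intro eqv_left)
    then have kg: "k * a \<doteq> l * (g * a)" using kla eqv_trans by blast
    have "a \<doteq> u * a" using u(2) by (rule eqv_sym)
    also have "\<dots> \<doteq> m * (k * a)" using m(2) uC GC C by (simp add: cl_eq_iff)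
    also have "\<dots> \<doteq> m * (l * (g * a))" using kg uC(2) by (rule eqv_left)
    finally have "a \<doteq> (m * l) * (g * a)" by (simp only: mult.assoc)
    moreover have "m * l \<in> N" using m l lC N_C by simp
    ultimately show "\<exists>h\<in>N. a \<doteq> h * (g * a)" by blast
  qed
qed

end

theorem corollary3p15:
  fixes \<Lambda> :: "('a, 'k::finite) kgraph"
    and K :: "'f::field itself"
  assumes "k_graph \<Lambda>" and "finitely_aligned \<Lambda>"
  shows "(\<forall>v\<in>vertices \<Lambda>.
           minimal_left_ideal (PIdl\<^bsub>kp_algebra K \<Lambda>\<^esub> (kp_vertex K \<Lambda> v)) (kp_algebra K \<Lambda>)
             \<longleftrightarrow> v \<in> line_points \<Lambda>) \<and>
         (\<forall>a\<in>carrier (kp_algebra K \<Lambda>).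
           minimal_left_ideal (PIdl\<^bsub>kp_algebra K \<Lambda>\<^esub> a) (kp_algebra K \<Lambda>)
             \<longleftrightarrow> (\<exists>v\<in>line_points \<Lambda>. left_module_isomorphic (kp_algebra K \<Lambda>)
                    (PIdl\<^bsub>kp_algebra K \<Lambda>\<^esub> (kp_vertex K \<Lambda> v)) (PIdl\<^bsub>kp_algebra K \<Lambda>\<^esub> a)))"
proof -
  interpret k_graph \<Lambda> by fact
  interpret kumjian_pask \<Lambda> K by unfold_locales fact
  have vert: "S v \<in> N" "simple (S v)" if "v \<in> line_points \<Lambda>" for v
  proof -
    have "v \<in> vertices \<Lambda>" using that by (simp add: line_points_def)
    then show "S v \<in> N" "simple (S v)" using vertex_rng_src(1) simple_vertex_iff that by simp_all
  qed
  show ?thesis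
  proof (intro conjI ballI)
    fix v assume v: "v \<in> vertices \<Lambda>"
    then have "S v \<in> N" using vertex_rng_src(1) by simp
    then show "minimal_left_ideal (PIdl\<^bsub>A\<^esub> (kp_vertex K \<Lambda> v)) A \<longleftrightarrow> v \<in> line_points \<Lambda>"
      unfolding vertex_cl using minimal_left_ideal_iff_simple simple_vertex_iff[OF v] by blast
  next
    fix b assume "b \<in> carrier A"
    then obtain a where a: "a \<in> N" "b = cl a" by (auto simp: carrier_A)
    show "minimal_left_ideal (PIdl\<^bsub>A\<^esub> b) A \<longleftrightarrow>
      (\<exists>v\<in>line_points \<Lambda>. left_module_isomorphic A (PIdl\<^bsub>A\<^esub> (kp_vertex K \<Lambda> v)) (PIdl\<^bsub>A\<^esub> b))"
      unfolding a(2) vertex_cl minimal_left_ideal_iff_simple[OF a(1)]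
      using simple_reaches_line_point[OF a(1)] vert isomorphic_of_simple[OF _ _ a(1)]
        simple_of_isomorphic[OF _ _ a(1)] by blast
  qed
qed

end
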